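(* Let $d\ge 2$ and let $\mathbf{K}$ be a compact set of Borel probability measures on $\mathrm{SL}(d,\mathbb{R})$. Assume that the following hold: (finite moment condition) there exist $\gamma>0$ and $C$ such that for every $\mu\in\mathbf{K}$ one has $\int_{\mathrm{SL}(d,\mathbb{R})}\|A\|^{\gamma}\,d\mu(A)<C$; (measures condition) for every $\mu\in\mathbf{K}$ there are no Borel probability measures $\nu_1,\nu_2$ on $\mathbb{RP}^{d-1}$ such that $(f_A)_*\nu_1=\nu_2$ for $\mu$-almost every $A\in\mathrm{SL}(d,\mathbb{R})$; (spaces condition) for every $\mu\in\mathbf{K}$ there are no two nonempty finite unions $U,U'$ of proper nonzero subspaces of $\mathbb{R}^d$ such that $A(U)=U'$ for $\mu$-almost every $A\in\mathrm{SL}(d,\mathbb{R})$. Then: (1) there exists $\lambda>0$ such that for any $n\in\mathbb{N}$ and any $\mu_1,\dots,\mu_n\in\mathbf{K}$ one has $L_n\ge n\lambda$; (2) for any sequence $(\mu_i)_{i\in\mathbb{N}}$ with $\mu_i\in\mathbf{K}$, almost surely $$\lim_{n\to\infty}\frac1n\bigl(\log\|T_n\|-L_n\bigr)=0 .$$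
   Context: Compactness of $\mathbf{K}$ is with respect to the topology of weak-$*$ (weak) convergence of probability measures. $\|A\|$ is the operator norm of $A$ for the Euclidean norm on $\mathbb{R}^d$. For $A\in\mathrm{SL}(d,\mathbb{R})$, $f_A:\mathbb{RP}^{d-1}\to\mathbb{RP}^{d-1}$ is the induced projective transformation. Given $\mu_1,\mu_2,\dots\in\mathbf{K}$, the matrices $A_i$ are chosen independently at random, $A_i$ having distribution $\mu_i$; $T_n=A_nA_{n-1}\cdots A_1$; and $L_n=\mathbb{E}\log\|T_n\|$, the expectation being over $\mu_1\times\dots\times\mu_n$. "Almost surely" refers to the product measure $\prod_i\mu_i$. *)

theory Defs
  imports "HOL-Probability.Probability"
begin

section \<open>Borel probability measures and their weak topology\<close>

definition borel_of :: "'a topology \<Rightarrow> 'a measure" where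
  "borel_of X = sigma (topspace X) {U. openin X U}"

definition borel_prob_measures :: "'a topology \<Rightarrow> 'a measure set" where
  "borel_prob_measures X = {M. prob_space M \<and> sets M = sets (borel_of X)}"

text \<open>The coarsest topology on the Borel probability measures on \<open>X\<close> that makes
  \<open>M \<mapsto> \<integral> f dM\<close> continuous for every bounded continuous real function \<open>f\<close> on \<open>X\<close>.\<close>

definition weak_topology :: "'a topology \<Rightarrow> 'a measure topology" where
  "weak_topology X = topology_generated_by
     {{M \<in> borel_prob_measures X. (\<integral>x. f x \<partial>M) \<in> U} | (f :: 'a \<Rightarrow> real) U.
        continuous_map X euclideanreal f \<and> bounded (f ` topspace X) \<and> open U}"

lemma topspace_weak_topology [simp]: "topspace (weak_topology X) = borel_prob_measures X"
proof -
  have "borel_prob_measures X \<in>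
     {{M \<in> borel_prob_measures X. (\<integral>x. f x \<partial>M) \<in> U} | (f :: 'a \<Rightarrow> real) U.
        continuous_map X euclideanreal f \<and> bounded (f ` topspace X) \<and> open U}"
    by (rule CollectI, rule exI[of _ "\<lambda>_. 0"], rule exI[of _ UNIV])
       (auto simp: image_constant_conv)
  then show ?thesis
    unfolding weak_topology_def topology_generated_by_topspace by blast
qed


section \<open>The special linear group and real projective space\<close>

definition SL :: "(real ^ 'n ^ 'n) set" where
  "SL = {A. det A = 1}"

text \<open>Points of the projective space are the lines through the origin; it carries the
  quotient topology of the map \<open>v \<mapsto> span {v}\<close> on the nonzero vectors.\<close>

definition proj_space :: "(real ^ 'n) set set" where
  "proj_space = {span {v} | v. v \<noteq> 0}"

definition proj_topology :: "(real ^ 'n) set topology" where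
  "proj_topology = topology (\<lambda>U. U \<subseteq> proj_space \<and> open {v. v \<noteq> 0 \<and> span {v} \<in> U})"

lemma istopology_proj:
  "istopology (\<lambda>U. U \<subseteq> (proj_space :: (real ^ 'n) set set) \<and> open {v. v \<noteq> 0 \<and> span {v} \<in> U})"
proof -
  have "{v. v \<noteq> 0 \<and> span {v} \<in> S \<inter> T} = {v. v \<noteq> 0 \<and> span {v} \<in> S} \<inter> {v. v \<noteq> 0 \<and> span {v} \<in> T}"
    for S T :: "(real ^ 'n) set set"
    by auto
  moreover have "{v. v \<noteq> 0 \<and> span {v} \<in> \<Union>\<K>} = (\<Union>S\<in>\<K>. {v. v \<noteq> 0 \<and> span {v} \<in> S})"
    for \<K> :: "(real ^ 'n) set set set"
    by auto
  ultimately show ?thesis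
    unfolding istopology_def by (auto simp: open_Int)
qed

lemma openin_proj_topology:
  "openin proj_topology U \<longleftrightarrow> U \<subseteq> proj_space \<and> open {v. v \<noteq> 0 \<and> span {v} \<in> U}"
  unfolding proj_topology_def topology_inverse'[OF istopology_proj] ..

lemma topspace_proj_topology [simp]: "topspace proj_topology = proj_space"
proof -
  have eq: "{v. v \<noteq> 0 \<and> span {v} \<in> proj_space} = - {0 :: real ^ 'n}"
    unfolding proj_space_def by blast
  then have "openin proj_topology (proj_space :: (real ^ 'n) set set)"
    unfolding openin_proj_topology eq by (intro conjI subset_refl open_Compl closed_singleton)
  then show ?thesis
    by (intro subset_antisym openin_subset) (use openin_proj_topology openin_topspace in blast)
qed

text \<open>For invertible \<open>A\<close>, the line \<open>l\<close> is sent to the line \<open>A l\<close>.\<close>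

definition proj_map :: "real ^ 'n ^ 'n \<Rightarrow> (real ^ 'n) set \<Rightarrow> (real ^ 'n) set" where
  "proj_map A l = (*v) A ` l"

definition union_of_proper_subspaces :: "(real ^ 'n) set \<Rightarrow> bool" where
  "union_of_proper_subspaces U \<longleftrightarrow>
     (\<exists>F. finite F \<and> F \<noteq> {} \<and> (\<forall>V\<in>F. subspace V \<and> V \<noteq> {0} \<and> V \<noteq> UNIV) \<and> U = \<Union>F)"


section \<open>Random matrix products\<close>

definition op_norm :: "real ^ 'n ^ 'n \<Rightarrow> real" where
  "op_norm A = onorm ((*v) A)"

text \<open>\<open>mat_prod A n = A n ** \<dots> ** A 1\<close>; the value \<open>A 0\<close> is never used.\<close>

fun mat_prod :: "(nat \<Rightarrow> real ^ 'n ^ 'n) \<Rightarrow> nat \<Rightarrow> real ^ 'n ^ 'n" where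
  "mat_prod A 0 = mat 1"
| "mat_prod A (Suc n) = A (Suc n) ** mat_prod A n"

definition expected_log_norm :: "(nat \<Rightarrow> (real ^ 'n ^ 'n) measure) \<Rightarrow> nat \<Rightarrow> real" where
  "expected_log_norm \<mu> n = (\<integral>A. ln (op_norm (mat_prod A n)) \<partial>(\<Pi>\<^sub>M i\<in>{1..n}. \<mu> i))"

end

theory Submission
  imports Defs
begin

text \<open>
  Write \<open>d\<close> for the dimension and \<open>T n = A n ** \<dots> ** A 1\<close> for the random product.

  The growth in part (1) comes from a spectral gap. A matrix of determinant one preserves Lebesgue
  measure, so \<open>g \<mapsto> g \<circ> A\<close> is unitary on the square integrable functions. Suppose that the
  averages of these operators over laws in \<open>K\<close> had norms arbitrarily close to one. Then there would
  be unit vectors \<open>f j\<close> and \<open>g j\<close> with \<open>g j \<circ> A\<close> close to \<open>f j\<close> for most \<open>A\<close>. The directions of random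
  vectors with densities \<open>(f j)\<^sup>2\<close> and \<open>(g j)\<^sup>2\<close> would converge to two measures, and almost every \<open>A\<close>,
  under a limit law in \<open>K\<close>, would carry the first to the second; the measures condition excludes this
  (\<open>no_almost_invariant_sequence\<close>, \<open>spectral_gap\<close>). So averaging over the law of \<open>T n\<close> contracts by a
  factor \<open>q ^ n\<close> with \<open>q < 1\<close>. The unit ball and its preimage under \<open>T n\<close> share a ball of radius
  \<open>1 / op_norm (T n)\<close>, hence the mean of \<open>op_norm (T n)\<close> to the power \<open>- d\<close> is at most \<open>q ^ n\<close>
  (\<open>norm_inverse_moment\<close>), and concavity of the logarithm gives linear growth
  (\<open>expected_log_norm_growth\<close>).

  Part (2) follows by the Borel--Cantelli lemma from exponentially small deviation probabilities
  (\<open>log_norm_deviation\<close>). Cut the product into blocks. Norms are submultiplicative, so bounds on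
  positive exponential moments of the logarithm of the norm multiply from block to block. In the
  other direction one follows a unit vector \<open>v\<close>: bounds on the moments of \<open>1 / norm (T n *v v)\<close>
  that are uniform in \<open>v\<close> multiply as well, and \<open>norm (T n *v v)\<close> bounds the norm of \<open>T n\<close> from below.
  The two rates agree up to \<open>\<epsilon>\<close> if in a block of large length \<open>m\<close> the expected logarithm of
  \<open>norm (T m *v v)\<close> falls short of that of the norm by at most \<open>\<epsilon> m\<close>, whatever \<open>v\<close> is (\<open>loss_bound\<close>).

  Much is lost only if, after a few steps, the direction of the vector is almost orthogonal to the
  direction that the rest of the block expands most. So random directions have to avoid
  neighbourhoods of hyperplanes, uniformly in the laws, the starting vector and the hyperplane
  (\<open>avoids_all\<close>). This is shown by induction on the dimension of the subspace to be avoided: a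
  failure produces, in the limit, laws of directions with an infinite past and a largest possible
  concentration on subspaces. The finitely many subspaces with this concentration at one time are
  then carried by almost every matrix onto those at the next time, against the spaces condition
  (\<open>no_ancient_concentration\<close>).

  All compactness arguments use limits along a free ultrafilter. Every sequence in a compact set has
  such a limit, so the limits of all laws along an infinite past are available simultaneously, and
  compactness of \<open>K\<close> in the weak topology can be used directly. What makes the limits compatible with
  the action of matrices on directions is that weak convergence of laws passes through integrals of
  continuously convergent functions (\<open>weak_limit_continuous_convergence\<close>).
\<close>

section \<open>Limits along a free ultrafilter\<close>

locale free_ultrafilter =
  fixes F :: "nat filter"
  assumes nontrivial: "F \<noteq> bot"
    and ultra: "eventually P F \<or> eventually (\<lambda>j. \<not> P j) F"
    and free: "F \<le> sequentially"

text \<open>By Zorn's lemma there is a minimal proper filter below \<open>sequentially\<close>; minimality forces it to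
  decide every property, since restricting it to an undecided one would make it smaller.\<close>

lemma free_ultrafilter_exists: "\<exists>F. free_ultrafilter F"
proof -
  define A where "A = {F :: nat filter. F \<noteq> bot \<and> F \<le> sequentially}"
  have "\<exists>m\<in>A. \<forall>a\<in>A. a \<le> m \<longrightarrow> a = m"
  proof (rule predicate_Zorn)
    show "partial_order_on A (relation_of (\<lambda>F G. G \<le> F) A)"
      by (rule partial_order_on_relation_ofI) auto
    fix C assume C: "C \<in> Chains (relation_of (\<lambda>F G :: nat filter. G \<le> F) A)"
    then have CA: "C \<subseteq> A" and chain: "\<And>F G. F \<in> C \<Longrightarrow> G \<in> C \<Longrightarrow> F \<le> G \<or> G \<le> F"
      unfolding Chains_def relation_of_def by auto
    show "\<exists>u\<in>A. \<forall>a\<in>C. u \<le> a"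
    proof (cases "C = {}")
      case True
      have "sequentially \<in> A" by (simp add: A_def)
      with True show ?thesis by blast
    next
      case False
      have "eventually P (Inf C) \<longleftrightarrow> (\<exists>b\<in>C. eventually P b)" for P
        by (rule eventually_Inf_base) (use False chain in \<open>auto simp: le_inf_iff\<close>)
      then have "Inf C \<noteq> bot"
        using CA unfolding trivial_limit_def A_def by auto
      moreover from False obtain G where "G \<in> C" by blast
      with CA have "Inf C \<le> G" "G \<le> sequentially"
        by (auto simp: A_def intro: Inf_lower)
      then have "Inf C \<le> sequentially" by (rule order_trans)
      ultimately have "Inf C \<in> A" by (simp add: A_def)
      then show ?thesis by (auto intro!: bexI[of _ "Inf C"] Inf_lower)
    qed
  qed
  then obtain F where F: "F \<in> A" and min: "\<And>G. G \<in> A \<Longrightarrow> G \<le> F \<Longrightarrow> G = F" by blast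
  have "eventually P F \<or> eventually (\<lambda>j. \<not> P j) F" for P
  proof (cases "inf F (principal {j. P j}) = bot")
    case True
    then have "eventually (\<lambda>j. \<not> P j) F"
      unfolding trivial_limit_def eventually_inf_principal by simp
    then show ?thesis ..
  next
    case False
    with F have "inf F (principal {j. P j}) \<in> A"
      unfolding A_def by (auto intro: le_infI1)
    from min[OF this] have "F = inf F (principal {j. P j})" by simp
    moreover have "eventually P (inf F (principal {j. P j}))"
      by (simp add: eventually_inf_principal)
    ultimately show ?thesis by simp
  qed
  with F show ?thesis
    by (intro exI[of _ F]) (auto simp: free_ultrafilter_def A_def)
qed

context free_ultrafilter
begin

lemma not_eventually_iff: "\<not> eventually P F \<longleftrightarrow> eventually (\<lambda>j. \<not> P j) F"
proof
  assume "eventually (\<lambda>j. \<not> P j) F"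
  moreover have False if "eventually P F" "eventually (\<lambda>j. \<not> P j) F"
    using eventually_conj[OF that] nontrivial by (simp add: trivial_limit_def)
  ultimately show "\<not> eventually P F" by blast
qed (use ultra in blast)

lemma eventually_at_least: "eventually (\<lambda>j. n \<le> j) F"
  using free eventually_ge_at_top[of n] by (rule filter_leD)

lemma tendsto_of_sequentially: "(x \<longlonglongrightarrow> l) \<Longrightarrow> (x \<longlongrightarrow> l) F"
  using free by (rule tendsto_mono)

lemma compact_limit:
  fixes x :: "nat \<Rightarrow> 'a :: topological_space"
  assumes "compact S" "eventually (\<lambda>j. x j \<in> S) F"
  shows "\<exists>l\<in>S. (x \<longlongrightarrow> l) F"
proof -
  have "filtermap x F \<noteq> bot" "eventually (\<lambda>y. y \<in> S) (filtermap x F)"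
    using nontrivial assms(2) by (auto simp: filtermap_bot_iff eventually_filtermap)
  then obtain l where l: "l \<in> S" "inf (nhds l) (filtermap x F) \<noteq> bot"
    using assms(1) unfolding compact_filter by blast
  have "(x \<longlongrightarrow> l) F"
  proof (rule topological_tendstoI, rule ccontr)
    fix U assume U: "open U" "l \<in> U" and "\<not> eventually (\<lambda>j. x j \<in> U) F"
    then have "eventually (\<lambda>y. y \<notin> U) (filtermap x F)"
      by (simp add: not_eventually_iff eventually_filtermap)
    moreover from U have "eventually (\<lambda>y. y \<in> U) (nhds l)"
      by (rule eventually_nhds_in_open)
    ultimately have "eventually (\<lambda>_. False) (inf (nhds l) (filtermap x F))"
      unfolding eventually_inf by blast
    with l(2) show False by (simp add: trivial_limit_def)
  qed
  with l(1) show ?thesis by blast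
qed

lemma bounded_limit:
  fixes x :: "nat \<Rightarrow> real"
  assumes "\<And>j. \<bar>x j\<bar> \<le> B"
  shows "\<exists>l. (x \<longlongrightarrow> l) F"
  using compact_limit[of "cball 0 B" x] assms by auto

text \<open>A countable family of properties that hold for almost every index can be realised at once
  along an unbounded sequence of family indices; this is the overspill principle of the ultrapower.\<close>

lemma diagonal:
  assumes "\<And>n :: nat. eventually (P n) F"
  shows "\<exists>k. eventually (\<lambda>j. P (k j) j) F \<and> (\<forall>n. eventually (\<lambda>j. n \<le> k j) F)"
proof -
  define k where "k j = Max {n. n \<le> j \<and> P n j}" for j
  have *: "P (k j) j \<and> n \<le> k j" if "n \<le> j" "P n j" for n j
  proof -
    have fin: "finite {n. n \<le> j \<and> P n j}" by simp
    moreover from that have "n \<in> {n. n \<le> j \<and> P n j}" by simp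
    ultimately show ?thesis
      using Max_in[of "{n. n \<le> j \<and> P n j}"] Max_ge[OF fin, of n] unfolding k_def by blast
  qed
  have "eventually (\<lambda>j. P (k j) j \<and> n \<le> k j) F" for n
    using eventually_at_least[of n] assms[of n] by eventually_elim (use * in blast)
  then show ?thesis by (intro exI[of _ k]) (auto simp: eventually_conj_iff)
qed

text \<open>If the limit were discontinuous at \<open>l\<close>, points \<open>y n\<close> tending to \<open>l\<close> with \<open>\<psi> (y n)\<close> far from \<open>\<psi> l\<close>
  could be diagonalised into a sequence along which \<open>\<phi> j\<close> stays close to the values \<open>\<psi> (y n)\<close>, although
  it should tend to \<open>\<psi> l\<close>.\<close>

lemma continuous_convergence_imp_continuous:
  fixes \<phi> :: "nat \<Rightarrow> 'a :: metric_space \<Rightarrow> 'b :: metric_space"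
  assumes conv: "\<And>x l. (\<And>j. x j \<in> S) \<Longrightarrow> l \<in> S \<Longrightarrow> (x \<longlongrightarrow> l) F \<Longrightarrow> ((\<lambda>j. \<phi> j (x j)) \<longlongrightarrow> \<psi> l) F"
  shows "continuous_on S \<psi>"
  unfolding continuous_on_iff
proof (rule ccontr)
  assume "\<not> (\<forall>x\<in>S. \<forall>e>0. \<exists>d>0. \<forall>x'\<in>S. dist x' x < d \<longrightarrow> dist (\<psi> x') (\<psi> x) < e)"
  then obtain l e where l: "l \<in> S" "e > 0"
    and "\<forall>d>0. \<exists>y\<in>S. dist y l < d \<and> \<not> dist (\<psi> y) (\<psi> l) < e"
    by blast
  then have "\<forall>n. \<exists>y\<in>S. dist y l < inverse (real (Suc n)) \<and> \<not> dist (\<psi> y) (\<psi> l) < e"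
    by simp
  then obtain y where y: "\<And>n. y n \<in> S" "\<And>n. dist (y n) l < inverse (real (Suc n))"
    "\<And>n. \<not> dist (\<psi> (y n)) (\<psi> l) < e"
    by metis
  have "eventually (\<lambda>j. dist (\<phi> j (y n)) (\<psi> (y n)) < e / 2) F" for n
    using conv[of "\<lambda>_. y n" "y n"] y(1) l(2) by (intro tendstoD) auto
  from diagonal[where P = "\<lambda>n j. dist (\<phi> j (y n)) (\<psi> (y n)) < e / 2", OF this]
  obtain k where
    k: "eventually (\<lambda>j. dist (\<phi> j (y (k j))) (\<psi> (y (k j))) < e / 2) F"
    "\<And>n. eventually (\<lambda>j. n \<le> k j) F"
    by blast
  have "filterlim k sequentially F"
    unfolding filterlim_at_top by (use k(2) in blast)
  moreover have "y \<longlonglongrightarrow> l"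
    by (rule metric_tendsto_imp_tendsto[OF LIMSEQ_inverse_real_of_nat])
      (use y(2) in \<open>auto intro!: always_eventually less_imp_le\<close>)
  ultimately have "((\<lambda>j. y (k j)) \<longlongrightarrow> l) F"
    by (rule filterlim_compose[rotated])
  from conv[OF _ l(1) this] y(1) have "((\<lambda>j. \<phi> j (y (k j))) \<longlongrightarrow> \<psi> l) F" by simp
  then have "eventually (\<lambda>j. dist (\<phi> j (y (k j))) (\<psi> l) < e / 2) F"
    using l(2) by (intro tendstoD) auto
  with k(1) have "eventually (\<lambda>j. False) F"
  proof eventually_elim
    case (elim j)
    then have "dist (\<psi> (y (k j))) (\<psi> l) < e"
      by (rule dist_triangle_half_r)
    with y(3) show False by blast
  qed
  with nontrivial show False by (simp add: trivial_limit_def)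
qed

end


section \<open>Weak limits of probability measures\<close>

lemma sets_borel_of_top_of_set:
  fixes S :: "'a :: topological_space set"
  assumes "S \<in> sets borel"
  shows "sets (borel_of (top_of_set S)) = sets (restrict_space borel S)"
proof -
  have "sets (borel_of (top_of_set S)) = sigma_sets S {U. openin (top_of_set S) U}"
    unfolding borel_of_def by (subst sets_measure_of) (auto dest: openin_imp_subset)
  also have "{U. openin (top_of_set S) U} = (\<inter>) S ` {U. open U}"
    by (auto simp: openin_open)
  also have "sigma_sets S \<dots> = (\<inter>) S ` sigma_sets UNIV {U. open U}"
    using assms by (intro sigma_sets_Int[symmetric]) (auto simp: borel_def)
  finally show ?thesis by (simp add: sets_restrict_space borel_def)
qed

lemma borel_prob_measuresD:
  fixes S :: "'a :: topological_space set"
  assumes "M \<in> borel_prob_measures (top_of_set S)" "closed S"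
  shows "prob_space M" "sets M = sets (restrict_space borel S)" "space M = S"
proof -
  show "prob_space M" "sets M = sets (restrict_space borel S)"
    using assms by (auto simp: borel_prob_measures_def sets_borel_of_top_of_set)
  from sets_eq_imp_space_eq[OF this(2)] show "space M = S"
    by (simp add: space_restrict_space)
qed

lemma borel_prob_measures_closedI:
  fixes S :: "'a :: topological_space set"
  assumes "closed S" "prob_space M" "sets M = sets (restrict_space borel S)"
  shows "M \<in> borel_prob_measures (top_of_set S)"
  using assms by (auto simp: borel_prob_measures_def sets_borel_of_top_of_set)

lemma measurable_borel_prob_measures:
  fixes S :: "'a :: topological_space set"
  assumes "M \<in> borel_prob_measures (top_of_set S)" "closed S"
    and "f \<in> measurable (restrict_space borel S) N"
  shows "f \<in> measurable M N"
  using assms(3) borel_prob_measuresD(2)[OF assms(1,2)] measurable_cong_sets by blast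

lemma borel_prob_measures_integrable:
  fixes S :: "'a :: topological_space set" and f :: "'a \<Rightarrow> real"
  assumes M: "M \<in> borel_prob_measures (top_of_set S)" "closed S"
    and f: "f \<in> borel_measurable (restrict_space borel S)" "\<And>x. x \<in> S \<Longrightarrow> \<bar>f x\<bar> \<le> B"
  shows "integrable M f"
proof -
  interpret prob_space M by (rule borel_prob_measuresD[OF M])
  show ?thesis
    by (rule integrable_const_bound[of _ B])
      (use f borel_prob_measuresD(3)[OF M] measurable_borel_prob_measures[OF M f(1)] in auto)
qed

lemma (in prob_space) integral_diff_le:
  fixes f g :: "'a \<Rightarrow> real"
  assumes "integrable M f" "integrable M g" "\<And>x. x \<in> space M \<Longrightarrow> \<bar>f x - g x\<bar> \<le> e"
  shows "\<bar>(\<integral>x. f x \<partial>M) - (\<integral>x. g x \<partial>M)\<bar> \<le> e"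
proof -
  have "\<bar>(\<integral>x. f x \<partial>M) - (\<integral>x. g x \<partial>M)\<bar> = \<bar>\<integral>x. f x - g x \<partial>M\<bar>"
    using assms by simp
  also have "\<dots> \<le> (\<integral>x. \<bar>f x - g x\<bar> \<partial>M)"
    by (rule integral_abs_bound)
  also have "\<dots> \<le> (\<integral>x. e \<partial>M)"
    using assms by (intro integral_mono) auto
  finally show ?thesis by (simp add: prob_space)
qed

context free_ultrafilter
begin

definition weak_limit :: "'a :: topological_space set \<Rightarrow> (nat \<Rightarrow> 'a measure) \<Rightarrow> 'a measure \<Rightarrow> bool" where
  "weak_limit S M N \<longleftrightarrow> (\<forall>f :: 'a \<Rightarrow> real. continuous_on S f \<longrightarrow> bounded (f ` S) \<longrightarrow>
     ((\<lambda>j. \<integral>x. f x \<partial>M j) \<longlongrightarrow> (\<integral>x. f x \<partial>N)) F)"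

text \<open>Compactness in the form that open covers have finite subcovers: if every \<open>N\<close> in \<open>K\<close> had a
  neighbourhood that \<open>M j\<close> avoids for almost all \<open>j\<close>, finitely many of these would cover \<open>K\<close>.\<close>

lemma compactin_weak_limit:
  assumes K: "compactin (weak_topology (top_of_set S)) K" and M: "\<And>j. M j \<in> K"
  shows "\<exists>N\<in>K. weak_limit S M N"
proof -
  let ?T = "weak_topology (top_of_set S)"
  have sub: "K \<subseteq> borel_prob_measures (top_of_set S)"
    using compactin_subset_topspace[OF K] by simp
  have "\<exists>N\<in>K. \<forall>U. openin ?T U \<longrightarrow> N \<in> U \<longrightarrow> eventually (\<lambda>j. M j \<in> U) F"
  proof (rule ccontr)
    assume "\<not> ?thesis"
    then obtain U where U: "\<And>N. N \<in> K \<Longrightarrow> openin ?T (U N)" "\<And>N. N \<in> K \<Longrightarrow> N \<in> U N"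
      "\<And>N. N \<in> K \<Longrightarrow> eventually (\<lambda>j. M j \<notin> U N) F"
      unfolding not_eventually_iff[symmetric] by metis
    have "\<exists>\<F>. finite \<F> \<and> \<F> \<subseteq> U ` K \<and> K \<subseteq> \<Union>\<F>"
      by (rule compactinD[OF K]) (use U in auto)
    then obtain G where G: "finite G" "G \<subseteq> K" "K \<subseteq> \<Union>(U ` G)"
      by (metis finite_subset_image)
    have "eventually (\<lambda>j. \<forall>N\<in>G. M j \<notin> U N) F"
      using G U(3) by (intro eventually_ball_finite) auto
    then have "eventually (\<lambda>j. False) F"
      by eventually_elim (use G(3) M in blast)
    with nontrivial show False by (simp add: trivial_limit_def)
  qed
  then obtain N where N: "N \<in> K" "\<And>U. openin ?T U \<Longrightarrow> N \<in> U \<Longrightarrow> eventually (\<lambda>j. M j \<in> U) F"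
    by blast
  have "((\<lambda>j. \<integral>x. f x \<partial>M j) \<longlongrightarrow> (\<integral>x. f x \<partial>N)) F"
    if f: "continuous_on S f" "bounded (f ` S)" for f :: "'a \<Rightarrow> real"
  proof (rule topological_tendstoI)
    fix U :: "real set" assume U: "open U" "(\<integral>x. f x \<partial>N) \<in> U"
    let ?V = "{M \<in> borel_prob_measures (top_of_set S). (\<integral>x. f x \<partial>M) \<in> U}"
    have "openin ?T ?V"
      unfolding weak_topology_def
      by (rule topology_generated_by_Basis)
        (use f U(1) in \<open>auto intro!: exI[of _ f] exI[of _ U]\<close>)
    moreover have "N \<in> ?V" using N(1) sub U(2) by blast
    ultimately have "eventually (\<lambda>j. M j \<in> ?V) F" by (rule N(2))
    then show "eventually (\<lambda>j. (\<integral>x. f x \<partial>M j) \<in> U) F" by eventually_elim simp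
  qed
  with N(1) show ?thesis unfolding weak_limit_def by blast
qed

text \<open>Continuous convergence is uniform on compact sets, and tightness makes the rest negligible. This
  is how a law and an integrand can be taken to the limit together.\<close>

lemma weak_limit_continuous_convergence:
  fixes S :: "'a :: {metric_space} set" and \<phi> :: "nat \<Rightarrow> 'a \<Rightarrow> real"
  assumes S: "closed S"
    and M: "\<And>j. M j \<in> borel_prob_measures (top_of_set S)" "N \<in> borel_prob_measures (top_of_set S)"
    and lim: "weak_limit S M N"
    and tight: "\<And>e. e > 0 \<Longrightarrow> \<exists>C. compact C \<and> C \<subseteq> S \<and> (\<forall>j. measure (M j) (S - C) \<le> e)"
    and meas: "\<And>j. \<phi> j \<in> borel_measurable (restrict_space borel S)"
    and bound: "\<And>j x. x \<in> S \<Longrightarrow> \<bar>\<phi> j x\<bar> \<le> B"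
    and conv: "\<And>x l. (\<And>j. x j \<in> S) \<Longrightarrow> l \<in> S \<Longrightarrow> (x \<longlongrightarrow> l) F \<Longrightarrow> ((\<lambda>j. \<phi> j (x j)) \<longlongrightarrow> \<psi> l) F"
  shows "((\<lambda>j. \<integral>x. \<phi> j x \<partial>M j) \<longlongrightarrow> (\<integral>x. \<psi> x \<partial>N)) F"
proof -
  have cont: "continuous_on S \<psi>"
    using conv by (rule continuous_convergence_imp_continuous)
  have bound': "\<bar>\<psi> l\<bar> \<le> B" if "l \<in> S" for l
  proof -
    have "((\<lambda>j. \<bar>\<phi> j l\<bar>) \<longlongrightarrow> \<bar>\<psi> l\<bar>) F"
      using conv[of "\<lambda>_. l" l] that by (intro tendsto_rabs) auto
    then show ?thesis
      by (rule tendsto_upperbound) (use bound that nontrivial in auto)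
  qed
  have "(\<psi> ` S) \<subseteq> cball 0 B" using bound' by auto
  then have bdd: "bounded (\<psi> ` S)" by (rule bounded_subset[OF bounded_cball])
  have meas': "\<psi> \<in> borel_measurable (restrict_space borel S)"
    using cont by (rule borel_measurable_continuous_on_restrict)
  have lim': "((\<lambda>j. \<integral>x. \<psi> x \<partial>M j) \<longlongrightarrow> (\<integral>x. \<psi> x \<partial>N)) F"
    using lim cont bdd unfolding weak_limit_def by blast
  have "((\<lambda>j. (\<integral>x. \<phi> j x \<partial>M j) - (\<integral>x. \<psi> x \<partial>M j)) \<longlongrightarrow> 0) F"
  proof (rule tendstoI)
    fix e :: real assume e: "e > 0"
    define e' where "e' = e / (2 * (2 * \<bar>B\<bar> + 1))"
    have e': "e' > 0" "2 * \<bar>B\<bar> * e' < e / 2"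
      using e by (auto simp: e'_def field_simps)
    from tight[OF e'(1)] obtain C where C: "compact C" "C \<subseteq> S" "\<And>j. measure (M j) (S - C) \<le> e'"
      by blast
    have "eventually (\<lambda>j. \<forall>x\<in>C. \<bar>\<phi> j x - \<psi> x\<bar> < e / 2) F"
    proof (rule ccontr)
      assume "\<not> ?thesis"
      then have ev: "eventually (\<lambda>j. \<exists>x\<in>C. \<not> \<bar>\<phi> j x - \<psi> x\<bar> < e / 2) F"
        unfolding not_eventually_iff by (rule eventually_mono) blast
      then obtain j0 where "\<exists>x\<in>C. \<not> \<bar>\<phi> j0 x - \<psi> x\<bar> < e / 2"
        using nontrivial eventually_happens by blast
      then obtain c where c: "c \<in> C" by blast
      define x where "x j = (if \<exists>x\<in>C. \<not> \<bar>\<phi> j x - \<psi> x\<bar> < e / 2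
        then SOME x. x \<in> C \<and> \<not> \<bar>\<phi> j x - \<psi> x\<bar> < e / 2 else c)" for j
      have x: "x j \<in> C" "(\<exists>x\<in>C. \<not> \<bar>\<phi> j x - \<psi> x\<bar> < e / 2) \<Longrightarrow> \<not> \<bar>\<phi> j (x j) - \<psi> (x j)\<bar> < e / 2" for j
        unfolding atomize_imp atomize_conj x_def
        using someI_ex[of "\<lambda>x. x \<in> C \<and> \<not> \<bar>\<phi> j x - \<psi> x\<bar> < e / 2"] c by auto
      obtain l where l: "l \<in> C" "(x \<longlongrightarrow> l) F"
        using compact_limit[OF C(1), of x] x(1) by auto
      have xS: "x j \<in> S" for j using x(1) C(2) by blast
      have "((\<lambda>j. \<phi> j (x j)) \<longlongrightarrow> \<psi> l) F"
        using conv[of x l] xS l C(2) by blast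
      moreover have "((\<lambda>j. \<psi> (x j)) \<longlongrightarrow> \<psi> l) F"
        by (rule continuous_on_tendsto_compose[OF cont l(2)]) (use l C xS in auto)
      ultimately have "((\<lambda>j. \<phi> j (x j) - \<psi> (x j)) \<longlongrightarrow> \<psi> l - \<psi> l) F"
        by (rule tendsto_diff)
      then have "eventually (\<lambda>j. dist (\<phi> j (x j) - \<psi> (x j)) (\<psi> l - \<psi> l) < e / 2) F"
        using e by (intro tendstoD) auto
      with ev have "eventually (\<lambda>j. False) F"
        by eventually_elim (use x(2) in \<open>auto simp: dist_real_def\<close>)
      with nontrivial show False by (simp add: trivial_limit_def)
    qed
    then show "eventually (\<lambda>j. dist ((\<integral>x. \<phi> j x \<partial>M j) - (\<integral>x. \<psi> x \<partial>M j)) 0 < e) F"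
    proof eventually_elim
      case (elim j)
      interpret prob_space "M j" by (rule borel_prob_measuresD[OF M(1) S])
      have sp: "space (M j) = S" by (rule borel_prob_measuresD[OF M(1) S])
      have C_sets: "S - C \<in> sets (M j)"
        unfolding borel_prob_measuresD(2)[OF M(1) S] sets_restrict_space
        using compact_imp_closed[OF C(1)] by (intro image_eqI[of _ _ "- C"]) auto
      have int: "integrable (M j) (\<phi> j)" "integrable (M j) \<psi>"
        using borel_prob_measures_integrable[OF M(1) S] meas meas' bound bound' by blast+
      have int2: "integrable (M j) (\<lambda>x. e / 2 + 2 * \<bar>B\<bar> * indicator (S - C) x)"
        using C_sets
        by (intro Bochner_Integration.integrable_add integrable_mult_right integrable_real_indicator)
          (auto simp: emeasure_eq_measure)
      have "\<bar>(\<integral>x. \<phi> j x \<partial>M j) - (\<integral>x. \<psi> x \<partial>M j)\<bar> = \<bar>\<integral>x. \<phi> j x - \<psi> x \<partial>M j\<bar>"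
        using int by simp
      also have "\<dots> \<le> (\<integral>x. \<bar>\<phi> j x - \<psi> x\<bar> \<partial>M j)"
        by (rule integral_abs_bound)
      also have "\<dots> \<le> (\<integral>x. e / 2 + 2 * \<bar>B\<bar> * indicator (S - C) x \<partial>M j)"
      proof (rule integral_mono)
        show "integrable (M j) (\<lambda>x. \<bar>\<phi> j x - \<psi> x\<bar>)" using int by auto
        fix x assume "x \<in> space (M j)"
        then show "\<bar>\<phi> j x - \<psi> x\<bar> \<le> e / 2 + 2 * \<bar>B\<bar> * indicator (S - C) x"
          using elim bound[of x j] bound'[of x] e by (cases "x \<in> C") (auto simp: sp less_imp_le)
      qed (rule int2)
      also have "\<dots> = e / 2 + 2 * \<bar>B\<bar> * measure (M j) (S - C)"
        using C_sets integrable_real_indicator[OF C_sets]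
        by (subst Bochner_Integration.integral_add) (auto simp: prob_space emeasure_eq_measure)
      also have "\<dots> < e"
        using C(3)[of j] e'(2) mult_left_mono[OF C(3)[of j], of "2 * \<bar>B\<bar>"] by linarith
      finally show ?case by simp
    qed
  qed
  from tendsto_add[OF this lim'] show ?thesis by simp
qed

lemma weak_limit_continuous_convergence_compact:
  fixes S :: "'a :: {metric_space} set" and \<phi> :: "nat \<Rightarrow> 'a \<Rightarrow> real"
  assumes S: "compact S"
    and M: "\<And>j. M j \<in> borel_prob_measures (top_of_set S)" "N \<in> borel_prob_measures (top_of_set S)"
    and lim: "weak_limit S M N"
    and meas: "\<And>j. \<phi> j \<in> borel_measurable (restrict_space borel S)"
    and bound: "\<And>j x. x \<in> S \<Longrightarrow> \<bar>\<phi> j x\<bar> \<le> B"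
    and conv: "\<And>x l. (\<And>j. x j \<in> S) \<Longrightarrow> l \<in> S \<Longrightarrow> (x \<longlongrightarrow> l) F \<Longrightarrow> ((\<lambda>j. \<phi> j (x j)) \<longlongrightarrow> \<psi> l) F"
  shows "((\<lambda>j. \<integral>x. \<phi> j x \<partial>M j) \<longlongrightarrow> (\<integral>x. \<psi> x \<partial>N)) F"
proof (rule weak_limit_continuous_convergence[OF compact_imp_closed[OF S] M lim _ meas bound conv])
  fix e :: real assume "e > 0"
  then show "\<exists>C. compact C \<and> C \<subseteq> S \<and> (\<forall>j. measure (M j) (S - C) \<le> e)"
    using S by (intro exI[of _ S]) auto
qed

text \<open>The limit is the Loeb measure of the \<open>M j\<close> pushed forward by the standard part map. On the space
  of all sequences in \<open>S\<close>, the internal sets \<open>{x. x j \<in> A j for almost all j}\<close> form an algebra on which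
  the limit of \<open>M j (A j)\<close> is finitely additive. A decreasing sequence of nonempty internal sets has
  nonempty intersection, so Caratheodory's extension theorem applies without further estimates.
  Sending a sequence in the compact set \<open>S\<close> to its limit along the ultrafilter gives the measure on
  \<open>S\<close>.\<close>

lemma weak_limit_exists:
  fixes S :: "'a :: metric_space set"
  assumes S: "compact S" and M: "\<And>j. M j \<in> borel_prob_measures (top_of_set S)"
  shows "\<exists>N\<in>borel_prob_measures (top_of_set S). weak_limit S M N"
proof -
  note [simp] = compact_imp_closed[OF S]
  interpret M: prob_space "M j" for j by (rule borel_prob_measuresD[OF M]) simp
  have spM: "space (M j) = S" for j by (rule borel_prob_measuresD[OF M]) simp
  have setsM: "sets (M j) = sets (restrict_space borel S)" for j by (rule borel_prob_measuresD[OF M]) simp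
  from M.not_empty[of 0] obtain s0 where s0: "s0 \<in> S" by (auto simp: spM)
  define \<Omega> where "\<Omega> = {x :: nat \<Rightarrow> 'a. \<forall>j. x j \<in> S}"
  define internal where "internal A = {x\<in>\<Omega>. eventually (\<lambda>j. x j \<in> A j) F}" for A :: "nat \<Rightarrow> 'a set"
  define \<B> where "\<B> = {A. \<forall>j. A j \<in> sets (M j)}"
  define \<A> where "\<A> = internal ` \<B>"
  have sub: "A j \<subseteq> S" if "A \<in> \<B>" for A j
    using that sets.sets_into_space[of "A j" "M j"] by (auto simp: \<B>_def spM)
  have internal_Int: "internal (\<lambda>j. A j \<inter> B j) = internal A \<inter> internal B" for A B
    by (auto simp: internal_def eventually_conj_iff)
  have internal_Diff: "internal (\<lambda>j. S - A j) = \<Omega> - internal A" for A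
  proof -
    have "eventually (\<lambda>j. x j \<in> S - A j) F \<longleftrightarrow> \<not> eventually (\<lambda>j. x j \<in> A j) F" if "x \<in> \<Omega>" for x
      unfolding not_eventually_iff using that by (auto simp: \<Omega>_def)
    then show ?thesis by (auto simp: internal_def)
  qed
  have internal_S: "internal (\<lambda>_. S) = \<Omega>"
    by (auto simp: internal_def \<Omega>_def)
  have internal_empty: "internal (\<lambda>_. {}) = {}"
    using nontrivial by (auto simp: internal_def trivial_limit_def)
  have internal_Un: "internal (\<lambda>j. A j \<union> B j) = internal A \<union> internal B"
    if "A \<in> \<B>" "B \<in> \<B>" for A B
  proof -
    have "(\<lambda>j. A j \<union> B j) = (\<lambda>j. S - ((S - A j) \<inter> (S - B j)))"
      using sub[OF that(1)] sub[OF that(2)] by (intro ext) blast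
    then have "internal (\<lambda>j. A j \<union> B j) = \<Omega> - ((\<Omega> - internal A) \<inter> (\<Omega> - internal B))"
      by (simp add: internal_Diff internal_Int)
    then show ?thesis by (auto simp: internal_def)
  qed
  have nonempty: "eventually (\<lambda>j. A j \<noteq> {}) F \<longleftrightarrow> internal A \<noteq> {}" if "A \<in> \<B>" for A
  proof
    assume ev: "eventually (\<lambda>j. A j \<noteq> {}) F"
    define x where "x j = (if A j = {} then s0 else SOME y. y \<in> A j)" for j
    have x: "A j \<noteq> {} \<Longrightarrow> x j \<in> A j" for j
      unfolding x_def by (auto intro: someI)
    then have "x \<in> \<Omega>"
      unfolding \<Omega>_def using sub[OF that] s0 by (auto simp: x_def)
    moreover from ev have "eventually (\<lambda>j. x j \<in> A j) F"
      by eventually_elim (rule x)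
    ultimately show "internal A \<noteq> {}" by (auto simp: internal_def)
  next
    assume "internal A \<noteq> {}"
    then obtain x where "eventually (\<lambda>j. x j \<in> A j) F" by (auto simp: internal_def)
    then show "eventually (\<lambda>j. A j \<noteq> {}) F" by eventually_elim auto
  qed
  have \<B>_Diff: "(\<lambda>j. A j - B j) \<in> \<B>" and \<B>_Un: "(\<lambda>j. A j \<union> B j) \<in> \<B>" and \<B>_Int: "(\<lambda>j. A j \<inter> B j) \<in> \<B>"
    if "A \<in> \<B>" "B \<in> \<B>" for A B
    using that by (auto simp: \<B>_def)
  have \<B>_S: "(\<lambda>_. S) \<in> \<B>" and \<B>_empty: "(\<lambda>_. {}) \<in> \<B>"
    using sets.top[of "M _"] by (auto simp: \<B>_def spM)
  have eventually_subset: "eventually (\<lambda>j. A j \<subseteq> B j) F" if "internal A \<subseteq> internal B" "A \<in> \<B>" "B \<in> \<B>" for A B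
  proof -
    have "internal (\<lambda>j. A j \<inter> (S - B j)) = {}"
      using that(1) by (auto simp: internal_Int internal_Diff)
    moreover have "(\<lambda>j. A j \<inter> (S - B j)) \<in> \<B>"
      by (rule \<B>_Int[OF that(2) \<B>_Diff[OF \<B>_S that(3)]])
    ultimately have "eventually (\<lambda>j. \<not> A j \<inter> (S - B j) \<noteq> {}) F"
      using nonempty not_eventually_iff by blast
    then show ?thesis
      by eventually_elim (use sub[OF that(2)] in blast)
  qed
  define p where "p A = Lim F (\<lambda>j. M.prob j (A j))" for A
  have p_lim: "((\<lambda>j. M.prob j (A j)) \<longlongrightarrow> p A) F" for A
    using bounded_limit[of "\<lambda>j. M.prob j (A j)" 1] tendsto_Lim[OF nontrivial] unfolding p_def
    by fastforce
  have p_nonneg: "0 \<le> p A" for A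
    by (rule tendsto_lowerbound[OF p_lim]) (use nontrivial in auto)
  have p_cong: "p A = p B" if "internal A = internal B" "A \<in> \<B>" "B \<in> \<B>" for A B
  proof (rule tendsto_unique[OF nontrivial p_lim])
    have "eventually (\<lambda>j. A j = B j) F"
      using eventually_subset[of A B] eventually_subset[of B A] that
      by (auto elim: eventually_elim2)
    then have "eventually (\<lambda>j. M.prob j (A j) = M.prob j (B j)) F" by eventually_elim simp
    from tendsto_cong[OF this] p_lim[of B] show "((\<lambda>j. M.prob j (A j)) \<longlongrightarrow> p B) F" by blast
  qed
  \<comment> \<open>An internal set determines its sequence of components up to almost all indices, which is
    all that \<open>p\<close> depends on; so the choice does not matter.\<close>
  define f where "f X = ennreal (p (SOME A. A \<in> \<B> \<and> X = internal A))" for X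
  have f: "f (internal A) = ennreal (p A)" if "A \<in> \<B>" for A
  proof -
    have "(SOME A'. A' \<in> \<B> \<and> internal A = internal A') \<in> \<B> \<and>
        internal A = internal (SOME A'. A' \<in> \<B> \<and> internal A = internal A')"
      by (rule someI[of "\<lambda>A'. A' \<in> \<B> \<and> internal A = internal A'" A]) (use that in auto)
    then show ?thesis unfolding f_def using p_cong[OF _ that] by metis
  qed
  have alg: "algebra \<Omega> \<A>"
    unfolding algebra_iff_Un
  proof (intro conjI ballI)
    show "\<A> \<subseteq> Pow \<Omega>" by (auto simp: \<A>_def internal_def)
    show "{} \<in> \<A>" unfolding \<A>_def using \<B>_empty internal_empty by (metis imageI)
    show "\<Omega> - a \<in> \<A>" if "a \<in> \<A>" for a
      using that \<B>_Diff[OF \<B>_S] internal_Diff unfolding \<A>_def by (metis (no_types, lifting) imageE imageI)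
    show "a \<union> b \<in> \<A>" if "a \<in> \<A>" "b \<in> \<A>" for a b
      using that \<B>_Un internal_Un unfolding \<A>_def by (smt (verit) imageE imageI)
  qed
  interpret algebra \<Omega> \<A> by (rule alg)
  have f_empty: "f {} = 0"
  proof -
    have "p (\<lambda>_. {}) = 0"
      by (rule tendsto_unique[OF nontrivial p_lim]) simp
    with f[OF \<B>_empty] show ?thesis by (simp add: internal_empty)
  qed
  have "\<exists>\<mu>. (\<forall>s\<in>\<A>. \<mu> s = f s) \<and> measure_space \<Omega> (sigma_sets \<Omega> \<A>) \<mu>"
  proof (rule caratheodory_empty_continuous)
    show "positive \<A> f" by (simp add: positive_def f_empty)
    show "f A \<noteq> \<infinity>" if "A \<in> \<A>" for A by (simp add: f_def)
    show "additive \<A> f"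
      unfolding additive_def
    proof (intro ballI impI)
      fix X Y assume "X \<in> \<A>" "Y \<in> \<A>" and disj: "X \<inter> Y = {}"
      then obtain A B where AB: "A \<in> \<B>" "B \<in> \<B>" "X = internal A" "Y = internal B"
        by (auto simp: \<A>_def)
      have "eventually (\<lambda>j. A j \<inter> B j \<subseteq> {}) F"
        by (rule eventually_subset[of _ "\<lambda>_. {}"])
          (use AB disj internal_empty \<B>_empty \<B>_Int in \<open>auto simp: internal_Int\<close>)
      then have "eventually (\<lambda>j. M.prob j (A j) + M.prob j (B j) = M.prob j (A j \<union> B j)) F"
      proof eventually_elim
        case (elim j)
        then show ?case
          using AB(1,2) by (intro M.finite_measure_Union[symmetric]) (auto simp: \<B>_def)
      qed
      from tendsto_cong[OF this] have "((\<lambda>j. M.prob j (A j \<union> B j)) \<longlongrightarrow> p A + p B) F"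
        using tendsto_add[OF p_lim p_lim] by blast
      then have "p (\<lambda>j. A j \<union> B j) = p A + p B"
        by (rule tendsto_unique[OF nontrivial p_lim])
      then show "f (X \<union> Y) = f X + f Y"
        using f[OF \<B>_Un[OF AB(1,2)]] AB
        by (simp add: internal_Un[OF AB(1,2)] f p_nonneg)
    qed
    fix X :: "nat \<Rightarrow> (nat \<Rightarrow> 'a) set"
    assume X: "range X \<subseteq> \<A>" "decseq X" "(\<Inter>i. X i) = {}"
    then have "\<forall>i. \<exists>A. A \<in> \<B> \<and> X i = internal A" unfolding \<A>_def by blast
    then obtain A where A: "\<And>i. A i \<in> \<B>" "\<And>i. X i = internal (A i)" by metis
    define C where "C n j = (\<Inter>i\<le>n. A i j)" for n j
    have C\<B>: "C n \<in> \<B>" for n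
      using A(1) unfolding C_def \<B>_def by auto
    \<comment> \<open>Diagonalisation gives, for almost all \<open>j\<close>, a point in ever more of the sets \<open>A i j\<close>; these
      points form a sequence that lies in every \<open>X n\<close>.\<close>
    have "\<exists>n. X n = {}"
    proof (rule ccontr)
      assume *: "\<not> (\<exists>n. X n = {})"
      have "eventually (\<lambda>j. C n j \<noteq> {}) F" for n
      proof -
        from * obtain x where x: "x \<in> X n" by blast
        have "x \<in> internal (A i)" if "i \<le> n" for i
          using decseqD[OF X(2) that] x A(2) by blast
        then have "eventually (\<lambda>j. \<forall>i\<in>{..n}. x j \<in> A i j) F"
          by (intro eventually_ball_finite) (auto simp: internal_def)
        then show ?thesis by eventually_elim (auto simp: C_def)
      qed
      from diagonal[where P = "\<lambda>n j. C n j \<noteq> {}", OF this] obtain k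
        where k: "eventually (\<lambda>j. C (k j) j \<noteq> {}) F" "\<And>n. eventually (\<lambda>j. n \<le> k j) F" by blast
      define x where "x j = (if C (k j) j = {} then s0 else SOME y. y \<in> C (k j) j)" for j
      have x: "C (k j) j \<noteq> {} \<Longrightarrow> x j \<in> C (k j) j" for j
        unfolding x_def by (auto intro: someI)
      then have x\<Omega>: "x \<in> \<Omega>"
        unfolding \<Omega>_def using sub[OF C\<B>] s0 by (auto simp: x_def)
      have "x \<in> X n" for n
      proof -
        from k(1) k(2)[of n] have "eventually (\<lambda>j. x j \<in> A n j) F"
          by eventually_elim (use x in \<open>auto simp: C_def\<close>)
        with x\<Omega> show ?thesis by (simp add: A(2) internal_def)
      qed
      with X(3) show False by blast
    qed
    then obtain n where n: "X n = {}" ..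
    have "f (X m) = 0" if "n \<le> m" for m
      using decseqD[OF X(2) that] n f_empty by simp
    then have "eventually (\<lambda>m. f (X m) = 0) sequentially"
      unfolding eventually_sequentially by blast
    from tendsto_cong[OF this] show "(\<lambda>m. f (X m)) \<longlonglongrightarrow> 0" by simp
  qed
  then obtain q where q: "\<And>X. X \<in> \<A> \<Longrightarrow> q X = f X" "measure_space \<Omega> (sigma_sets \<Omega> \<A>) q" by blast
  define Q where "Q = measure_of \<Omega> (sigma_sets \<Omega> \<A>) q"
  have setsQ: "sets Q = sigma_sets \<Omega> \<A>" and spQ: "space Q = \<Omega>"
    using q(2) unfolding Q_def measure_space_def
    by (auto simp: sigma_algebra.sets_measure_of_eq sigma_algebra.space_measure_of_eq)
  have emQ: "emeasure Q (internal A) = ennreal (p A)" and internalQ: "internal A \<in> sets Q"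
    if "A \<in> \<B>" for A
  proof -
    have "internal A \<in> \<A>" using that by (auto simp: \<A>_def)
    then show "internal A \<in> sets Q" by (simp add: setsQ)
    have "emeasure Q (internal A) = q (internal A)"
      unfolding Q_def using q(2) \<open>internal A \<in> \<A>\<close>
      by (intro emeasure_measure_of_sigma) (auto simp: measure_space_def)
    then show "emeasure Q (internal A) = ennreal (p A)"
      using q(1)[OF \<open>internal A \<in> \<A>\<close>] f[OF that] by simp
  qed
  have "p (\<lambda>_. S) = 1"
    by (rule tendsto_unique[OF nontrivial p_lim]) (use M.prob_space in \<open>simp add: spM\<close>)
  with emQ[OF \<B>_S] have "emeasure Q (space Q) = 1"
    by (simp add: internal_S spQ)
  then interpret Q: prob_space Q by (rule prob_spaceI)
  have measQ: "Q.prob (internal A) = p A" if "A \<in> \<B>" for A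
    using emQ[OF that] p_nonneg by (simp add: measure_def)
  define st where "st x = Lim F x" for x :: "nat \<Rightarrow> 'a"
  have st: "st x \<in> S" "(x \<longlongrightarrow> st x) F" if x: "x \<in> \<Omega>" for x
  proof -
    from compact_limit[OF S, of x] x obtain l where l: "l \<in> S" "(x \<longlongrightarrow> l) F"
      by (auto simp: \<Omega>_def)
    from tendsto_Lim[OF nontrivial l(2)] l show "st x \<in> S" "(x \<longlongrightarrow> st x) F"
      by (auto simp: st_def)
  qed
  have st_meas: "st \<in> measurable Q (restrict_space borel S)"
  proof (rule measurable_restrict_space2)
    show "st \<in> space Q \<rightarrow> S" using st(1) by (auto simp: spQ)
    show "st \<in> borel_measurable Q"
    proof (rule borel_measurableI)
      fix U :: "'a set" assume U: "open U"
      show "st -` U \<inter> space Q \<in> sets Q"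
      proof (cases "U = UNIV")
        case False
        define G where "G n = S \<inter> {y. infdist y (- U) > 1 / real (Suc n)}" for n
        have G: "(\<lambda>_. G n) \<in> \<B>" for n
        proof -
          have "open {y. infdist y (- U) > 1 / real (Suc n)}"
            by (intro open_Collect_less continuous_intros)
          then show ?thesis by (auto simp: \<B>_def setsM sets_restrict_space G_def)
        qed
        have "st -` U \<inter> space Q = (\<Union>n. internal (\<lambda>_. G n))"
        proof (intro set_eqI iffI)
          fix x assume "x \<in> st -` U \<inter> space Q"
          then have x: "x \<in> \<Omega>" "st x \<in> U" by (auto simp: spQ)
          have "infdist (st x) (- U) \<noteq> 0"
            using U False x(2) in_closed_iff_infdist_zero[of "- U" "st x"] by auto
          then have "infdist (st x) (- U) > 0" using infdist_nonneg[of "st x" "- U"] by linarith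
          then obtain n where n: "1 / real (Suc n) < infdist (st x) (- U)"
            using nat_approx_posE by blast
          have "((\<lambda>j. infdist (x j) (- U)) \<longlongrightarrow> infdist (st x) (- U)) F"
            using st(2)[OF x(1)] by (rule tendsto_infdist)
          from order_tendstoD(1)[OF this n] have "eventually (\<lambda>j. x j \<in> G n) F"
            by eventually_elim (use x(1) in \<open>auto simp: G_def \<Omega>_def\<close>)
          with x(1) show "x \<in> (\<Union>n. internal (\<lambda>_. G n))" by (auto simp: internal_def)
        next
          fix x assume "x \<in> (\<Union>n. internal (\<lambda>_. G n))"
          then obtain n where x: "x \<in> \<Omega>" "eventually (\<lambda>j. x j \<in> G n) F" by (auto simp: internal_def)
          have "((\<lambda>j. infdist (x j) (- U)) \<longlongrightarrow> infdist (st x) (- U)) F"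
            using st(2)[OF x(1)] by (rule tendsto_infdist)
          then have "1 / real (Suc n) \<le> infdist (st x) (- U)"
            by (rule tendsto_lowerbound) (use x(2) nontrivial in \<open>auto simp: G_def elim: eventually_mono\<close>)
          then have "infdist (st x) (- U) > 0"
            by (smt (verit) divide_pos_pos of_nat_0_less_iff zero_less_Suc)
          then have "st x \<notin> - U" using infdist_zero[of "st x" "- U"] by linarith
          with x(1) show "x \<in> st -` U \<inter> space Q" by (auto simp: spQ)
        qed
        also have "\<dots> \<in> sets Q" using internalQ[OF G] by blast
        finally show ?thesis .
      qed simp
    qed
  qed
  define N where "N = distr Q (restrict_space borel S) st"
  have "prob_space N" unfolding N_def by (rule Q.prob_space_distr[OF st_meas])
  then have N: "N \<in> borel_prob_measures (top_of_set S)"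
    by (intro borel_prob_measures_closedI) (auto simp: N_def)
  have "((\<lambda>j. \<integral>x. g x \<partial>M j) \<longlongrightarrow> (\<integral>x. g x \<partial>N)) F"
    if g: "continuous_on S g" "bounded (g ` S)" for g :: "'a \<Rightarrow> real"
  proof -
    have g_meas: "g \<in> borel_measurable (restrict_space borel S)"
      using g(1) by (rule borel_measurable_continuous_on_restrict)
    from g(2) obtain B where B: "\<And>x. x \<in> S \<Longrightarrow> \<bar>g x\<bar> \<le> B"
      unfolding bounded_iff by auto
    have intN: "(\<integral>x. g x \<partial>N) = (\<integral>x. g (st x) \<partial>Q)"
      unfolding N_def by (rule integral_distr[OF st_meas g_meas])
    show ?thesis unfolding intN
    proof (rule tendstoI)
      fix e :: real assume "e > 0"
      then obtain m where m: "1 / real (Suc m) < e / 3" by (metis nat_approx_posE divide_pos_pos zero_less_numeral)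
      define c where "c = real (Suc m)"
      have c: "c > 0" "1 / c < e / 3" using m by (auto simp: c_def)
      \<comment> \<open>At scale \<open>1 / c\<close> both integrals are close to sums over the level sets of \<open>g\<close>: the one for
        \<open>M j\<close> directly, the one for \<open>Q\<close> because a sequence in \<open>level i\<close> has its limit where \<open>g\<close> is
        within \<open>1 / c\<close> of \<open>i / c\<close>. The weights of the sums converge by the definition of \<open>p\<close>.\<close>
      define level where "level i = {x\<in>S. \<lfloor>c * g x\<rfloor> = i}" for i
      define I where "I = {\<lfloor>- c * B\<rfloor>..\<lfloor>c * B\<rfloor>}"
      have level: "(\<lambda>_. level i) \<in> \<B>" for i
      proof -
        have "{x \<in> space (restrict_space borel S). \<lfloor>c * g x\<rfloor> = i} \<in> sets (restrict_space borel S)"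
          using g_meas by measurable
        then show ?thesis by (simp add: \<B>_def level_def setsM space_restrict_space)
      qed
      have "\<lfloor>c * g x\<rfloor> \<in> I" if "x \<in> S" for x
        using B[OF that] c(1) mult_left_mono[of "g x" B c] mult_left_mono[of "- B" "g x" c]
        unfolding I_def by (auto intro!: floor_mono)
      then have I: "\<exists>i\<in>I. x \<in> level i" if "x \<in> S" for x
        using that by (auto simp: level_def)
      have finI: "finite I" by (simp add: I_def)
      define step where "step x = (\<Sum>i\<in>I. (of_int i / c) * indicator (level i) x)" for x
      have step: "step x = of_int i / c" if "x \<in> level i" "i \<in> I" for x i
      proof -
        have "step x = (\<Sum>k\<in>I. if k = i then of_int i / c else 0)"
          unfolding step_def by (rule sum.cong) (use that in \<open>auto simp: level_def indicator_def\<close>)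
        then show ?thesis using finI that(2) by simp
      qed
      have level_close: "\<bar>g x - of_int i / c\<bar> \<le> 1 / c" if "x \<in> level i" for x i
      proof -
        from that have "of_int i \<le> c * g x" "c * g x < of_int i + 1"
          unfolding level_def by (auto simp: floor_eq_iff)
        then have "\<bar>c * g x - of_int i\<bar> / c \<le> 1 / c"
          using c(1) by (intro divide_right_mono) auto
        moreover have "g x - of_int i / c = (c * g x - of_int i) / c"
          using c(1) by (simp add: field_simps)
        ultimately show ?thesis using c(1) by (simp only: abs_divide abs_of_pos)
      qed
      have close: "\<bar>(\<integral>x. g x \<partial>M j) - (\<Sum>i\<in>I. of_int i / c * M.prob j (level i))\<bar> \<le> 1 / c" for j
      proof -
        have ls: "level i \<in> sets (M j)" for i using level[of i] by (simp add: \<B>_def)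
        have "(\<integral>x. step x \<partial>M j) = (\<Sum>i\<in>I. of_int i / c * M.prob j (level i))"
          unfolding step_def using ls
          by (subst Bochner_Integration.integral_sum)
            (auto intro!: integrable_mult_right simp: M.emeasure_eq_measure)
        moreover have "\<bar>(\<integral>x. g x \<partial>M j) - (\<integral>x. step x \<partial>M j)\<bar> \<le> 1 / c"
        proof (rule M.integral_diff_le)
          show "integrable (M j) g"
            by (rule borel_prob_measures_integrable[OF M _ g_meas B]) auto
          show "integrable (M j) step"
            unfolding step_def using ls
            by (intro Bochner_Integration.integrable_sum integrable_mult_right)
              (auto simp: M.emeasure_eq_measure)
          show "\<bar>g x - step x\<bar> \<le> 1 / c" if "x \<in> space (M j)" for x
          proof -
            from I[of x] that obtain i where "i \<in> I" "x \<in> level i" by (auto simp: spM)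
            with step level_close show ?thesis by simp
          qed
        qed
        ultimately show ?thesis by simp
      qed
      have step_lim: "((\<lambda>j. \<Sum>i\<in>I. of_int i / c * M.prob j (level i)) \<longlongrightarrow>
          (\<Sum>i\<in>I. of_int i / c * p (\<lambda>_. level i))) F"
        by (intro tendsto_sum tendsto_mult tendsto_const p_lim)
      have near: "\<bar>(\<integral>x. g (st x) \<partial>Q) - (\<Sum>i\<in>I. of_int i / c * p (\<lambda>_. level i))\<bar> \<le> 1 / c"
      proof -
        define step' where "step' x = (\<Sum>i\<in>I. (of_int i / c) * indicator (internal (\<lambda>_. level i)) x)" for x
        have "(\<integral>x. step' x \<partial>Q) = (\<Sum>i\<in>I. of_int i / c * Q.prob (internal (\<lambda>_. level i)))"
          unfolding step'_def using internalQ[OF level]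
          by (subst Bochner_Integration.integral_sum)
            (auto intro!: integrable_mult_right simp: Q.emeasure_eq_measure)
        moreover have "\<bar>(\<integral>x. g (st x) \<partial>Q) - (\<integral>x. step' x \<partial>Q)\<bar> \<le> 1 / c"
        proof (rule Q.integral_diff_le)
          show "integrable Q (\<lambda>x. g (st x))"
            by (rule Q.integrable_const_bound[of _ B])
              (use B st(1) measurable_compose[OF st_meas g_meas] in \<open>auto simp: spQ\<close>)
          show "integrable Q step'"
            unfolding step'_def using internalQ[OF level]
            by (intro Bochner_Integration.integrable_sum integrable_mult_right)
              (auto simp: Q.emeasure_eq_measure)
          show "\<bar>g (st x) - step' x\<bar> \<le> 1 / c" if "x \<in> space Q" for x
          proof -
            have x: "x \<in> \<Omega>" using that by (simp add: spQ)
            have "\<exists>i\<in>I. eventually (\<lambda>j. x j \<in> level i) F"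
            proof (rule ccontr)
              assume "\<not> ?thesis"
              then have "eventually (\<lambda>j. \<forall>i\<in>I. x j \<notin> level i) F"
                using finI by (intro eventually_ball_finite) (auto simp: not_eventually_iff)
              then have "eventually (\<lambda>j. False) F"
                by eventually_elim (use I x in \<open>auto simp: \<Omega>_def\<close>)
              with nontrivial show False by (simp add: trivial_limit_def)
            qed
            then obtain i where i: "i \<in> I" "eventually (\<lambda>j. x j \<in> level i) F" by blast
            have other: "x \<notin> internal (\<lambda>_. level k)" if "k \<noteq> i" for k
            proof
              assume "x \<in> internal (\<lambda>_. level k)"
              then have "eventually (\<lambda>j. x j \<in> level k) F" by (simp add: internal_def)
              with i(2) have "eventually (\<lambda>j. False) F"
                by eventually_elim (use that in \<open>auto simp: level_def\<close>)
              with nontrivial show False by (simp add: trivial_limit_def)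
            qed
            have "step' x = (\<Sum>k\<in>I. if k = i then of_int i / c else 0)"
              unfolding step'_def
              by (rule sum.cong) (use other i x in \<open>auto simp: indicator_def internal_def\<close>)
            then have *: "step' x = of_int i / c" using finI i(1) by simp
            have "((\<lambda>j. g (x j)) \<longlongrightarrow> g (st x)) F"
              by (rule continuous_on_tendsto_compose[OF g(1) st(2)[OF x] st(1)[OF x]])
                (use x in \<open>auto simp: \<Omega>_def\<close>)
            then have "((\<lambda>j. \<bar>g (x j) - of_int i / c\<bar>) \<longlongrightarrow> \<bar>g (st x) - of_int i / c\<bar>) F"
              by (intro tendsto_intros)
            moreover have "eventually (\<lambda>j. \<bar>g (x j) - of_int i / c\<bar> \<le> 1 / c) F"
              using i(2) by eventually_elim (rule level_close)
            ultimately have "\<bar>g (st x) - of_int i / c\<bar> \<le> 1 / c"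
              using nontrivial by (rule tendsto_upperbound)
            with * show ?thesis by simp
          qed
        qed
        ultimately show ?thesis using measQ[OF level] by simp
      qed
      have "e / 3 > 0" using \<open>e > 0\<close> by simp
      from tendstoD[OF step_lim this] show "eventually (\<lambda>j. dist (\<integral>x. g x \<partial>M j) (\<integral>x. g (st x) \<partial>Q) < e) F"
      proof eventually_elim
        case (elim j)
        with close[of j] near c(2) show ?case unfolding dist_real_def by linarith
      qed
    qed
  qed
  with N show ?thesis unfolding weak_limit_def by blast
qed

end

text \<open>Bumps \<open>min 1 (m * infdist x (- U))\<close> increase to the indicator of \<open>U\<close>, and it is enough to let \<open>U\<close>
  range over a countable base that is closed under intersection. Countability matters because equality
  of integrals will be known only for almost every matrix, separately for each test function.\<close>

lemma measure_determining_family: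
  fixes S :: "'a :: {metric_space, second_countable_topology} set"
  assumes S: "closed S"
  obtains \<Phi> :: "('a \<Rightarrow> real) set" where "countable \<Phi>"
    "\<And>f. f \<in> \<Phi> \<Longrightarrow> continuous_on UNIV f" "\<And>f x. f \<in> \<Phi> \<Longrightarrow> \<bar>f x\<bar> \<le> 1"
    "\<And>M N. M \<in> borel_prob_measures (top_of_set S) \<Longrightarrow> N \<in> borel_prob_measures (top_of_set S) \<Longrightarrow>
      (\<And>f. f \<in> \<Phi> \<Longrightarrow> (\<integral>x. f x \<partial>M) = (\<integral>x. f x \<partial>N)) \<Longrightarrow> M = N"
proof -
  obtain B :: "'a set set" where B: "countable B" "topological_basis B"
    using ex_countable_basis by blast
  define \<U> where "\<U> = (\<lambda>X. \<Inter>X) ` {X. X \<subseteq> B \<and> finite X}"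
  have \<U>_open: "open U" if "U \<in> \<U>" for U
    using that B(2) by (auto simp: \<U>_def topological_basis_def intro!: open_Inter)
  have \<U>_count: "countable \<U>"
    unfolding \<U>_def using countable_Collect_finite_subset[OF B(1)]
    by (intro countable_image) (simp add: conj_commute)
  have \<U>_Int: "U \<inter> V \<in> \<U>" if "U \<in> \<U>" "V \<in> \<U>" for U V
  proof -
    from that obtain X Y where "X \<subseteq> B" "finite X" "U = \<Inter>X" "Y \<subseteq> B" "finite Y" "V = \<Inter>Y"
      by (auto simp: \<U>_def)
    then show ?thesis unfolding \<U>_def by (intro image_eqI[of _ _ "X \<union> Y"]) auto
  qed
  have "B \<subseteq> \<U>"
    unfolding \<U>_def by (auto intro!: image_eqI[of _ _ "{_}"])
  with B(2) \<U>_open have "topological_basis \<U>"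
    unfolding topological_basis_def by (meson subset_trans)
  then have borel_\<U>: "borel = sigma UNIV \<U>"
    by (rule borel_eq_countable_basis[OF \<U>_count])
  define bump where "bump U m x = min 1 (real m * infdist x (- U))" for U :: "'a set" and m :: nat and x
  define \<Phi> where "\<Phi> = (\<lambda>(U, m). bump U m) ` (\<U> \<times> (UNIV :: nat set))"
  have bump_cont: "continuous_on UNIV (bump U m)" for U m
    unfolding bump_def by (intro continuous_intros)
  have bump_bound: "\<bar>bump U m x\<bar> \<le> 1" for U m x
    unfolding bump_def using infdist_nonneg[of x "- U"] by (auto simp: abs_le_iff min_def)
  have bump_lim: "(\<lambda>m. bump U m x) \<longlonglongrightarrow> indicator U x" if U: "open U" "U \<noteq> UNIV" for U x
  proof (cases "x \<in> U")
    case True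
    then have "infdist x (- U) > 0"
      using U in_closed_iff_infdist_zero[of "- U" x] infdist_nonneg[of x "- U"]
      by (smt (verit, ccfv_threshold) Compl_eq_Diff_UNIV Compl_iff Diff_eq_empty_iff closed_Compl top.extremum_unique)
    have "eventually (\<lambda>m. real m * infdist x (- U) \<ge> 1) sequentially"
      using eventually_ge_at_top[of "nat \<lceil>1 / infdist x (- U)\<rceil>"]
    proof eventually_elim
      case (elim m)
      then have "1 / infdist x (- U) \<le> real m" by linarith
      with \<open>infdist x (- U) > 0\<close> show ?case by (simp add: field_simps)
    qed
    then have "eventually (\<lambda>m. bump U m x = 1) sequentially"
      by eventually_elim (simp add: bump_def)
    then show ?thesis using True by (simp add: tendsto_eventually)
  next
    case False
    then show ?thesis by (simp add: bump_def)
  qed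
  have bump_int: "(\<lambda>m. \<integral>x. bump U m x \<partial>M) \<longlonglongrightarrow> measure M (S \<inter> U)"
    if U: "open U" "U \<noteq> UNIV" and M: "M \<in> borel_prob_measures (top_of_set S)" for U M
  proof -
    interpret prob_space M by (rule borel_prob_measuresD[OF M S])
    have sp: "space M = S" by (rule borel_prob_measuresD[OF M S])
    have SU: "S \<inter> U \<in> sets M"
      using U(1) by (auto simp: borel_prob_measuresD(2)[OF M S] sets_restrict_space)
    have "(\<lambda>m. \<integral>x. bump U m x \<partial>M) \<longlonglongrightarrow> (\<integral>x. indicator (S \<inter> U) x \<partial>M)"
    proof (rule integral_dominated_convergence[where w = "\<lambda>_. 1"])
      show "(indicator (S \<inter> U) :: 'a \<Rightarrow> real) \<in> borel_measurable M" using SU by simp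
      show "bump U m \<in> borel_measurable M" for m
        by (rule measurable_borel_prob_measures[OF M S])
          (intro borel_measurable_continuous_on_restrict continuous_on_subset[OF bump_cont], simp)
      show "AE x in M. (\<lambda>m. bump U m x) \<longlonglongrightarrow> indicator (S \<inter> U) x"
        using bump_lim[OF U] by (auto simp: sp indicator_inter_arith)
    qed (use bump_bound in auto)
    then show ?thesis using SU by simp
  qed
  show ?thesis
  proof (rule that[of \<Phi>])
    show "countable \<Phi>" unfolding \<Phi>_def using \<U>_count by auto
    show "continuous_on UNIV f" if "f \<in> \<Phi>" for f using that bump_cont by (auto simp: \<Phi>_def)
    show "\<bar>f x\<bar> \<le> 1" if "f \<in> \<Phi>" for f x using that bump_bound by (auto simp: \<Phi>_def)
    fix M N assume M: "M \<in> borel_prob_measures (top_of_set S)" and N: "N \<in> borel_prob_measures (top_of_set S)"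
      and eq: "\<And>f. f \<in> \<Phi> \<Longrightarrow> (\<integral>x. f x \<partial>M) = (\<integral>x. f x \<partial>N)"
    interpret M: prob_space M by (rule borel_prob_measuresD[OF M S])
    interpret N: prob_space N by (rule borel_prob_measuresD[OF N S])
    have sp: "space M = S" "space N = S" using borel_prob_measuresD(3)[OF _ S] M N by auto
    have gen: "sets (restrict_space borel S) = sigma_sets S ((\<inter>) S ` \<U>)"
    proof -
      have eq: "sets (borel :: 'a measure) = sigma_sets UNIV \<U>"
        by (subst borel_\<U>) simp
      moreover have "S \<in> sets borel" using S by simp
      ultimately have "(\<inter>) S ` sigma_sets UNIV \<U> = sigma_sets S ((\<inter>) S ` \<U>)"
        by (intro sigma_sets_Int) auto
      with eq show ?thesis by (simp add: sets_restrict_space)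
    qed
    show "M = N"
    proof (rule measure_eqI_generator_eq[where E = "(\<inter>) S ` \<U>" and \<Omega> = S and A = "\<lambda>_. S"])
      show "Int_stable ((\<inter>) S ` \<U>)"
        unfolding Int_stable_def
      proof (intro ballI)
        fix X Y assume "X \<in> (\<inter>) S ` \<U>" "Y \<in> (\<inter>) S ` \<U>"
        then obtain U V where "U \<in> \<U>" "X = S \<inter> U" "V \<in> \<U>" "Y = S \<inter> V" by auto
        then show "X \<inter> Y \<in> (\<inter>) S ` \<U>"
          by (intro image_eqI[of _ _ "U \<inter> V"] \<U>_Int) auto
      qed
      show "(\<inter>) S ` \<U> \<subseteq> Pow S" by auto
      show "sets M = sigma_sets S ((\<inter>) S ` \<U>)" "sets N = sigma_sets S ((\<inter>) S ` \<U>)"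
        using borel_prob_measuresD(2)[OF _ S] M N gen by auto
      show "range (\<lambda>_. S) \<subseteq> (\<inter>) S ` \<U>"
      proof -
        have "UNIV \<in> \<U>" unfolding \<U>_def by (intro image_eqI[of _ _ "{}"]) auto
        then show ?thesis by (auto intro: image_eqI[of _ _ UNIV])
      qed
      show "emeasure M S \<noteq> \<infinity>" by simp
      show "emeasure M X = emeasure N X" if "X \<in> (\<inter>) S ` \<U>" for X
      proof -
        from that obtain U where U: "U \<in> \<U>" "X = S \<inter> U" by auto
        show ?thesis
        proof (cases "U = UNIV")
          case True
          then show ?thesis using M.emeasure_space_1 N.emeasure_space_1 by (simp add: U sp)
        next
          case False
          have "bump U m \<in> \<Phi>" for m using U(1) by (auto simp: \<Phi>_def)
          with eq bump_int[OF \<U>_open[OF U(1)] False N]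
          have "(\<lambda>m. \<integral>x. bump U m x \<partial>M) \<longlonglongrightarrow> measure N (S \<inter> U)" by simp
          with bump_int[OF \<U>_open[OF U(1)] False M] have "measure M (S \<inter> U) = measure N (S \<inter> U)"
            by (rule LIMSEQ_unique)
          then show ?thesis by (simp add: U(2) M.emeasure_eq_measure N.emeasure_eq_measure)
        qed
      qed
    qed auto
  qed
qed

section \<open>Linear changes of variables\<close>

text \<open>In the coordinate along \<open>b\<close> alone the shear is a translation, by an amount that is fixed by the
  other coordinates; so Fubini's theorem reduces the claim to translation invariance on the line.\<close>

lemma nn_integral_lborel_shear:
  fixes f :: "'a :: euclidean_space \<Rightarrow> ennreal"
  assumes [measurable]: "f \<in> borel_measurable borel" and b: "b \<in> Basis" "b' \<in> Basis" "b \<noteq> b'"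
  shows "(\<integral>\<^sup>+x. f (x + (x \<bullet> b') *\<^sub>R b) \<partial>lborel) = (\<integral>\<^sup>+x. f x \<partial>lborel)"
proof -
  interpret product_sigma_finite "\<lambda>_ :: 'a. lborel :: real measure" ..
  define I where "I = (Basis :: 'a set) - {b}"
  have I: "Basis = insert b I" "finite I" "b \<notin> I" "b' \<in> I" using b by (auto simp: I_def)
  define vec where "vec \<phi> = (\<Sum>c\<in>Basis. \<phi> c *\<^sub>R c)" for \<phi> :: "'a \<Rightarrow> real"
  have vec_meas [measurable]: "vec \<in> measurable (\<Pi>\<^sub>M c\<in>insert b I. lborel) borel"
    unfolding vec_def I(1)[symmetric] by measurable
  have lborel_vec: "lborel = distr (\<Pi>\<^sub>M c\<in>insert b I. lborel) borel vec"
    unfolding I(1)[symmetric] vec_def by (rule lborel_eq)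
  have vec_b': "vec (\<phi>(b := y)) \<bullet> b' = \<phi> b'" for \<phi> y
    unfolding vec_def using b by (subst inner_sum_left_Basis) auto
  have vec_b: "vec (\<phi>(b := y)) = vec (\<phi>(b := 0)) + y *\<^sub>R b" for \<phi> y
  proof -
    have "vec (\<phi>(b := y)) = y *\<^sub>R b + (\<Sum>c\<in>I. \<phi> c *\<^sub>R c)" for y
      unfolding vec_def I(1) using I(2,3) by (auto intro!: sum.cong)
    then show ?thesis by simp
  qed
  have "(\<integral>\<^sup>+x. f (x + (x \<bullet> b') *\<^sub>R b) \<partial>lborel) =
      (\<integral>\<^sup>+\<phi>. f (vec \<phi> + (vec \<phi> \<bullet> b') *\<^sub>R b) \<partial>(\<Pi>\<^sub>M c\<in>insert b I. lborel))"
    by (subst lborel_vec, subst nn_integral_distr) measurable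
  also have "\<dots> = (\<integral>\<^sup>+\<phi>. (\<integral>\<^sup>+y. f (vec (\<phi>(b := y)) + (vec (\<phi>(b := y)) \<bullet> b') *\<^sub>R b) \<partial>lborel) \<partial>(\<Pi>\<^sub>M c\<in>I. lborel))"
    by (rule product_nn_integral_insert[OF I(2,3)]) measurable
  also have "\<dots> = (\<integral>\<^sup>+\<phi>. (\<integral>\<^sup>+y. f (vec (\<phi>(b := y))) \<partial>lborel) \<partial>(\<Pi>\<^sub>M c\<in>I. lborel))"
  proof (rule nn_integral_cong)
    fix \<phi> :: "'a \<Rightarrow> real"
    have "(\<integral>\<^sup>+y. f (vec (\<phi>(b := 0)) + y *\<^sub>R b) \<partial>lborel) =
        (\<integral>\<^sup>+y. f (vec (\<phi>(b := 0)) + (\<phi> b' + 1 * y) *\<^sub>R b) \<partial>lborel)"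
      by (subst nn_integral_real_affine[where c = 1 and t = "\<phi> b'"]) auto
    then show "(\<integral>\<^sup>+y. f (vec (\<phi>(b := y)) + (vec (\<phi>(b := y)) \<bullet> b') *\<^sub>R b) \<partial>lborel) = (\<integral>\<^sup>+y. f (vec (\<phi>(b := y))) \<partial>lborel)"
      unfolding vec_b' by (subst (1 2) vec_b) (simp add: algebra_simps)
  qed
  also have "\<dots> = (\<integral>\<^sup>+\<phi>. f (vec \<phi>) \<partial>(\<Pi>\<^sub>M c\<in>insert b I. lborel))"
    by (rule product_nn_integral_insert[OF I(2,3), symmetric]) measurable
  also have "\<dots> = (\<integral>\<^sup>+x. f x \<partial>lborel)"
    by (subst lborel_vec, subst nn_integral_distr) measurable
  finally show ?thesis .
qed

lemma measurable_matrix_vector_mult [measurable]: "(*v) A \<in> borel_measurable borel"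
  for A :: "real ^ 'n ^ 'm"
  by (intro borel_measurable_continuous_onI linear_continuous_on matrix_vector_mul_bounded_linear)

lemma nn_integral_lborel_permute:
  fixes f :: "real ^ 'n \<Rightarrow> ennreal" and p :: "'n \<Rightarrow> 'n"
  assumes [measurable]: "f \<in> borel_measurable borel" and p: "bij p"
  shows "(\<integral>\<^sup>+x. f (\<chi> i. x $ p i) \<partial>lborel) = (\<integral>\<^sup>+x. f x \<partial>lborel)"
proof -
  define T where "T x = (\<chi> i. x $ p i)" for x :: "real ^ 'n"
  have [measurable]: "T \<in> borel_measurable borel"
    unfolding T_def by (intro borel_measurable_continuous_onI continuous_intros)
  have "lborel = distr lborel borel T"
  proof (rule lborel_eqI)
    fix l u :: "real ^ 'n" assume le: "\<And>b. b \<in> Basis \<Longrightarrow> l \<bullet> b \<le> u \<bullet> b"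
    then have le': "l $ i \<le> u $ i" for i
      using le[of "axis i 1"] by (simp add: inner_axis axis_in_Basis_iff)
    define q where "q = inv p"
    have q: "p (q i) = i" "q (p i) = i" for i
      using p by (auto simp: q_def bij_is_surj surj_f_inv_f bij_is_inj)
    have "T -` box l u = box (\<chi> i. l $ q i) (\<chi> i. u $ q i)"
      unfolding T_def by (auto simp: mem_box_cart) (metis q)+
    then have "emeasure (distr lborel borel T) (box l u) = emeasure lborel (box (\<chi> i. l $ q i) (\<chi> i. u $ q i))"
      by (simp add: emeasure_distr)
    also have "\<dots> = ennreal (\<Prod>b\<in>Basis. ((\<chi> i. u $ q i) - (\<chi> i. l $ q i)) \<bullet> b)"
      using le' by (subst emeasure_lborel_box_eq) (auto simp: Basis_vec_def inner_axis)
    also have "(\<Prod>b\<in>Basis. ((\<chi> i. u $ q i) - (\<chi> i. l $ q i)) \<bullet> b) = (\<Prod>i\<in>UNIV. u $ q i - l $ q i)"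
      unfolding Basis_vec_def
      by (subst prod.UNION_disjoint) (auto simp: axis_eq_axis inner_axis)
    also have "\<dots> = (\<Prod>i\<in>UNIV. u $ i - l $ i)"
      by (rule prod.reindex_bij_betw) (use bij_imp_bij_inv[OF p] in \<open>simp add: q_def\<close>)
    also have "\<dots> = (\<Prod>b\<in>Basis. (u - l) \<bullet> b)"
      unfolding Basis_vec_def
      by (subst prod.UNION_disjoint) (auto simp: axis_eq_axis inner_axis)
    finally show "emeasure (distr lborel borel T) (box l u) = ennreal (\<Prod>b\<in>Basis. (u - l) \<bullet> b)" .
  qed simp
  then have "(\<integral>\<^sup>+x. f x \<partial>lborel) = (\<integral>\<^sup>+x. f x \<partial>distr lborel borel T)" by simp
  also have "\<dots> = (\<integral>\<^sup>+x. f (T x) \<partial>lborel)" by (rule nn_integral_distr) simp_all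
  finally show ?thesis by (simp add: T_def)
qed

text \<open>The formulas for two matrices combine to that for their product, so it suffices to treat diagonal
  matrices, transpositions of coordinates and shears.\<close>

lemma nn_integral_lborel_matrix:
  fixes A :: "real ^ 'n ^ 'n" and f :: "real ^ 'n \<Rightarrow> ennreal"
  assumes "det A \<noteq> 0" "f \<in> borel_measurable borel"
  shows "\<bar>det A\<bar> * (\<integral>\<^sup>+x. f (A *v x) \<partial>lborel) = (\<integral>\<^sup>+x. f x \<partial>lborel)"
proof -
  have "det A \<noteq> 0 \<longrightarrow> (\<forall>f. f \<in> borel_measurable borel \<longrightarrow>
      \<bar>det A\<bar> * (\<integral>\<^sup>+x. f (A *v x) \<partial>lborel) = (\<integral>\<^sup>+x. f x \<partial>lborel))"
  proof (rule induct_matrix_elementary_alt)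
    fix A B :: "real ^ 'n ^ 'n"
    assume A: "det A \<noteq> 0 \<longrightarrow> (\<forall>f. f \<in> borel_measurable borel \<longrightarrow>
        \<bar>det A\<bar> * (\<integral>\<^sup>+x. f (A *v x) \<partial>lborel) = (\<integral>\<^sup>+x. f x \<partial>lborel))"
      and B: "det B \<noteq> 0 \<longrightarrow> (\<forall>f. f \<in> borel_measurable borel \<longrightarrow>
        \<bar>det B\<bar> * (\<integral>\<^sup>+x. f (B *v x) \<partial>lborel) = (\<integral>\<^sup>+x. f x \<partial>lborel))"
    show "det (A ** B) \<noteq> 0 \<longrightarrow> (\<forall>f. f \<in> borel_measurable borel \<longrightarrow>
        \<bar>det (A ** B)\<bar> * (\<integral>\<^sup>+x. f (A ** B *v x) \<partial>lborel) = (\<integral>\<^sup>+x. f x \<partial>lborel))"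
    proof (intro impI allI)
      fix f :: "real ^ 'n \<Rightarrow> ennreal" assume nz: "det (A ** B) \<noteq> 0" and f[measurable]: "f \<in> borel_measurable borel"
      then have nz: "det A \<noteq> 0" "det B \<noteq> 0" by (auto simp: det_mul)
      have "\<bar>det (A ** B)\<bar> * (\<integral>\<^sup>+x. f (A ** B *v x) \<partial>lborel) =
          \<bar>det A\<bar> * (\<bar>det B\<bar> * (\<integral>\<^sup>+x. f (A *v (B *v x)) \<partial>lborel))"
        by (simp add: det_mul abs_mult ennreal_mult mult.assoc matrix_vector_mul_assoc)
      also have "\<bar>det B\<bar> * (\<integral>\<^sup>+x. f (A *v (B *v x)) \<partial>lborel) = (\<integral>\<^sup>+x. f (A *v x) \<partial>lborel)"
        using B[rule_format, OF nz(2), of "\<lambda>y. f (A *v y)"] by simp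
      also have "\<bar>det A\<bar> * \<dots> = (\<integral>\<^sup>+x. f x \<partial>lborel)"
        using A nz f by blast
      finally show "\<bar>det (A ** B)\<bar> * (\<integral>\<^sup>+x. f (A ** B *v x) \<partial>lborel) = (\<integral>\<^sup>+x. f x \<partial>lborel)" .
    qed
  next
    fix A :: "real ^ 'n ^ 'n" and i assume "row i A = 0"
    then show "det A \<noteq> 0 \<longrightarrow> (\<forall>f. f \<in> borel_measurable borel \<longrightarrow>
        \<bar>det A\<bar> * (\<integral>\<^sup>+x. f (A *v x) \<partial>lborel) = (\<integral>\<^sup>+x. f x \<partial>lborel))"
      using det_zero_row by blast
  next
    fix A :: "real ^ 'n ^ 'n" assume diag: "\<And>i j. i \<noteq> j \<Longrightarrow> A $ i $ j = 0"
    have det: "det A = (\<Prod>i\<in>UNIV. A $ i $ i)" by (rule det_diagonal) (rule diag)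
    define c where "c j = (A *v j) \<bullet> j" for j :: "real ^ 'n"
    have c_axis: "c (axis i 1) = A $ i $ i" for i
      by (simp add: c_def inner_axis matrix_vector_mult_basis column_def)
    have prod: "(\<Prod>j\<in>Basis. g (c j)) = (\<Prod>i\<in>UNIV. g (A $ i $ i))" for g :: "real \<Rightarrow> real"
      unfolding Basis_vec_def
      by (subst prod.UNION_disjoint) (auto simp: axis_eq_axis c_axis)
    have A: "A *v x = 0 + (\<Sum>j\<in>Basis. (c j * (x \<bullet> j)) *\<^sub>R j)" for x
    proof -
      have "(\<Sum>j\<in>Basis. (c j * (x \<bullet> j)) *\<^sub>R j) = (\<Sum>i\<in>UNIV. (A $ i $ i * x $ i) *\<^sub>R axis i 1)"
        unfolding Basis_vec_def
        by (subst sum.UNION_disjoint) (auto simp: axis_eq_axis c_axis inner_axis)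
      also have "\<dots> = A *v x"
      proof (unfold vec_eq_iff, intro allI)
        fix i
        have "(\<Sum>j\<in>UNIV. A $ i $ j * x $ j) = (\<Sum>j\<in>UNIV. if j = i then A $ i $ i * x $ i else 0)"
          by (rule sum.cong) (auto simp: diag)
        then show "(\<Sum>i\<in>UNIV. (A $ i $ i * x $ i) *\<^sub>R axis i 1) $ i = (A *v x) $ i"
          by (simp add: matrix_vector_mult_def axis_def if_distrib cong: if_cong)
      qed
      finally show ?thesis by simp
    qed
    show "det A \<noteq> 0 \<longrightarrow> (\<forall>f. f \<in> borel_measurable borel \<longrightarrow>
        \<bar>det A\<bar> * (\<integral>\<^sup>+x. f (A *v x) \<partial>lborel) = (\<integral>\<^sup>+x. f x \<partial>lborel))"
    proof (intro impI allI)
      fix f :: "real ^ 'n \<Rightarrow> ennreal" assume nz: "det A \<noteq> 0" and f[measurable]: "f \<in> borel_measurable borel"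
      have "c j \<noteq> 0" if "j \<in> Basis" for j
        using that nz by (auto simp: Basis_vec_def c_axis det)
      from lborel_affine_euclidean[of c 0, OF this]
      have "lborel = density (distr lborel borel ((*v) A)) (\<lambda>_. (\<Prod>j\<in>Basis. \<bar>c j\<bar>))"
        unfolding A[symmetric] .
      then have "(\<integral>\<^sup>+x. f x \<partial>lborel) = (\<integral>\<^sup>+x. f x \<partial>density (distr lborel borel ((*v) A)) (\<lambda>_. (\<Prod>j\<in>Basis. \<bar>c j\<bar>)))"
        by simp
      also have "\<dots> = (\<Prod>j\<in>Basis. \<bar>c j\<bar>) * (\<integral>\<^sup>+x. f (A *v x) \<partial>lborel)"
        by (simp add: nn_integral_density nn_integral_distr nn_integral_cmult)
      also have "(\<Prod>j\<in>Basis. \<bar>c j\<bar>) = \<bar>det A\<bar>"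
        by (simp add: prod det abs_prod)
      finally show "\<bar>det A\<bar> * (\<integral>\<^sup>+x. f (A *v x) \<partial>lborel) = (\<integral>\<^sup>+x. f x \<partial>lborel)" by simp
    qed
  next
    fix m n :: 'n assume "m \<noteq> n"
    let ?p = "Transposition.transpose m n"
    let ?A = "\<chi> i j. mat 1 $ i $ ?p j :: real ^ 'n ^ 'n"
    have "det ?A = of_int (sign ?p) * det (mat 1 :: real ^ 'n ^ 'n)"
      by (rule det_permute_columns) (simp add: permutes_swap_id)
    then have "\<bar>det ?A\<bar> = 1" by (simp add: sign_def)
    moreover have "?A *v x = (\<chi> i. x $ ?p i)" for x
    proof (unfold vec_eq_iff, intro allI)
      fix i
      have "(\<Sum>j\<in>UNIV. ?A $ i $ j * x $ j) = (\<Sum>j\<in>UNIV. if j = ?p i then x $ j else 0)"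
        by (rule sum.cong) (auto simp: mat_def)
      then show "(?A *v x) $ i = (\<chi> i. x $ ?p i) $ i" by (simp add: matrix_vector_mult_def)
    qed
    ultimately show "det ?A \<noteq> 0 \<longrightarrow> (\<forall>f. f \<in> borel_measurable borel \<longrightarrow>
        \<bar>det ?A\<bar> * (\<integral>\<^sup>+x. f (?A *v x) \<partial>lborel) = (\<integral>\<^sup>+x. f x \<partial>lborel))"
      by (simp add: nn_integral_lborel_permute)
  next
    fix m n :: 'n assume mn: "m \<noteq> n"
    let ?A = "\<chi> i j. of_bool (i = m \<and> j = n \<or> i = j) :: real ^ 'n ^ 'n"
    have "?A = (\<chi> k. if k = m then row m (mat 1) + 1 *s row n (mat 1) else row k (mat 1))"
      using mn by (auto simp: vec_eq_iff row_def mat_def)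
    then have "det ?A = 1" by (simp only: det_row_operation[OF mn] det_I)
    moreover have "?A *v x = x + (x \<bullet> axis n 1) *\<^sub>R axis m 1" for x
    proof (unfold vec_eq_iff, intro allI)
      fix i
      have "(\<Sum>j\<in>UNIV. ?A $ i $ j * x $ j) =
          (\<Sum>j\<in>UNIV. (if j = i then x $ i else 0) + (if j = n then if i = m then x $ n else 0 else 0))"
        by (rule sum.cong) (use mn in auto)
      then show "(?A *v x) $ i = (x + (x \<bullet> axis n 1) *\<^sub>R axis m 1) $ i"
        by (simp add: matrix_vector_mult_def sum.distrib inner_axis) (simp add: axis_def)
    qed
    ultimately show "det ?A \<noteq> 0 \<longrightarrow> (\<forall>f. f \<in> borel_measurable borel \<longrightarrow>
        \<bar>det ?A\<bar> * (\<integral>\<^sup>+x. f (?A *v x) \<partial>lborel) = (\<integral>\<^sup>+x. f x \<partial>lborel))"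
      using mn by (simp add: nn_integral_lborel_shear axis_in_Basis_iff axis_eq_axis)
  qed
  with assms show ?thesis by blast
qed


section \<open>Matrices of determinant one\<close>

lemma norm_matrix_vector_mult_le: "norm (A *v x) \<le> op_norm A * norm x"
  for A :: "real ^ 'n ^ 'n"
  unfolding op_norm_def by (rule onorm) simp

lemma op_norm_nonneg: "0 \<le> op_norm A"
  unfolding op_norm_def by (rule onorm_pos_le) simp

lemma op_norm_mult_le: "op_norm (A ** B) \<le> op_norm A * op_norm B"
  using onorm_compose[of "(*v) A" "(*v) B"]
  by (simp add: op_norm_def matrix_vector_mult_matrix_matrix_mult_compose)

lemma abs_component_le_op_norm: "\<bar>A $ i $ j\<bar> \<le> op_norm A"
  for A :: "real ^ 'n ^ 'n"
  using component_le_norm_cart[of "A *v axis j 1" i] norm_matrix_vector_mult_le[of A "axis j 1"]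
  by (simp add: matrix_vector_mult_basis column_def)

lemma norm_le_op_norm: "norm A \<le> (real CARD('n))\<^sup>2 * op_norm A"
  for A :: "real ^ 'n ^ 'n"
proof -
  have row: "norm (A $ i) \<le> real CARD('n) * op_norm A" for i
  proof -
    have "norm (A $ i) \<le> (\<Sum>j\<in>UNIV. \<bar>A $ i $ j\<bar>)" by (rule norm_le_l1_cart)
    also have "\<dots> \<le> (\<Sum>j\<in>(UNIV :: 'n set). op_norm A)"
      by (intro sum_mono abs_component_le_op_norm)
    finally show ?thesis by simp
  qed
  have "norm A \<le> (\<Sum>i\<in>UNIV. norm (A $ i))"
    unfolding norm_vec_def by (rule L2_set_le_sum) simp
  also have "\<dots> \<le> (\<Sum>i\<in>(UNIV :: 'n set). real CARD('n) * op_norm A)"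
    by (intro sum_mono row)
  finally show ?thesis by (simp add: power2_eq_square mult.assoc)
qed

lemma op_norm_le_norm: "op_norm A \<le> real CARD('n) * norm A"
  for A :: "real ^ 'n ^ 'n"
  unfolding op_norm_def
proof (rule onorm_le)
  fix x :: "real ^ 'n"
  have "\<bar>(A *v x) $ i\<bar> \<le> norm A * norm x" for i
  proof -
    have "\<bar>(A *v x) $ i\<bar> = \<bar>A $ i \<bullet> x\<bar>" by (simp add: matrix_vector_mul_component)
    also have "\<dots> \<le> norm (A $ i) * norm x" by (rule Cauchy_Schwarz_ineq2)
    also have "\<dots> \<le> norm A * norm x"
      by (intro mult_right_mono Finite_Cartesian_Product.norm_nth_le) simp
    finally show ?thesis .
  qed
  then have "(\<Sum>i\<in>UNIV. \<bar>(A *v x) $ i\<bar>) \<le> (\<Sum>i\<in>(UNIV :: 'n set). norm A * norm x)"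
    by (intro sum_mono)
  with norm_le_l1_cart[of "A *v x"] show "norm (A *v x) \<le> real CARD('n) * norm A * norm x"
    by simp
qed

lemma continuous_on_matrix_mult [continuous_intros]:
  fixes f g :: "'a :: topological_space \<Rightarrow> real ^ 'n ^ 'n"
  assumes "continuous_on S f" "continuous_on S g"
  shows "continuous_on S (\<lambda>x. f x ** g x)"
  unfolding matrix_matrix_mult_def by (intro continuous_intros assms)

lemma continuous_on_matrix_vector_mult' [continuous_intros]:
  fixes f :: "'a :: topological_space \<Rightarrow> real ^ 'n ^ 'm" and g :: "'a \<Rightarrow> real ^ 'n"
  assumes "continuous_on S f" "continuous_on S g"
  shows "continuous_on S (\<lambda>x. f x *v g x)"
  unfolding matrix_vector_mult_def by (intro continuous_intros assms)

lemma borel_measurable_matrix_mult [measurable (raw)]: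
  fixes f g :: "'a \<Rightarrow> real ^ 'n ^ 'n"
  assumes "f \<in> borel_measurable M" "g \<in> borel_measurable M"
  shows "(\<lambda>x. f x ** g x) \<in> borel_measurable M"
  by (rule borel_measurable_continuous_Pair[OF assms]) (intro continuous_intros)

lemma borel_measurable_matrix_vector_mult [measurable (raw)]:
  fixes f :: "'a \<Rightarrow> real ^ 'n ^ 'm" and g :: "'a \<Rightarrow> real ^ 'n"
  assumes "f \<in> borel_measurable M" "g \<in> borel_measurable M"
  shows "(\<lambda>x. f x *v g x) \<in> borel_measurable M"
  by (rule borel_measurable_continuous_Pair[OF assms]) (intro continuous_intros)

lemma op_norm_diff_le: "op_norm A \<le> op_norm B + op_norm (A - B)"
  using onorm_triangle[of "(*v) B" "(*v) (A - B)"]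
  by (simp add: op_norm_def matrix_vector_mult_diff_rdistrib)

lemma op_norm_uminus: "op_norm (- A) = op_norm A"
proof -
  have "(*v) (- A) = (\<lambda>x. - (A *v x))"
    by (auto simp: vec_eq_iff matrix_vector_mult_def sum_negf)
  then show ?thesis using onorm_neg[of "(*v) A"] by (simp add: op_norm_def)
qed

lemma continuous_on_op_norm: "continuous_on UNIV (op_norm :: real ^ 'n ^ 'n \<Rightarrow> real)"
proof -
  have "\<bar>op_norm A - op_norm B\<bar> \<le> real CARD('n) * norm (A - B)" for A B :: "real ^ 'n ^ 'n"
    using op_norm_diff_le[of A B] op_norm_diff_le[of B A] op_norm_uminus[of "A - B"]
      op_norm_le_norm[of "A - B"]
    by simp
  then have "(real CARD('n))-lipschitz_on UNIV (op_norm :: real ^ 'n ^ 'n \<Rightarrow> real)"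
    by (intro lipschitz_onI) (auto simp: dist_norm)
  then show ?thesis by (rule lipschitz_on_continuous_on)
qed

lemma borel_measurable_op_norm [measurable]: "op_norm \<in> borel_measurable borel"
  by (rule borel_measurable_continuous_onI[OF continuous_on_op_norm])

lemma continuous_on_det: "continuous_on UNIV (det :: real ^ 'n ^ 'n \<Rightarrow> real)"
  unfolding det_def by (intro continuous_intros)

lemma closed_SL: "closed (SL :: (real ^ 'n ^ 'n) set)"
  unfolding SL_def using continuous_closed_vimage[of UNIV] continuous_on_det
  by (intro closed_Collect_eq continuous_on_const) auto

lemma compact_SL_op_norm_le: "compact {A \<in> (SL :: (real ^ 'n ^ 'n) set). op_norm A \<le> R}"
proof -
  have "norm A \<le> (real CARD('n))\<^sup>2 * R" if "op_norm A \<le> R" for A :: "real ^ 'n ^ 'n"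
    using norm_le_op_norm[of A] that by (meson mult_left_mono order_trans zero_le_power2)
  then have "bounded {A \<in> (SL :: (real ^ 'n ^ 'n) set). op_norm A \<le> R}"
    by (intro boundedI[of _ "(real CARD('n))\<^sup>2 * R"]) auto
  moreover have "closed {A \<in> (SL :: (real ^ 'n ^ 'n) set). op_norm A \<le> R}"
  proof -
    have "closed {A :: real ^ 'n ^ 'n. op_norm A \<le> R}"
      by (intro closed_Collect_le continuous_on_op_norm continuous_on_const)
    moreover have "{A \<in> (SL :: (real ^ 'n ^ 'n) set). op_norm A \<le> R} = SL \<inter> {A. op_norm A \<le> R}" by blast
    ultimately show ?thesis by (metis closed_Int closed_SL)
  qed
  ultimately show ?thesis by (simp add: compact_eq_bounded_closed)
qed

lemma SL_mult: "A \<in> SL \<Longrightarrow> B \<in> SL \<Longrightarrow> A ** B \<in> SL"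
  by (simp add: SL_def det_mul)

lemma SL_mat_1: "mat 1 \<in> SL"
  by (simp add: SL_def)

lemma SL_inv:
  assumes "A \<in> SL"
  obtains A' where "A ** A' = mat 1" "A' ** A = mat 1"
  using assms invertible_det_nz[of A] by (auto simp: SL_def invertible_def)

lemma SL_mult_eq_0_iff:
  fixes A :: "real ^ 'n ^ 'n"
  assumes "A \<in> SL"
  shows "A *v x = 0 \<longleftrightarrow> x = 0"
proof
  assume "A *v x = 0"
  then show "x = 0" using SL_inv[OF assms] matrix_left_invertible_ker[of A] by blast
qed simp

lemma surj_SL: "A \<in> SL \<Longrightarrow> surj ((*v) A)" for A :: "real ^ 'n ^ 'n"
  using SL_inv[of A] matrix_right_invertible_surjective[of A] by blast

lemma nn_integral_lborel_SL:
  fixes A :: "real ^ 'n ^ 'n" and f :: "real ^ 'n \<Rightarrow> ennreal"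
  assumes "A \<in> SL" "f \<in> borel_measurable borel"
  shows "(\<integral>\<^sup>+x. f (A *v x) \<partial>lborel) = (\<integral>\<^sup>+x. f x \<partial>lborel)"
  using nn_integral_lborel_matrix[of A f] assms by (simp add: SL_def)

text \<open>The image of the unit ball has the same volume and lies in the ball of radius \<open>op_norm A\<close>.\<close>

lemma one_le_op_norm_SL:
  fixes A :: "real ^ 'n ^ 'n"
  assumes A: "A \<in> SL"
  shows "1 \<le> op_norm A"
proof -
  let ?b = "unit_ball_vol (real DIM(real ^ 'n))"
  have "op_norm A \<ge> 0" by (rule op_norm_nonneg)
  have "ennreal ?b = emeasure lborel (cball (0 :: real ^ 'n) 1)"
    by (simp add: emeasure_cball)
  also have "\<dots> = (\<integral>\<^sup>+x. indicator (cball (0 :: real ^ 'n) 1) x \<partial>lborel)" by simp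
  also have "\<dots> \<le> (\<integral>\<^sup>+x. indicator (cball 0 (op_norm A)) (A *v x) \<partial>lborel)"
    using norm_matrix_vector_mult_le[of A] op_norm_nonneg[of A]
    by (intro nn_integral_mono) (auto simp: indicator_def intro: order_trans mult_left_le)
  also have "\<dots> = (\<integral>\<^sup>+x. indicator (cball (0 :: real ^ 'n) (op_norm A)) x \<partial>lborel)"
    by (rule nn_integral_lborel_SL[OF A, of "indicator (cball 0 (op_norm A))"])
      (auto intro!: borel_measurable_indicator)
  also have "\<dots> = ennreal (?b * op_norm A ^ DIM(real ^ 'n))"
    using op_norm_nonneg[of A] by (simp add: emeasure_cball)
  finally have "?b * 1 \<le> ?b * op_norm A ^ DIM(real ^ 'n)"
    using op_norm_nonneg[of A] by (subst (asm) ennreal_le_iff) (auto intro!: mult_nonneg_nonneg)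
  then have "1 \<le> op_norm A ^ DIM(real ^ 'n)"
    by (subst (asm) mult_le_cancel_left_pos) auto
  then show ?thesis
    using op_norm_nonneg[of A] by (metis linorder_not_le power_less_one_iff DIM_positive)
qed

text \<open>By Cramer's rule, \<open>x $ k\<close> is the determinant of \<open>A\<close> with column \<open>k\<close> replaced by \<open>A *v x\<close>. Every
  term of its Leibniz expansion has one factor from that column and \<open>d - 1\<close> entries of \<open>A\<close>. In effect
  the norm of the inverse is bounded by a power of the norm, so a moment of the norm controls the
  contraction of vectors too.\<close>

lemma norm_le_norm_SL_mult:
  fixes A :: "real ^ 'n ^ 'n"
  assumes A: "A \<in> SL"
  shows "norm x \<le> real CARD('n) * fact CARD('n) * op_norm A ^ (CARD('n) - 1) * norm (A *v x)"
proof -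
  have *: "\<bar>x $ k\<bar> \<le> fact CARD('n) * (op_norm A ^ (CARD('n) - 1) * norm (A *v x))" for k
  proof -
    let ?B = "\<chi> i j. if j = k then (A *v x) $ i else A $ i $ j"
    have entry: "\<bar>?B $ i $ j\<bar> \<le> (if j = k then norm (A *v x) else op_norm A)" for i j
      using component_le_norm_cart[of "A *v x" i] abs_component_le_op_norm[of A i j] by simp
    have "\<bar>x $ k\<bar> = \<bar>det ?B\<bar>"
      using cramer_lemma[of k A x] A by (simp add: SL_def)
    also have "\<dots> \<le> (\<Sum>p\<in>{p. p permutes (UNIV :: 'n set)}. \<bar>of_int (sign p) * (\<Prod>i\<in>UNIV. ?B $ i $ p i)\<bar>)"
      unfolding det_def by (rule sum_abs)
    also have "\<dots> \<le> (\<Sum>p\<in>{p. p permutes (UNIV :: 'n set)}. op_norm A ^ (CARD('n) - 1) * norm (A *v x))"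
    proof (rule sum_mono)
      fix p :: "'n \<Rightarrow> 'n" assume "p \<in> {p. p permutes UNIV}"
      then have p: "p permutes UNIV" by simp
      have "\<bar>of_int (sign p) * (\<Prod>i\<in>UNIV. ?B $ i $ p i)\<bar> = (\<Prod>i\<in>UNIV. \<bar>?B $ i $ p i\<bar>)"
        by (simp add: abs_mult abs_prod sign_def)
      also have "\<dots> \<le> (\<Prod>i\<in>UNIV. if p i = k then norm (A *v x) else op_norm A)"
        by (intro prod_mono conjI entry) simp
      also have "\<dots> = (\<Prod>j\<in>UNIV. if j = k then norm (A *v x) else op_norm A)"
        by (rule prod.reindex_bij_betw) (use p in \<open>simp add: permutes_bij\<close>)
      also have "\<dots> = op_norm A ^ (CARD('n) - 1) * norm (A *v x)"
        by (subst prod.remove[of _ k]) (auto simp: mult.commute)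
      finally show "\<bar>of_int (sign p) * (\<Prod>i\<in>UNIV. ?B $ i $ p i)\<bar> \<le> op_norm A ^ (CARD('n) - 1) * norm (A *v x)" .
    qed
    also have "\<dots> = fact CARD('n) * (op_norm A ^ (CARD('n) - 1) * norm (A *v x))"
      by (simp add: card_permutations)
    finally show ?thesis .
  qed
  have "norm x \<le> (\<Sum>k\<in>UNIV. \<bar>x $ k\<bar>)" by (rule norm_le_l1_cart)
  also have "\<dots> \<le> (\<Sum>k\<in>(UNIV :: 'n set). fact CARD('n) * (op_norm A ^ (CARD('n) - 1) * norm (A *v x)))"
    by (intro sum_mono *)
  finally show ?thesis by (simp add: mult.assoc)
qed

text \<open>If \<open>u\<close> is a unit vector of maximal expansion and \<open>y\<close> the direction of its image, then \<open>w\<close> is the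
  direction of \<open>y v* A\<close>: pairing \<open>A *v x\<close> with the unit vector \<open>y\<close> does not increase the norm, and gives
  \<open>x \<bullet> (y v* A)\<close>, where \<open>y v* A\<close> has norm at least \<open>op_norm A\<close> because its pairing with \<open>u\<close> is
  \<open>op_norm A\<close>. So \<open>w\<close> is a right singular vector for the largest singular value.\<close>

lemma op_norm_le_norm_mult_inner:
  fixes A :: "real ^ 'n ^ 'n"
  shows "\<exists>w. norm w = 1 \<and> (\<forall>x. op_norm A * \<bar>x \<bullet> w\<bar> \<le> norm (A *v x))"
proof -
  have "compact (sphere (0 :: real ^ 'n) 1)" "sphere (0 :: real ^ 'n) 1 \<noteq> {}"
    by (auto intro: exI[of _ "axis undefined 1"])
  moreover have "continuous_on (sphere 0 1) (\<lambda>x. norm (A *v x))" by (intro continuous_intros)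
  ultimately obtain u where u: "norm u = 1" "\<And>x. norm x = 1 \<Longrightarrow> norm (A *v x) \<le> norm (A *v u)"
    using continuous_attains_sup[of "sphere (0 :: real ^ 'n) 1" "\<lambda>x. norm (A *v x)"] by auto
  have op: "op_norm A = norm (A *v u)"
  proof (rule antisym)
    show "op_norm A \<le> norm (A *v u)"
      unfolding op_norm_def
    proof (rule onorm_le)
      fix x
      show "norm (A *v x) \<le> norm (A *v u) * norm x"
      proof (cases "x = 0")
        case False
        have "norm (A *v (x /\<^sub>R norm x)) \<le> norm (A *v u)" using False by (intro u(2)) simp
        with False show ?thesis by (simp add: matrix_vector_mult_scaleR field_simps)
      qed simp
    qed
    show "norm (A *v u) \<le> op_norm A" using norm_matrix_vector_mult_le[of A u] u by simp
  qed
  show ?thesis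
  proof (cases "A *v u = 0")
    case True
    with op u(1) show ?thesis by (auto intro!: exI[of _ u])
  next
    case False
    define y where "y = (A *v u) /\<^sub>R norm (A *v u)"
    have y: "norm y = 1" using False by (simp add: y_def)
    define z where "z = y v* A"
    have inner: "(A *v x) \<bullet> y = x \<bullet> z" for x
      unfolding z_def by (metis dot_lmul_matrix inner_commute)
    have "op_norm A = (A *v u) \<bullet> y"
      using False by (simp add: y_def op power2_norm_eq_inner[symmetric] power2_eq_square)
    also have "\<dots> \<le> norm z" using norm_cauchy_schwarz[of u z] u(1) by (simp add: inner)
    finally have z: "op_norm A \<le> norm z" .
    with False op have "norm z > 0" by (smt (verit) zero_less_norm_iff)
    have "op_norm A * \<bar>x \<bullet> (z /\<^sub>R norm z)\<bar> \<le> norm (A *v x)" for x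
    proof -
      have "op_norm A * \<bar>x \<bullet> (z /\<^sub>R norm z)\<bar> \<le> norm z * \<bar>x \<bullet> (z /\<^sub>R norm z)\<bar>"
        by (intro mult_right_mono z) simp
      also have "\<dots> = \<bar>(A *v x) \<bullet> y\<bar>"
        using \<open>norm z > 0\<close> by (simp add: inner abs_mult)
      also have "\<dots> \<le> norm (A *v x)"
        using Cauchy_Schwarz_ineq2[of "A *v x" y] y by simp
      finally show ?thesis .
    qed
    with \<open>norm z > 0\<close> show ?thesis by (auto intro!: exI[of _ "z /\<^sub>R norm z"])
  qed
qed

section \<open>Laws of random matrix products\<close>

abbreviation SL_laws :: "(real ^ 'n ^ 'n) measure set" where
  "SL_laws \<equiv> borel_prob_measures (top_of_set SL)"

abbreviation sphere_laws :: "(real ^ 'n) measure set" where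
  "sphere_laws \<equiv> borel_prob_measures (top_of_set (sphere 0 1))"

lemmas SL_lawsD = borel_prob_measuresD[OF _ closed_SL]
lemmas sphere_lawsD = borel_prob_measuresD[OF _ closed_sphere]

lemma measurable_SL_law:
  "M \<in> SL_laws \<Longrightarrow> f \<in> measurable borel N \<Longrightarrow> f \<in> measurable M N"
  by (rule measurable_borel_prob_measures[OF _ closed_SL measurable_restrict_space1])

lemma measurable_sphere_law:
  "M \<in> sphere_laws \<Longrightarrow> f \<in> measurable borel N \<Longrightarrow> f \<in> measurable M N"
  by (rule measurable_borel_prob_measures[OF _ closed_sphere measurable_restrict_space1])

lemma borel_prob_measures_distr:
  fixes S :: "'b :: topological_space set" and g :: "'b \<Rightarrow> real"
  assumes "prob_space M" "closed S" "f \<in> borel_measurable M" "\<And>x. x \<in> space M \<Longrightarrow> f x \<in> S"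
  shows "distr M (restrict_space borel S) f \<in> borel_prob_measures (top_of_set S)"
    and "h \<in> borel_measurable borel \<Longrightarrow> (\<integral>\<^sup>+y. h y \<partial>distr M (restrict_space borel S) f) = (\<integral>\<^sup>+x. h (f x) \<partial>M)"
    and "g \<in> borel_measurable (restrict_space borel S) \<Longrightarrow>
      (\<integral>y. g y \<partial>distr M (restrict_space borel S) f) = (\<integral>x. g (f x) \<partial>M)"
proof -
  have f: "f \<in> measurable M (restrict_space borel S)"
    using assms(3,4) by (intro measurable_restrict_space2) auto
  show "distr M (restrict_space borel S) f \<in> borel_prob_measures (top_of_set S)"
    using assms(1,2) f by (intro borel_prob_measures_closedI) (auto intro: prob_space.prob_space_distr)
  show "h \<in> borel_measurable borel \<Longrightarrow> (\<integral>\<^sup>+y. h y \<partial>distr M (restrict_space borel S) f) = (\<integral>\<^sup>+x. h (f x) \<partial>M)"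
    by (rule nn_integral_distr[OF f]) (simp add: measurable_restrict_space1)
  show "g \<in> borel_measurable (restrict_space borel S) \<Longrightarrow>
      (\<integral>y. g y \<partial>distr M (restrict_space borel S) f) = (\<integral>x. g (f x) \<partial>M)"
    by (rule integral_distr[OF f])
qed

lemma mat_prod_cong: "(\<And>i. i \<in> {1..n} \<Longrightarrow> A i = B i) \<Longrightarrow> mat_prod A n = mat_prod B n"
  by (induction n) auto

lemma measurable_mat_prod:
  assumes "{1..n} \<subseteq> I" "\<And>i. i \<in> I \<Longrightarrow> \<mu> i \<in> SL_laws"
  shows "(\<lambda>A. mat_prod A n) \<in> borel_measurable (\<Pi>\<^sub>M i\<in>I. \<mu> i)"
  using assms(1)
proof (induction n)
  case (Suc n)
  have "(\<lambda>A. A (Suc n)) \<in> borel_measurable (\<Pi>\<^sub>M i\<in>I. \<mu> i)"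
    using Suc.prems
    by (intro measurable_compose[OF measurable_component_singleton[of "Suc n" I \<mu>]]
        measurable_SL_law[OF assms(2)]) auto
  moreover have "(\<lambda>A. mat_prod A n) \<in> borel_measurable (\<Pi>\<^sub>M i\<in>I. \<mu> i)"
    using Suc.prems by (intro Suc.IH) auto
  ultimately show ?case by simp
qed simp

lemma mat_prod_in_SL:
  assumes "{1..n} \<subseteq> I" "\<And>i. i \<in> I \<Longrightarrow> \<mu> i \<in> SL_laws" "A \<in> space (\<Pi>\<^sub>M i\<in>I. \<mu> i)"
  shows "mat_prod A n \<in> SL"
  using assms(1)
proof (induction n)
  case (Suc n)
  have "Suc n \<in> I" using Suc.prems by (rule subsetD) simp
  then have "A (Suc n) \<in> space (\<mu> (Suc n))"
    using assms(3) PiE_mem[of A I "\<lambda>i. space (\<mu> i)" "Suc n"] by (auto simp: space_PiM)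
  also have "\<dots> = SL" using \<open>Suc n \<in> I\<close> by (intro SL_lawsD(3) assms(2))
  finally have "A (Suc n) \<in> SL" .
  moreover have "mat_prod A n \<in> SL" using Suc.prems by (intro Suc.IH) auto
  ultimately show ?case by (auto intro: SL_mult)
qed (simp add: SL_mat_1)

text \<open>The law of the product is kept as a measure on matrices, not on tuples: then the law of \<open>n + m\<close>
  factors is an iterated integral over two such laws.\<close>

definition prod_law :: "(nat \<Rightarrow> (real ^ 'n ^ 'n) measure) \<Rightarrow> nat \<Rightarrow> (real ^ 'n ^ 'n) measure" where
  "prod_law \<mu> n = distr (\<Pi>\<^sub>M i\<in>{1..n}. \<mu> i) (restrict_space borel SL) (\<lambda>A. mat_prod A n)"

lemma
  fixes g :: "real ^ 'n ^ 'n \<Rightarrow> real"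
  assumes \<mu>: "\<And>i. \<mu> i \<in> SL_laws"
  shows prod_law_SL: "prod_law \<mu> n \<in> SL_laws"
    and nn_integral_prod_law: "h \<in> borel_measurable borel \<Longrightarrow>
      (\<integral>\<^sup>+T. h T \<partial>prod_law \<mu> n) = (\<integral>\<^sup>+A. h (mat_prod A n) \<partial>(\<Pi>\<^sub>M i\<in>{1..n}. \<mu> i))"
    and integral_prod_law: "g \<in> borel_measurable borel \<Longrightarrow>
      (\<integral>T. g T \<partial>prod_law \<mu> n) = (\<integral>A. g (mat_prod A n) \<partial>(\<Pi>\<^sub>M i\<in>{1..n}. \<mu> i))"
proof -
  interpret product_prob_space \<mu> "{1..n}"
    by (rule product_prob_spaceI) (rule SL_lawsD[OF \<mu>])
  have meas: "(\<lambda>A. mat_prod A n) \<in> borel_measurable (\<Pi>\<^sub>M i\<in>{1..n}. \<mu> i)"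
    by (rule measurable_mat_prod[OF subset_refl \<mu>])
  have SL: "mat_prod A n \<in> SL" if "A \<in> space (\<Pi>\<^sub>M i\<in>{1..n}. \<mu> i)" for A
    using that by (rule mat_prod_in_SL[OF subset_refl \<mu>])
  note * = borel_prob_measures_distr[OF P.prob_space_axioms closed_SL meas SL]
  show "prod_law \<mu> n \<in> SL_laws"
    unfolding prod_law_def by (rule *) auto
  show "h \<in> borel_measurable borel \<Longrightarrow>
      (\<integral>\<^sup>+T. h T \<partial>prod_law \<mu> n) = (\<integral>\<^sup>+A. h (mat_prod A n) \<partial>(\<Pi>\<^sub>M i\<in>{1..n}. \<mu> i))"
    unfolding prod_law_def by (rule *) auto
  show "g \<in> borel_measurable borel \<Longrightarrow>
      (\<integral>T. g T \<partial>prod_law \<mu> n) = (\<integral>A. g (mat_prod A n) \<partial>(\<Pi>\<^sub>M i\<in>{1..n}. \<mu> i))"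
    unfolding prod_law_def by (rule *(3)) (auto intro: measurable_restrict_space1)
qed

lemma nn_integral_prod_law_0:
  assumes "\<And>i. \<mu> i \<in> SL_laws" "h \<in> borel_measurable borel"
  shows "(\<integral>\<^sup>+T. h T \<partial>prod_law \<mu> 0) = h (mat 1)"
proof -
  interpret product_prob_space \<mu> "{1..0}"
    by (rule product_prob_spaceI) (rule SL_lawsD[OF assms(1)])
  show ?thesis
    unfolding nn_integral_prod_law[OF assms] using P.emeasure_space_1 by simp
qed

lemma borel_measurable_nn_integral_SL:
  fixes h :: "'a :: {second_countable_topology, topological_space} \<Rightarrow> real ^ 'n ^ 'n \<Rightarrow> ennreal"
  assumes M: "M \<in> SL_laws" and h: "case_prod h \<in> borel_measurable borel"
  shows "(\<lambda>x. \<integral>\<^sup>+T. h x T \<partial>M) \<in> borel_measurable borel"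
proof -
  interpret prob_space M by (rule SL_lawsD[OF M])
  have "(\<lambda>p. p) \<in> measurable (borel \<Otimes>\<^sub>M M) (borel \<Otimes>\<^sub>M borel)"
    using measurable_compose[OF measurable_snd measurable_SL_law[OF M measurable_ident]]
    by (simp add: measurable_pair_iff comp_def)
  moreover have "case_prod h \<in> borel_measurable (borel \<Otimes>\<^sub>M borel)"
    using h by (simp add: borel_prod)
  ultimately have "case_prod h \<in> borel_measurable (borel \<Otimes>\<^sub>M M)"
    by (rule measurable_compose)
  then show ?thesis by (rule borel_measurable_nn_integral)
qed

lemma nn_integral_prod_law_Suc:
  assumes \<mu>: "\<And>i. \<mu> i \<in> SL_laws" and h [measurable]: "h \<in> borel_measurable borel"
  shows "(\<integral>\<^sup>+T. h T \<partial>prod_law \<mu> (Suc n)) = (\<integral>\<^sup>+T. (\<integral>\<^sup>+a. h (a ** T) \<partial>\<mu> (Suc n)) \<partial>prod_law \<mu> n)"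
proof -
  interpret product_prob_space \<mu> "{1..n}"
    by (rule product_prob_spaceI) (rule SL_lawsD[OF \<mu>])
  have ins: "{1..Suc n} = insert (Suc n) {1..n}" by auto
  have "(\<integral>\<^sup>+T. h T \<partial>prod_law \<mu> (Suc n)) =
      (\<integral>\<^sup>+A. h (mat_prod A (Suc n)) \<partial>(\<Pi>\<^sub>M i\<in>insert (Suc n) {1..n}. \<mu> i))"
    unfolding nn_integral_prod_law[OF \<mu> h] ins ..
  also have "\<dots> = (\<integral>\<^sup>+A. (\<integral>\<^sup>+a. h (mat_prod (A(Suc n := a)) (Suc n)) \<partial>\<mu> (Suc n)) \<partial>(\<Pi>\<^sub>M i\<in>{1..n}. \<mu> i))"
  proof (rule product_nn_integral_insert)
    show "(\<lambda>A. h (mat_prod A (Suc n))) \<in> borel_measurable (\<Pi>\<^sub>M i\<in>insert (Suc n) {1..n}. \<mu> i)"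
      by (rule measurable_compose[OF _ h], rule measurable_mat_prod) (use \<mu> in auto)
  qed auto
  also have "\<dots> = (\<integral>\<^sup>+A. (\<integral>\<^sup>+a. h (a ** mat_prod A n) \<partial>\<mu> (Suc n)) \<partial>(\<Pi>\<^sub>M i\<in>{1..n}. \<mu> i))"
  proof -
    have "mat_prod (A(Suc n := a)) n = mat_prod A n" for A and a :: "real ^ 'a ^ 'a"
      by (rule mat_prod_cong) auto
    then show ?thesis by simp
  qed
  also have "\<dots> = (\<integral>\<^sup>+T. (\<integral>\<^sup>+a. h (a ** T) \<partial>\<mu> (Suc n)) \<partial>prod_law \<mu> n)"
    by (rule nn_integral_prod_law[OF \<mu>, symmetric])
      (rule borel_measurable_nn_integral_SL[OF \<mu>], simp add: borel_prod[symmetric] split_beta')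
  finally show ?thesis .
qed

lemma nn_integral_prod_law_add:
  assumes \<mu>: "\<And>i. \<mu> i \<in> SL_laws" and h [measurable]: "h \<in> borel_measurable borel"
  shows "(\<integral>\<^sup>+T. h T \<partial>prod_law \<mu> (n + m)) = (\<integral>\<^sup>+T. (\<integral>\<^sup>+B. h (B ** T) \<partial>prod_law (\<lambda>i. \<mu> (n + i)) m) \<partial>prod_law \<mu> n)"
  using h
proof (induction m arbitrary: h)
  case 0
  note [measurable] = 0
  have "(\<integral>\<^sup>+B. h (B ** T) \<partial>prod_law (\<lambda>i. \<mu> (n + i)) 0) = h T" for T
    by (subst nn_integral_prod_law_0) (use \<mu> in auto)
  then show ?case by simp
next
  case (Suc m)
  note [measurable] = Suc.prems
  have [measurable]: "(\<lambda>T. \<integral>\<^sup>+a. h (a ** T) \<partial>\<mu> (Suc (n + m))) \<in> borel_measurable borel"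
    by (rule borel_measurable_nn_integral_SL[OF \<mu>]) (simp add: borel_prod[symmetric] split_beta')
  have "(\<integral>\<^sup>+T. h T \<partial>prod_law \<mu> (n + Suc m)) =
      (\<integral>\<^sup>+T. (\<integral>\<^sup>+a. h (a ** T) \<partial>\<mu> (Suc (n + m))) \<partial>prod_law \<mu> (n + m))"
    using nn_integral_prod_law_Suc[OF \<mu> Suc.prems, where n = "n + m"] by simp
  also have "\<dots> = (\<integral>\<^sup>+T. (\<integral>\<^sup>+B. (\<integral>\<^sup>+a. h (a ** (B ** T)) \<partial>\<mu> (Suc (n + m))) \<partial>prod_law (\<lambda>i. \<mu> (n + i)) m) \<partial>prod_law \<mu> n)"
    by (rule Suc.IH) measurable
  also have "\<dots> = (\<integral>\<^sup>+T. (\<integral>\<^sup>+B. h (B ** T) \<partial>prod_law (\<lambda>i. \<mu> (n + i)) (Suc m)) \<partial>prod_law \<mu> n)"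
    using \<mu> by (subst nn_integral_prod_law_Suc) (auto simp: matrix_mul_assoc)
  finally show ?case .
qed

locale compact_moment =
  fixes K :: "(real ^ 'n ^ 'n) measure set" and \<gamma> C :: real
  assumes compact: "compactin (weak_topology (top_of_set SL)) K"
    and \<gamma>_pos: "0 < \<gamma>"
    and moment: "\<And>\<mu>. \<mu> \<in> K \<Longrightarrow> (\<integral>\<^sup>+A. ennreal (op_norm A powr \<gamma>) \<partial>\<mu>) \<le> ennreal C"
begin

lemma K_SL: "\<mu> \<in> K \<Longrightarrow> \<mu> \<in> SL_laws"
  using compactin_subset_topspace[OF compact] by auto

lemma C_ge_1:
  assumes "\<mu> \<in> K"
  shows "1 \<le> C"
proof -
  interpret prob_space \<mu> by (rule SL_lawsD[OF K_SL[OF assms]])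
  have "1 = (\<integral>\<^sup>+A. 1 \<partial>\<mu>)" by (simp add: emeasure_space_1)
  also have "\<dots> \<le> (\<integral>\<^sup>+A. ennreal (op_norm A powr \<gamma>) \<partial>\<mu>)"
    using SL_lawsD(3)[OF K_SL[OF assms]] \<gamma>_pos
    by (intro nn_integral_mono) (auto simp: one_le_op_norm_SL intro!: ge_one_powr_ge_zero)
  also have "\<dots> \<le> ennreal C" by (rule moment[OF assms])
  finally show ?thesis by simp
qed

text \<open>Matrices of bounded norm in \<open>SL\<close> form a compact set, and Markov's inequality for the moment of
  order \<open>\<gamma>\<close> bounds the rest uniformly over \<open>K\<close>.\<close>

lemma K_tight:
  assumes e: "0 < e"
  shows "\<exists>D. compact D \<and> D \<subseteq> SL \<and> (\<forall>\<mu>\<in>K. measure \<mu> (SL - D) \<le> e)"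
proof (cases "K = {}")
  case True
  then show ?thesis by (intro exI[of _ "{}"]) auto
next
  case False
  then have C: "1 \<le> C" using C_ge_1 by blast
  define R where "R = (C / e) powr (1 / \<gamma>)"
  define D where "D = {A \<in> (SL :: (real ^ 'n ^ 'n) set). op_norm A \<le> R}"
  have R: "R powr \<gamma> = C / e" "R \<ge> 0" using C e \<gamma>_pos by (auto simp: R_def powr_powr)
  have "measure \<mu> (SL - D) \<le> e" if \<mu>: "\<mu> \<in> K" for \<mu>
  proof -
    interpret prob_space \<mu> by (rule SL_lawsD[OF K_SL[OF \<mu>]])
    have sp: "space \<mu> = SL" by (rule SL_lawsD[OF K_SL[OF \<mu>]])
    have [measurable]: "op_norm \<in> borel_measurable \<mu>"
      using measurable_SL_law[OF K_SL[OF \<mu>] borel_measurable_op_norm] .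
    have SD: "SL - D = {A \<in> space \<mu>. R < op_norm A}" by (auto simp: D_def sp)
    have [measurable]: "SL - D \<in> sets \<mu>" unfolding SD by measurable
    have "ennreal (C / e) * emeasure \<mu> (SL - D) = (\<integral>\<^sup>+A. ennreal (C / e) * indicator (SL - D) A \<partial>\<mu>)"
      by (simp add: nn_integral_cmult_indicator)
    also have "\<dots> \<le> (\<integral>\<^sup>+A. ennreal (op_norm A powr \<gamma>) \<partial>\<mu>)"
    proof (rule nn_integral_mono)
      fix A assume "A \<in> space \<mu>"
      show "ennreal (C / e) * indicator (SL - D) A \<le> ennreal (op_norm A powr \<gamma>)"
      proof (cases "A \<in> SL - D")
        case True
        then have "R powr \<gamma> \<le> op_norm A powr \<gamma>"
          using R(2) \<gamma>_pos by (intro powr_mono2) (auto simp: D_def)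
        with True R(1) show ?thesis by (simp add: ennreal_leI)
      qed simp
    qed
    also have "\<dots> \<le> ennreal C" by (rule moment[OF \<mu>])
    finally have "C / e * measure \<mu> (SL - D) \<le> C"
      using C e by (simp add: emeasure_eq_measure ennreal_mult[symmetric])
    then show ?thesis using C e by (simp add: field_simps)
  qed
  moreover have "compact D" unfolding D_def by (rule compact_SL_op_norm_le)
  ultimately show ?thesis by (intro exI[of _ D]) (auto simp: D_def)
qed

lemma moment_prod_law:
  assumes \<mu>: "\<And>i. \<mu> i \<in> K"
  shows "(\<integral>\<^sup>+T. ennreal (op_norm T powr \<gamma>) \<partial>prod_law \<mu> n) \<le> ennreal (C ^ n)"
proof (induction n)
  case 0
  have "1 \<le> op_norm (mat 1 :: real ^ 'n ^ 'n)" by (rule one_le_op_norm_SL[OF SL_mat_1])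
  moreover have "op_norm (mat 1 :: real ^ 'n ^ 'n) \<le> 1"
    unfolding op_norm_def by (rule onorm_le) simp
  ultimately have "op_norm (mat 1 :: real ^ 'n ^ 'n) = 1" by simp
  then show ?case by (subst nn_integral_prod_law_0) (auto intro: K_SL \<mu>)
next
  case (Suc n)
  have C: "1 \<le> C" using C_ge_1 \<mu> by blast
  have "(\<integral>\<^sup>+T. ennreal (op_norm T powr \<gamma>) \<partial>prod_law \<mu> (Suc n)) =
      (\<integral>\<^sup>+T. (\<integral>\<^sup>+a. ennreal (op_norm (a ** T) powr \<gamma>) \<partial>\<mu> (Suc n)) \<partial>prod_law \<mu> n)"
    by (rule nn_integral_prod_law_Suc) (auto intro: K_SL \<mu>)
  also have "\<dots> \<le> (\<integral>\<^sup>+T. ennreal C * ennreal (op_norm T powr \<gamma>) \<partial>prod_law \<mu> n)"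
  proof (rule nn_integral_mono)
    fix T :: "real ^ 'n ^ 'n"
    have "(\<integral>\<^sup>+a. ennreal (op_norm (a ** T) powr \<gamma>) \<partial>\<mu> (Suc n)) \<le>
        (\<integral>\<^sup>+a. ennreal (op_norm a powr \<gamma>) * ennreal (op_norm T powr \<gamma>) \<partial>\<mu> (Suc n))"
      using \<gamma>_pos op_norm_nonneg op_norm_mult_le
      by (intro nn_integral_mono)
        (auto simp: ennreal_mult[symmetric] powr_mult[symmetric] intro!: ennreal_leI powr_mono2)
    also have "\<dots> = (\<integral>\<^sup>+a. ennreal (op_norm a powr \<gamma>) \<partial>\<mu> (Suc n)) * ennreal (op_norm T powr \<gamma>)"
      by (rule nn_integral_multc) (rule measurable_SL_law[OF K_SL[OF \<mu>]], measurable)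
    also have "\<dots> \<le> ennreal C * ennreal (op_norm T powr \<gamma>)"
      by (intro mult_right_mono moment \<mu>) simp
    finally show "(\<integral>\<^sup>+a. ennreal (op_norm (a ** T) powr \<gamma>) \<partial>\<mu> (Suc n)) \<le> ennreal C * ennreal (op_norm T powr \<gamma>)" .
  qed
  also have "\<dots> = ennreal C * (\<integral>\<^sup>+T. ennreal (op_norm T powr \<gamma>) \<partial>prod_law \<mu> n)"
    by (rule nn_integral_cmult) (rule measurable_SL_law[OF prod_law_SL[OF K_SL[OF \<mu>]]], measurable)
  also have "\<dots> \<le> ennreal C * ennreal (C ^ n)" by (intro mult_left_mono Suc.IH) simp
  also have "\<dots> = ennreal (C ^ Suc n)" using C by (simp add: ennreal_mult)
  finally show ?case .
qed

lemma ln_op_norm_nonneg: "T \<in> SL \<Longrightarrow> 0 \<le> ln (op_norm T)"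
  using one_le_op_norm_SL by (intro ln_ge_zero)

lemma integrable_op_norm_powr:
  assumes \<mu>: "\<And>i. \<mu> i \<in> K" and t: "0 \<le> t" "t \<le> \<gamma>"
  shows "integrable (prod_law \<mu> n) (\<lambda>T. op_norm T powr t)"
    and "(\<integral>T. op_norm T powr t \<partial>prod_law \<mu> n) \<le> C ^ n"
proof -
  note law = prod_law_SL[OF K_SL[OF \<mu>], where n = n]
  have C: "1 \<le> C" using C_ge_1 \<mu> by blast
  have le: "(\<integral>\<^sup>+T. ennreal (op_norm T powr t) \<partial>prod_law \<mu> n) \<le> ennreal (C ^ n)"
  proof -
    have "(\<integral>\<^sup>+T. ennreal (op_norm T powr t) \<partial>prod_law \<mu> n) \<le> (\<integral>\<^sup>+T. ennreal (op_norm T powr \<gamma>) \<partial>prod_law \<mu> n)"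
      using SL_lawsD(3)[OF law] t by (intro nn_integral_mono ennreal_leI powr_mono one_le_op_norm_SL) auto
    also have "\<dots> \<le> ennreal (C ^ n)" by (rule moment_prod_law[OF \<mu>])
    finally show ?thesis .
  qed
  have meas: "(\<lambda>T. op_norm T powr t) \<in> borel_measurable (prod_law \<mu> n)"
    by (rule measurable_SL_law[OF law]) measurable
  show int: "integrable (prod_law \<mu> n) (\<lambda>T. op_norm T powr t)"
    using le by (intro integrableI_bounded meas) (auto simp: top.extremum_strict intro: le_less_trans)
  from le show "(\<integral>T. op_norm T powr t \<partial>prod_law \<mu> n) \<le> C ^ n"
    using C by (subst (asm) nn_integral_eq_integral[OF int]) auto
qed

lemma integrable_ln_op_norm:
  assumes \<mu>: "\<And>i. \<mu> i \<in> K"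
  shows "integrable (prod_law \<mu> n) (\<lambda>T. ln (op_norm T))"
proof (rule Bochner_Integration.integrable_bound)
  note law = prod_law_SL[OF K_SL[OF \<mu>], where n = n]
  show "integrable (prod_law \<mu> n) (\<lambda>T. op_norm T powr \<gamma> / \<gamma>)"
    using integrable_op_norm_powr(1)[OF \<mu>, of \<gamma>] \<gamma>_pos by simp
  show "(\<lambda>T. ln (op_norm T)) \<in> borel_measurable (prod_law \<mu> n)"
    by (rule measurable_SL_law[OF law]) measurable
  show "AE T in prod_law \<mu> n. norm (ln (op_norm T)) \<le> norm (op_norm T powr \<gamma> / \<gamma>)"
  proof (rule AE_I2)
    fix T :: "real ^ 'n ^ 'n" assume "T \<in> space (prod_law \<mu> n)"
    then have T: "T \<in> SL" by (simp add: SL_lawsD(3)[OF law])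
    then show "norm (ln (op_norm T)) \<le> norm (op_norm T powr \<gamma> / \<gamma>)"
      using ln_powr_bound[OF one_le_op_norm_SL[OF T] \<gamma>_pos] ln_op_norm_nonneg[OF T] \<gamma>_pos by simp
  qed
qed

lemma expected_log_norm_eq:
  assumes \<mu>: "\<And>i. \<mu> i \<in> K"
  shows "expected_log_norm \<mu> n = (\<integral>T. ln (op_norm T) \<partial>prod_law \<mu> n)"
  unfolding expected_log_norm_def
  by (rule integral_prod_law[OF K_SL[OF \<mu>], symmetric]) measurable

end

section \<open>The action on directions\<close>

lemma sgn_scaleR_pos: "0 < c \<Longrightarrow> sgn (c *\<^sub>R x) = sgn x" for x :: "'a :: real_normed_vector"
  by (simp add: sgn_scaleR)

lemma sgn_mult_sgn: "x \<noteq> 0 \<Longrightarrow> sgn (A *v sgn x) = sgn (A *v x)" for A :: "real ^ 'n ^ 'm"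
  by (simp add: sgn_div_norm[of x] matrix_vector_mult_scaleR sgn_scaleR_pos)

lemma SL_mult_sphere_neq_0:
  fixes A :: "real ^ 'n ^ 'n"
  assumes "A \<in> SL" "x \<in> sphere 0 1"
  shows "A *v x \<noteq> 0"
proof -
  have "x \<noteq> 0" using assms(2) by auto
  then show ?thesis by (simp only: SL_mult_eq_0_iff[OF assms(1)] not_False_eq_True)
qed

lemma sgn_SL_sphere:
  "A \<in> SL \<Longrightarrow> x \<in> sphere 0 1 \<Longrightarrow> sgn (A *v x) \<in> sphere 0 1" for A :: "real ^ 'n ^ 'n"
  using SL_mult_eq_0_iff[of A x] by (auto simp: norm_sgn)

lemma borel_measurable_sgn_vec [measurable]: "(sgn :: real ^ 'n \<Rightarrow> _) \<in> borel_measurable borel"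
  unfolding sgn_div_norm[abs_def] by measurable

lemma span_singleton_sgn: "x \<noteq> 0 \<Longrightarrow> span {sgn x} = span {x}" for x :: "'a :: real_normed_vector"
  using span_image_scale[of "{x}" "\<lambda>_. inverse (norm x)"] by (simp add: sgn_div_norm)

lemma proj_map_span: "proj_map A (span {x}) = span {A *v x}"
  unfolding proj_map_def by (subst linear_span_image[symmetric]) auto

lemma measurable_borel_of:
  assumes "f \<in> space M \<rightarrow> topspace X" "\<And>U. openin X U \<Longrightarrow> f -` U \<inter> space M \<in> sets M"
  shows "f \<in> measurable M (borel_of X)"
  unfolding borel_of_def
  by (rule measurable_measure_of) (use assms in \<open>auto dest: openin_subset\<close>)

lemma sets_borel_of_openin: "openin X U \<Longrightarrow> U \<in> sets (borel_of X)"
  unfolding borel_of_def by (subst sets_measure_of) (auto dest: openin_subset)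

lemma space_borel_of: "space (borel_of X) = topspace X"
  unfolding borel_of_def by (rule space_measure_of) (auto dest: openin_subset)

lemma measurable_span_singleton:
  "(\<lambda>x. span {x}) \<in> measurable (restrict_space borel (sphere (0 :: real ^ 'n) 1)) (borel_of proj_topology)"
proof (rule measurable_borel_of)
  show "(\<lambda>x. span {x}) \<in> space (restrict_space borel (sphere (0 :: real ^ 'n) 1)) \<rightarrow> topspace proj_topology"
  proof
    fix x assume "x \<in> space (restrict_space borel (sphere (0 :: real ^ 'n) 1))"
    then have "x \<noteq> 0" by (auto simp: space_restrict_space)
    then show "span {x} \<in> topspace proj_topology"
      unfolding topspace_proj_topology proj_space_def by blast
  qed
next
  fix U :: "(real ^ 'n) set set" assume "openin proj_topology U"
  then have "{v. v \<noteq> 0 \<and> span {v} \<in> U} \<in> sets borel" by (simp add: openin_proj_topology)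
  moreover have "(\<lambda>x. span {x}) -` U \<inter> space (restrict_space borel (sphere 0 1)) =
      sphere 0 1 \<inter> {v. v \<noteq> 0 \<and> span {v} \<in> U}"
    by (auto simp: space_restrict_space)
  ultimately show "(\<lambda>x. span {x}) -` U \<inter> space (restrict_space borel (sphere 0 1)) \<in>
      sets (restrict_space borel (sphere 0 1))"
    unfolding sets_restrict_space by (intro image_eqI)
qed

lemma measurable_proj_map:
  fixes A :: "real ^ 'n ^ 'n"
  assumes A: "A \<in> SL"
  shows "proj_map A \<in> measurable (borel_of proj_topology) (borel_of proj_topology)"
proof (rule measurable_borel_of)
  have maps: "proj_map A l \<in> proj_space" if "l \<in> proj_space" for l
  proof -
    from that obtain v where v: "v \<noteq> 0" "l = span {v}" by (auto simp: proj_space_def)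
    then have "proj_map A l = span {A *v v}" "A *v v \<noteq> 0"
      by (simp_all add: proj_map_span SL_mult_eq_0_iff[OF A])
    then show ?thesis unfolding proj_space_def by blast
  qed
  then show "proj_map A \<in> space (borel_of proj_topology) \<rightarrow> topspace proj_topology"
    by (auto simp: space_borel_of)
  fix U :: "(real ^ 'n) set set" assume U: "openin proj_topology U"
  have "v \<noteq> 0 \<and> span {v} \<in> proj_map A -` U \<inter> proj_space \<longleftrightarrow> A *v v \<noteq> 0 \<and> span {A *v v} \<in> U" for v
  proof -
    have "v \<noteq> 0 \<Longrightarrow> span {v} \<in> proj_space" unfolding proj_space_def by blast
    then show ?thesis
      unfolding SL_mult_eq_0_iff[OF A] vimage_eq Int_iff proj_map_span by blast
  qed
  then have "{v. v \<noteq> 0 \<and> span {v} \<in> proj_map A -` U \<inter> proj_space} = (*v) A -` {v. v \<noteq> 0 \<and> span {v} \<in> U}"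
    by blast
  moreover have "open ((*v) A -` {v. v \<noteq> 0 \<and> span {v} \<in> U})"
    using U by (intro open_vimage linear_continuous_on) (auto simp: openin_proj_topology)
  ultimately have "openin proj_topology (proj_map A -` U \<inter> proj_space)"
    by (auto simp: openin_proj_topology)
  from sets_borel_of_openin[OF this]
  show "proj_map A -` U \<inter> space (borel_of proj_topology) \<in> sets (borel_of proj_topology)"
    by (simp add: space_borel_of)
qed

text \<open>Directions are represented by unit vectors, on which \<open>A\<close> acts by \<open>x \<mapsto> sgn (A *v x)\<close>. The map from a
  unit vector to its line intertwines this action with \<open>proj_map A\<close>, so an invariance found on the
  sphere contradicts the measures condition on projective space.\<close>

lemma sphere_laws_to_projective:
  fixes \<mu> :: "(real ^ 'n ^ 'n) measure"
  assumes \<mu>: "\<mu> \<in> SL_laws" and \<nu>: "\<nu> \<in> sphere_laws" "\<nu>' \<in> sphere_laws"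
    and ae: "AE A in \<mu>. distr \<nu> (restrict_space borel (sphere 0 1)) (\<lambda>x. sgn (A *v x)) = \<nu>'"
  shows "\<exists>\<nu>\<^sub>1 \<in> borel_prob_measures proj_topology. \<exists>\<nu>\<^sub>2 \<in> borel_prob_measures proj_topology.
    AE A in \<mu>. distr \<nu>\<^sub>1 (borel_of proj_topology) (proj_map A) = \<nu>\<^sub>2"
proof -
  let ?S = "restrict_space borel (sphere (0 :: real ^ 'n) 1)"
  let ?P = "borel_of proj_topology :: (real ^ 'n) set measure"
  define push where "push \<rho> = distr \<rho> ?P (\<lambda>x. span {x})" for \<rho> :: "(real ^ 'n) measure"
  have meas: "(\<lambda>x. span {x}) \<in> measurable \<rho> ?P" if "\<rho> \<in> sphere_laws" for \<rho> :: "(real ^ 'n) measure"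
    using measurable_borel_prob_measures[OF that closed_sphere measurable_span_singleton] .
  have push: "push \<rho> \<in> borel_prob_measures proj_topology" if "\<rho> \<in> sphere_laws" for \<rho>
    using prob_space.prob_space_distr[OF sphere_lawsD(1)[OF that] meas[OF that]]
    by (simp add: borel_prob_measures_def push_def)
  have "AE A in \<mu>. distr (push \<nu>) ?P (proj_map A) = push \<nu>'"
    using ae AE_space
  proof eventually_elim
    case (elim A)
    then have A: "A \<in> SL" by (simp add: SL_lawsD(3)[OF \<mu>])
    have m: "(\<lambda>x. sgn (A *v x)) \<in> measurable \<nu> ?S"
    proof (rule measurable_restrict_space2)
      show "(\<lambda>x. sgn (A *v x)) \<in> space \<nu> \<rightarrow> sphere 0 1"
        using sgn_SL_sphere[OF A] unfolding sphere_lawsD(3)[OF \<nu>(1)] by blast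
      show "(\<lambda>x. sgn (A *v x)) \<in> borel_measurable \<nu>"
        by (rule measurable_sphere_law[OF \<nu>(1)]) measurable
    qed
    have "distr (push \<nu>) ?P (proj_map A) = distr \<nu> ?P (\<lambda>x. proj_map A (span {x}))"
      unfolding push_def using measurable_proj_map[OF A] meas[OF \<nu>(1)]
      by (simp add: distr_distr comp_def)
    also have "\<dots> = distr \<nu> ?P (\<lambda>x. span {sgn (A *v x)})"
    proof (rule distr_cong)
      fix x assume "x \<in> space \<nu>"
      then have "x \<in> sphere 0 1" by (simp only: sphere_lawsD(3)[OF \<nu>(1)])
      then have "A *v x \<noteq> 0" by (rule SL_mult_sphere_neq_0[OF A])
      then show "proj_map A (span {x}) = span {sgn (A *v x)}"
        by (simp add: proj_map_span span_singleton_sgn)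
    qed auto
    also have "\<dots> = push (distr \<nu> ?S (\<lambda>x. sgn (A *v x)))"
      unfolding push_def
      by (rule distr_distr[OF measurable_span_singleton m, symmetric, unfolded comp_def])
    also have "\<dots> = push \<nu>'" using elim by simp
    finally show ?case .
  qed
  with push[OF \<nu>(1)] push[OF \<nu>(2)] show ?thesis by blast
qed

text \<open>Convergence is joint in the matrix and in the law of the direction: the maps
  \<open>x \<mapsto> sgn (Aj j *v x)\<close> converge continuously on the sphere. In particular the averages, as functions
  of the matrix, converge continuously, and one can integrate once more over a convergent law of
  matrices.\<close>

lemma (in free_ultrafilter) tendsto_action_integral:
  fixes \<phi> :: "real ^ 'n \<Rightarrow> real"
  assumes \<phi>: "continuous_on UNIV \<phi>" "\<And>x. \<bar>\<phi> x\<bar> \<le> 1"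
    and \<nu>: "\<And>j. \<nu>j j \<in> sphere_laws" "\<nu> \<in> sphere_laws" "weak_limit (sphere 0 1) \<nu>j \<nu>"
    and A: "\<And>j. Aj j \<in> SL" "A \<in> SL" "(Aj \<longlongrightarrow> A) F"
  shows "((\<lambda>j. \<integral>x. \<phi> (sgn (Aj j *v x)) \<partial>\<nu>j j) \<longlongrightarrow> (\<integral>x. \<phi> (sgn (A *v x)) \<partial>\<nu>)) F"
proof (rule weak_limit_continuous_convergence_compact[OF compact_sphere \<nu>, where B = 1])
  have [measurable]: "\<phi> \<in> borel_measurable borel"
    using \<phi>(1) by (rule borel_measurable_continuous_onI)
  show "(\<lambda>x. \<phi> (sgn (Aj j *v x))) \<in> borel_measurable (restrict_space borel (sphere 0 1))" for j
    by (rule measurable_restrict_space1) measurable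
  show "\<bar>\<phi> (sgn (Aj j *v x))\<bar> \<le> 1" for j x by (rule \<phi>)
  fix x :: "nat \<Rightarrow> real ^ 'n" and l assume x: "\<And>j. x j \<in> sphere 0 1" "l \<in> sphere 0 1" "(x \<longlongrightarrow> l) F"
  have "((\<lambda>j. Aj j *v x j) \<longlongrightarrow> A *v l) F"
    unfolding matrix_vector_mult_def by (intro tendsto_intros A x)
  moreover have "A *v l \<noteq> 0" by (rule SL_mult_sphere_neq_0[OF A(2) x(2)])
  ultimately have "((\<lambda>j. sgn (Aj j *v x j)) \<longlongrightarrow> sgn (A *v l)) F" by (rule tendsto_sgn)
  moreover have "isCont \<phi> (sgn (A *v l))" using \<phi>(1) by (simp add: continuous_on_eq_continuous_at)
  ultimately show "((\<lambda>j. \<phi> (sgn (Aj j *v x j))) \<longlongrightarrow> \<phi> (sgn (A *v l))) F"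
    by (rule isCont_tendsto_compose[rotated])
qed

lemma borel_measurable_action_integral:
  fixes \<phi> :: "real ^ 'n \<Rightarrow> real"
  assumes [measurable]: "\<phi> \<in> borel_measurable borel" and \<nu>: "\<nu> \<in> sphere_laws"
  shows "(\<lambda>A :: real ^ 'n ^ 'n. \<integral>x. \<phi> (sgn (A *v x)) \<partial>\<nu>) \<in> borel_measurable borel"
proof -
  interpret prob_space \<nu> by (rule sphere_lawsD[OF \<nu>])
  have [measurable]: "(\<lambda>p. snd p) \<in> measurable (borel \<Otimes>\<^sub>M \<nu>) borel"
    using measurable_compose[OF measurable_snd measurable_sphere_law[OF \<nu> measurable_ident]]
    by (simp add: id_def)
  have "(\<lambda>p. \<phi> (sgn (fst p *v snd p))) \<in> borel_measurable ((borel :: (real ^ 'n ^ 'n) measure) \<Otimes>\<^sub>M \<nu>)"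
    by measurable
  then show ?thesis
    by (intro borel_measurable_lebesgue_integral) (simp add: split_beta')
qed

lemma lborel_distr_SL:
  fixes A :: "real ^ 'n ^ 'n"
  assumes A: "A \<in> SL"
  shows "distr lborel borel ((*v) A) = lborel"
proof (rule measure_eqI)
  fix X assume "X \<in> sets (distr lborel borel ((*v) A))"
  then have [measurable]: "X \<in> sets borel" by simp
  have "emeasure (distr lborel borel ((*v) A)) X = (\<integral>\<^sup>+x. indicator X x \<partial>distr lborel borel ((*v) A))"
    by simp
  also have "\<dots> = (\<integral>\<^sup>+x. indicator X (A *v x) \<partial>lborel)" by (rule nn_integral_distr) auto
  also have "\<dots> = (\<integral>\<^sup>+x. indicator X x \<partial>lborel)" by (rule nn_integral_lborel_SL[OF A]) simp
  finally show "emeasure (distr lborel borel ((*v) A)) X = emeasure lborel X" by simp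
qed simp


section \<open>A spectral gap on the square integrable functions\<close>

locale no_common_image = compact_moment K \<gamma> C
  for K :: "(real ^ 'n ^ 'n) measure set" and \<gamma> C :: real +
  assumes no_common_image: "\<And>\<mu>. \<mu> \<in> K \<Longrightarrow> \<not> (\<exists>\<nu>\<^sub>1 \<in> borel_prob_measures proj_topology.
        \<exists>\<nu>\<^sub>2 \<in> borel_prob_measures proj_topology.
          AE A in \<mu>. distr \<nu>\<^sub>1 (borel_of proj_topology) (proj_map A) = \<nu>\<^sub>2)"
begin

text \<open>Let \<open>law h\<close> be the law of the direction of a random vector with density \<open>h\<^sup>2\<close>. Since \<open>A\<close> preserves
  Lebesgue measure, \<open>A\<close> carries \<open>law (g j \<circ> A)\<close> to \<open>law (g j)\<close>, and \<open>law (f j)\<close> is close to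
  \<open>law (g j \<circ> A)\<close> whenever \<open>f j\<close> is close to \<open>g j \<circ> A\<close> in mean square. In the limit almost every \<open>A\<close>
  carries the limit of \<open>law (f j)\<close> to the limit of \<open>law (g j)\<close>.\<close>

lemma no_almost_invariant_sequence:
  fixes f g :: "nat \<Rightarrow> real ^ 'n \<Rightarrow> real"
  assumes \<mu>: "\<And>j. \<mu> j \<in> K"
    and [measurable]: "\<And>j. f j \<in> borel_measurable borel" "\<And>j. g j \<in> borel_measurable borel"
    and f: "\<And>j. (\<integral>\<^sup>+x. ennreal ((f j x)\<^sup>2) \<partial>lborel) = 1"
    and g: "\<And>j. (\<integral>\<^sup>+x. ennreal ((g j x)\<^sup>2) \<partial>lborel) = 1"
    and D: "\<And>j. (\<integral>\<^sup>+A. (\<integral>\<^sup>+x. ennreal ((f j x - g j (A *v x))\<^sup>2) \<partial>lborel) \<partial>\<mu> j) \<le> ennreal (\<epsilon> j)"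
    and \<epsilon>: "\<epsilon> \<longlonglongrightarrow> 0"
  shows False
proof -
  obtain F where "free_ultrafilter F" using free_ultrafilter_exists by blast
  interpret free_ultrafilter F by fact
  let ?S = "restrict_space borel (sphere (0 :: real ^ 'n) 1)"
  \<comment> \<open>The value at zero is arbitrary: it makes \<open>dir\<close> a total map to the sphere, and concerns a
    null set.\<close>
  define dir where "dir x = (if x = 0 then axis undefined 1 else sgn x)" for x :: "real ^ 'n"
  have [measurable]: "dir \<in> borel_measurable borel" unfolding dir_def by measurable
  have dir_sphere: "dir x \<in> sphere 0 1" for x by (simp add: dir_def norm_sgn)
  define law where "law h = distr (density lborel (\<lambda>x. ennreal ((h x)\<^sup>2))) ?S dir" for h :: "real ^ 'n \<Rightarrow> real"
  have dens: "prob_space (density lborel (\<lambda>x. ennreal ((h x)\<^sup>2)))"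
    if [measurable]: "h \<in> borel_measurable borel" and "(\<integral>\<^sup>+x. ennreal ((h x)\<^sup>2) \<partial>lborel) = 1" for h :: "real ^ 'n \<Rightarrow> real"
    using that(2) by (intro prob_spaceI) (simp add: emeasure_density cong: nn_integral_cong)
  have law: "law h \<in> sphere_laws"
    and law_int: "\<phi> \<in> borel_measurable borel \<Longrightarrow> (\<integral>x. \<phi> x \<partial>law h) = (\<integral>x. (h x)\<^sup>2 * \<phi> (dir x) \<partial>lborel)"
    if h[measurable]: "h \<in> borel_measurable borel" and 1: "(\<integral>\<^sup>+x. ennreal ((h x)\<^sup>2) \<partial>lborel) = 1"
    for h and \<phi> :: "real ^ 'n \<Rightarrow> real"
  proof -
    have "dir \<in> borel_measurable (density lborel (\<lambda>x. ennreal ((h x)\<^sup>2)))" by simp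
    note * = borel_prob_measures_distr[OF dens[OF h 1] closed_sphere this dir_sphere]
    show "law h \<in> sphere_laws" unfolding law_def by (rule *)
    assume [measurable]: "\<phi> \<in> borel_measurable borel"
    have "(\<integral>x. \<phi> x \<partial>law h) = (\<integral>x. \<phi> (dir x) \<partial>density lborel (\<lambda>x. ennreal ((h x)\<^sup>2)))"
      unfolding law_def by (rule *(3)) (rule measurable_restrict_space1, measurable)
    also have "\<dots> = (\<integral>x. (h x)\<^sup>2 * \<phi> (dir x) \<partial>lborel)"
      by (subst integral_density) auto
    finally show "(\<integral>x. \<phi> x \<partial>law h) = (\<integral>x. (h x)\<^sup>2 * \<phi> (dir x) \<partial>lborel)" .
  qed
  have law_f: "law (f j) \<in> sphere_laws" and law_g: "law (g j) \<in> sphere_laws" for j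
    using law f g by auto
  obtain \<nu> where \<nu>: "\<nu> \<in> sphere_laws" "weak_limit (sphere 0 1) (\<lambda>j. law (f j)) \<nu>"
    using weak_limit_exists[OF compact_sphere, of "\<lambda>j. law (f j)"] law_f by blast
  obtain \<nu>' where \<nu>': "\<nu>' \<in> sphere_laws" "weak_limit (sphere 0 1) (\<lambda>j. law (g j)) \<nu>'"
    using weak_limit_exists[OF compact_sphere, of "\<lambda>j. law (g j)"] law_g by blast
  obtain \<mu>' where \<mu>': "\<mu>' \<in> K" "weak_limit SL \<mu> \<mu>'"
    using compactin_weak_limit[OF compact, of \<mu>] \<mu> by blast
  obtain \<Phi> :: "(real ^ 'n \<Rightarrow> real) set" where \<Phi>: "countable \<Phi>"
    "\<And>\<phi>. \<phi> \<in> \<Phi> \<Longrightarrow> continuous_on UNIV \<phi>" "\<And>\<phi> x. \<phi> \<in> \<Phi> \<Longrightarrow> \<bar>\<phi> x\<bar> \<le> 1"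
    "\<And>M N. M \<in> sphere_laws \<Longrightarrow> N \<in> sphere_laws \<Longrightarrow>
      (\<And>\<phi>. \<phi> \<in> \<Phi> \<Longrightarrow> (\<integral>x. \<phi> x \<partial>M) = (\<integral>x. \<phi> x \<partial>N)) \<Longrightarrow> M = N"
    by (rule measure_determining_family[OF closed_sphere[of 0 1]]) blast
  have "AE A in \<mu>'. (\<integral>x. \<phi> (sgn (A *v x)) \<partial>\<nu>) = (\<integral>x. \<phi> x \<partial>\<nu>')" if "\<phi> \<in> \<Phi>" for \<phi>
  proof -
    have \<phi>: "continuous_on UNIV \<phi>" "\<And>x. \<bar>\<phi> x\<bar> \<le> 1" using \<Phi> that by auto
    have [measurable]: "\<phi> \<in> borel_measurable borel" using \<phi>(1) by (rule borel_measurable_continuous_onI)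
    \<comment> \<open>\<open>H\<close> tests on \<open>\<phi>\<close> whether \<open>A\<close> carries \<open>\<rho>\<close> to \<open>\<rho>'\<close>.\<close>
    define H where "H \<rho> \<rho>' A = (\<integral>x. \<phi> (sgn (A *v x)) \<partial>\<rho>) - (\<integral>x. \<phi> x \<partial>\<rho>')"
      for \<rho> \<rho>' and A :: "real ^ 'n ^ 'n"
    have H_meas [measurable]: "H \<rho> \<rho>' \<in> borel_measurable borel" if "\<rho> \<in> sphere_laws" for \<rho> \<rho>'
      unfolding H_def using borel_measurable_action_integral[OF _ that, of \<phi>] by simp
    have abs_int: "\<bar>\<integral>x. \<psi> x \<partial>\<rho>\<bar> \<le> 1" if "\<rho> \<in> sphere_laws" "\<And>x. \<bar>\<psi> x\<bar> \<le> 1" "\<psi> \<in> borel_measurable borel"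
      for \<rho> and \<psi> :: "real ^ 'n \<Rightarrow> real"
    proof -
      interpret prob_space \<rho> by (rule sphere_lawsD[OF that(1)])
      have "integrable \<rho> \<psi>"
        using that by (intro integrable_const_bound[of _ 1]) (auto intro: measurable_sphere_law[OF that(1)])
      from integral_diff_le[OF this integrable_const[of 0], of 1] that(2) show ?thesis by simp
    qed
    have H_bound: "(H \<rho> \<rho>' A)\<^sup>2 \<le> 4" if "\<rho> \<in> sphere_laws" "\<rho>' \<in> sphere_laws" for \<rho> \<rho>' and A :: "real ^ 'n ^ 'n"
    proof -
      have "\<bar>H \<rho> \<rho>' A\<bar> \<le> 2"
        unfolding H_def using abs_int[OF that(1), of "\<lambda>x. \<phi> (sgn (A *v x))"] abs_int[OF that(2), of \<phi>] \<phi>(2)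
        by fastforce
      from power_mono[OF this, of 2] show ?thesis by simp
    qed
    \<comment> \<open>Cauchy--Schwarz inequality for \<open>f\<^sup>2 - g\<^sup>2 = (f - g) * (f + g)\<close>; the second factor is at most
      two in norm.\<close>
    have H_D: "ennreal ((H (law (f j)) (law (g j)) A)\<^sup>2) \<le> 4 * (\<integral>\<^sup>+x. ennreal ((f j x - g j (A *v x))\<^sup>2) \<partial>lborel)"
      if A: "A \<in> SL" for A j
    proof -
      have sq_int: "integrable lborel (\<lambda>x. (h x)\<^sup>2)"
        if "h \<in> borel_measurable borel" "(\<integral>\<^sup>+x. ennreal ((h x)\<^sup>2) \<partial>lborel) = 1" for h :: "real ^ 'n \<Rightarrow> real"
        using that by (intro integrableI_nonneg) auto
      have gA: "(\<integral>\<^sup>+x. ennreal ((g j (A *v x))\<^sup>2) \<partial>lborel) = 1"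
        using nn_integral_lborel_SL[OF A, of "\<lambda>x. ennreal ((g j x)\<^sup>2)"] g by simp
      have int_mult: "integrable lborel (\<lambda>x. (h x)\<^sup>2 * \<phi> (dir (A *v x)))"
        if "h \<in> borel_measurable borel" "(\<integral>\<^sup>+x. ennreal ((h x)\<^sup>2) \<partial>lborel) = 1" for h :: "real ^ 'n \<Rightarrow> real"
      proof (rule Bochner_Integration.integrable_bound[OF sq_int[OF that]])
        show "AE x in lborel. norm ((h x)\<^sup>2 * \<phi> (dir (A *v x))) \<le> norm ((h x)\<^sup>2)"
          using \<phi>(2) by (auto simp: abs_mult intro!: mult_left_le)
      qed (use that(1) in measurable)
      have "(\<integral>x. \<phi> (sgn (A *v x)) \<partial>law (f j)) = (\<integral>x. (f j x)\<^sup>2 * \<phi> (sgn (A *v dir x)) \<partial>lborel)"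
        by (rule law_int) (use f in auto)
      also have "\<dots> = (\<integral>x. (f j x)\<^sup>2 * \<phi> (dir (A *v x)) \<partial>lborel)"
      proof (rule integral_cong_AE)
        have "AE x in lborel. x \<noteq> (0 :: real ^ 'n)" by (rule AE_lborel_singleton)
        then show "AE x in lborel. (f j x)\<^sup>2 * \<phi> (sgn (A *v dir x)) = (f j x)\<^sup>2 * \<phi> (dir (A *v x))"
          by eventually_elim (simp add: dir_def SL_mult_eq_0_iff[OF A] sgn_mult_sgn)
      qed measurable
      finally have f_eq: "(\<integral>x. \<phi> (sgn (A *v x)) \<partial>law (f j)) = (\<integral>x. (f j x)\<^sup>2 * \<phi> (dir (A *v x)) \<partial>lborel)" .
      have "(\<integral>x. \<phi> x \<partial>law (g j)) = (\<integral>x. (g j x)\<^sup>2 * \<phi> (dir x) \<partial>lborel)"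
        by (rule law_int) (use g in auto)
      also have "\<dots> = (\<integral>x. (g j x)\<^sup>2 * \<phi> (dir x) \<partial>distr lborel borel ((*v) A))"
        by (simp add: lborel_distr_SL[OF A])
      also have "\<dots> = (\<integral>x. (g j (A *v x))\<^sup>2 * \<phi> (dir (A *v x)) \<partial>lborel)"
        by (subst integral_distr) auto
      finally have g_eq: "(\<integral>x. \<phi> x \<partial>law (g j)) = (\<integral>x. (g j (A *v x))\<^sup>2 * \<phi> (dir (A *v x)) \<partial>lborel)" .
      have int_f: "integrable lborel (\<lambda>x. (f j x)\<^sup>2 * \<phi> (dir (A *v x)))" by (rule int_mult) (use f in auto)
      have int_g: "integrable lborel (\<lambda>x. (g j (A *v x))\<^sup>2 * \<phi> (dir (A *v x)))" by (rule int_mult) (use gA in auto)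
      have "(\<integral>\<^sup>+x. (ennreal \<bar>f j x + g j (A *v x)\<bar>)\<^sup>2 \<partial>lborel) \<le>
          (\<integral>\<^sup>+x. 2 * ennreal ((f j x)\<^sup>2) + 2 * ennreal ((g j (A *v x))\<^sup>2) \<partial>lborel)"
      proof (rule nn_integral_mono)
        fix x
        have "(f j x + g j (A *v x))\<^sup>2 \<le> 2 * (f j x)\<^sup>2 + 2 * (g j (A *v x))\<^sup>2"
          using zero_le_power2[of "f j x - g j (A *v x)"] by (simp add: power2_eq_square algebra_simps)
        then show "(ennreal \<bar>f j x + g j (A *v x)\<bar>)\<^sup>2 \<le> 2 * ennreal ((f j x)\<^sup>2) + 2 * ennreal ((g j (A *v x))\<^sup>2)"
          by (simp add: ennreal_power ennreal_mult'[symmetric] ennreal_plus[symmetric] ennreal_leI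
              flip: ennreal_numeral del: ennreal_plus)
      qed
      also have "\<dots> = 4"
        by (subst nn_integral_add) (auto simp: nn_integral_cmult f gA)
      finally have sum_le: "(\<integral>\<^sup>+x. (ennreal \<bar>f j x + g j (A *v x)\<bar>)\<^sup>2 \<partial>lborel) \<le> 4" .
      have "\<bar>H (law (f j)) (law (g j)) A\<bar> = \<bar>\<integral>x. (f j x)\<^sup>2 * \<phi> (dir (A *v x)) - (g j (A *v x))\<^sup>2 * \<phi> (dir (A *v x)) \<partial>lborel\<bar>"
        unfolding H_def f_eq g_eq using int_f int_g by simp
      also have "ennreal \<dots> \<le> (\<integral>\<^sup>+x. ennreal \<bar>(f j x)\<^sup>2 * \<phi> (dir (A *v x)) - (g j (A *v x))\<^sup>2 * \<phi> (dir (A *v x))\<bar> \<partial>lborel)"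
        using integral_norm_bound_ennreal[OF Bochner_Integration.integrable_diff[OF int_f int_g]] by simp
      also have "\<dots> \<le> (\<integral>\<^sup>+x. ennreal \<bar>f j x - g j (A *v x)\<bar> * ennreal \<bar>f j x + g j (A *v x)\<bar> \<partial>lborel)"
      proof (rule nn_integral_mono)
        fix x
        have "\<bar>(f j x)\<^sup>2 * \<phi> (dir (A *v x)) - (g j (A *v x))\<^sup>2 * \<phi> (dir (A *v x))\<bar> =
            \<bar>f j x - g j (A *v x)\<bar> * \<bar>f j x + g j (A *v x)\<bar> * \<bar>\<phi> (dir (A *v x))\<bar>"
          by (simp add: abs_mult[symmetric] power2_eq_square algebra_simps)
        also have "\<dots> \<le> \<bar>f j x - g j (A *v x)\<bar> * \<bar>f j x + g j (A *v x)\<bar>"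
          using \<phi>(2) by (intro mult_left_le) auto
        finally show "ennreal \<bar>(f j x)\<^sup>2 * \<phi> (dir (A *v x)) - (g j (A *v x))\<^sup>2 * \<phi> (dir (A *v x))\<bar> \<le>
            ennreal \<bar>f j x - g j (A *v x)\<bar> * ennreal \<bar>f j x + g j (A *v x)\<bar>"
          by (simp add: ennreal_mult[symmetric] ennreal_leI)
      qed
      finally have "(ennreal \<bar>H (law (f j)) (law (g j)) A\<bar>)\<^sup>2 \<le>
          (\<integral>\<^sup>+x. ennreal \<bar>f j x - g j (A *v x)\<bar> * ennreal \<bar>f j x + g j (A *v x)\<bar> \<partial>lborel)\<^sup>2"
        by (rule power_mono) simp
      also have "\<dots> \<le> (\<integral>\<^sup>+x. (ennreal \<bar>f j x - g j (A *v x)\<bar>)\<^sup>2 \<partial>lborel) *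
          (\<integral>\<^sup>+x. (ennreal \<bar>f j x + g j (A *v x)\<bar>)\<^sup>2 \<partial>lborel)"
        by (rule Cauchy_Schwarz_nn_integral) measurable
      also have "\<dots> \<le> (\<integral>\<^sup>+x. (ennreal \<bar>f j x - g j (A *v x)\<bar>)\<^sup>2 \<partial>lborel) * 4"
        by (intro mult_left_mono sum_le) simp
      finally show ?thesis
        by (simp add: ennreal_power mult.commute)
    qed
    have H_int: "(\<integral>A. (H (law (f j)) (law (g j)) A)\<^sup>2 \<partial>\<mu> j) \<le> 4 * \<bar>\<epsilon> j\<bar>" for j
    proof -
      note m = K_SL[OF \<mu>[of j]]
      have "ennreal (\<integral>A. (H (law (f j)) (law (g j)) A)\<^sup>2 \<partial>\<mu> j) = (\<integral>\<^sup>+A. ennreal ((H (law (f j)) (law (g j)) A)\<^sup>2) \<partial>\<mu> j)"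
        by (rule nn_integral_eq_integral[symmetric])
          (use H_bound[OF law_f law_g] H_meas[OF law_f] in
            \<open>auto intro!: borel_prob_measures_integrable[OF m closed_SL] measurable_restrict_space1\<close>)
      also have "\<dots> \<le> (\<integral>\<^sup>+A. 4 * (\<integral>\<^sup>+x. ennreal ((f j x - g j (A *v x))\<^sup>2) \<partial>lborel) \<partial>\<mu> j)"
        using H_D by (intro nn_integral_mono) (simp add: SL_lawsD(3)[OF m])
      also have "\<dots> = 4 * (\<integral>\<^sup>+A. (\<integral>\<^sup>+x. ennreal ((f j x - g j (A *v x))\<^sup>2) \<partial>lborel) \<partial>\<mu> j)"
        by (rule nn_integral_cmult) (rule measurable_SL_law[OF m], measurable)
      also have "\<dots> \<le> 4 * ennreal \<bar>\<epsilon> j\<bar>"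
        by (intro mult_left_mono order_trans[OF D]) (auto intro: ennreal_leI)
      also have "\<dots> = ennreal (4 * \<bar>\<epsilon> j\<bar>)" by (simp add: ennreal_mult)
      finally show ?thesis by (simp add: ennreal_le_iff)
    qed
    have lim: "((\<lambda>j. \<integral>A. (H (law (f j)) (law (g j)) A)\<^sup>2 \<partial>\<mu> j) \<longlongrightarrow> (\<integral>A. (H \<nu> \<nu>' A)\<^sup>2 \<partial>\<mu>')) F"
    proof (rule weak_limit_continuous_convergence[OF closed_SL K_SL[OF \<mu>] K_SL[OF \<mu>'(1)] \<mu>'(2), where B = 4])
      show "\<exists>D. compact D \<and> D \<subseteq> SL \<and> (\<forall>j. measure (\<mu> j) (SL - D) \<le> e)" if "e > 0" for e
        using K_tight[OF that] \<mu> by blast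
      show "(\<lambda>A. (H (law (f j)) (law (g j)) A)\<^sup>2) \<in> borel_measurable (restrict_space borel SL)" for j
        by (intro measurable_restrict_space1 borel_measurable_power H_meas law_f)
      show "\<bar>(H (law (f j)) (law (g j)) A)\<^sup>2\<bar> \<le> 4" for j A
        using H_bound[OF law_f law_g] by simp
      fix Aj :: "nat \<Rightarrow> real ^ 'n ^ 'n" and A assume A: "\<And>j. Aj j \<in> SL" "A \<in> SL" "(Aj \<longlongrightarrow> A) F"
      have "bounded (\<phi> ` sphere 0 1)" using \<phi>(2) by (intro boundedI[of _ 1]) auto
      with \<nu>'(2) continuous_on_subset[OF \<phi>(1)] have "((\<lambda>j. \<integral>x. \<phi> x \<partial>law (g j)) \<longlongrightarrow> (\<integral>x. \<phi> x \<partial>\<nu>')) F"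
        unfolding weak_limit_def by blast
      then show "((\<lambda>j. (H (law (f j)) (law (g j)) (Aj j))\<^sup>2) \<longlongrightarrow> (H \<nu> \<nu>' A)\<^sup>2) F"
        unfolding H_def by (intro tendsto_intros tendsto_action_integral \<phi> law_f \<nu> A)
    qed
    have "(\<lambda>j. 4 * \<bar>\<epsilon> j\<bar>) \<longlonglongrightarrow> 4 * \<bar>0\<bar>" by (intro tendsto_intros \<epsilon>)
    then have "((\<lambda>j. 4 * \<bar>\<epsilon> j\<bar>) \<longlongrightarrow> 0) F" by (simp add: tendsto_of_sequentially)
    from tendsto_le[OF nontrivial this lim] H_int have "(\<integral>A. (H \<nu> \<nu>' A)\<^sup>2 \<partial>\<mu>') \<le> 0" by simp
    moreover have "0 \<le> (\<integral>A. (H \<nu> \<nu>' A)\<^sup>2 \<partial>\<mu>')" by simp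
    ultimately have "(\<integral>A. (H \<nu> \<nu>' A)\<^sup>2 \<partial>\<mu>') = 0" by linarith
    moreover have "integrable \<mu>' (\<lambda>A. (H \<nu> \<nu>' A)\<^sup>2)"
      using H_bound[OF \<nu>(1) \<nu>'(1)] H_meas[OF \<nu>(1)]
      by (intro borel_prob_measures_integrable[OF K_SL[OF \<mu>'(1)] closed_SL, where B = 4] measurable_restrict_space1) auto
    ultimately have "AE A in \<mu>'. (H \<nu> \<nu>' A)\<^sup>2 = 0"
      by (subst (asm) integral_nonneg_eq_0_iff_AE) auto
    then show ?thesis by eventually_elim (simp add: H_def)
  qed
  then have "AE A in \<mu>'. \<forall>\<phi>\<in>\<Phi>. (\<integral>x. \<phi> (sgn (A *v x)) \<partial>\<nu>) = (\<integral>x. \<phi> x \<partial>\<nu>')"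
    using \<Phi>(1) by (simp add: AE_ball_countable)
  then have "AE A in \<mu>'. distr \<nu> ?S (\<lambda>x. sgn (A *v x)) = \<nu>'"
    using AE_space
  proof eventually_elim
    case (elim A)
    then have A: "A \<in> SL" by (simp add: SL_lawsD(3)[OF K_SL[OF \<mu>'(1)]])
    have m: "(\<lambda>x. sgn (A *v x)) \<in> borel_measurable \<nu>" by (rule measurable_sphere_law[OF \<nu>(1)]) measurable
    have s: "sgn (A *v x) \<in> sphere 0 1" if "x \<in> space \<nu>" for x
      using sgn_SL_sphere[OF A] that by (simp only: sphere_lawsD(3)[OF \<nu>(1)])
    note * = borel_prob_measures_distr[OF sphere_lawsD(1)[OF \<nu>(1)] closed_sphere m s]
    show ?case
    proof (rule \<Phi>(4)[OF *(1) \<nu>'(1)])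
      fix \<phi> assume \<phi>: "\<phi> \<in> \<Phi>"
      have "\<phi> \<in> borel_measurable ?S"
        using \<Phi>(2)[OF \<phi>] by (intro measurable_restrict_space1 borel_measurable_continuous_onI)
      from *(3)[OF _ this] elim(1) \<phi> show "(\<integral>x. \<phi> x \<partial>distr \<nu> ?S (\<lambda>x. sgn (A *v x))) = (\<integral>x. \<phi> x \<partial>\<nu>')"
        by simp
    qed
  qed
  from sphere_laws_to_projective[OF K_SL[OF \<mu>'(1)] \<nu>(1) \<nu>'(1) this] no_common_image[OF \<mu>'(1)]
  show False by blast
qed

text \<open>For unit vectors the squared distance between \<open>f\<close> and \<open>g \<circ> A\<close> is \<open>2 - 2 * \<langle>f, g \<circ> A\<rangle>\<close>. So pairings
  with mean close to one would give a sequence of almost invariant vectors.\<close>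

lemma spectral_gap:
  "\<exists>q. 0 < q \<and> q < 1 \<and> (\<forall>\<mu>\<in>K. \<forall>f g :: real ^ 'n \<Rightarrow> real.
    f \<in> borel_measurable borel \<longrightarrow> g \<in> borel_measurable borel \<longrightarrow> (\<forall>x. 0 \<le> f x) \<longrightarrow> (\<forall>x. 0 \<le> g x) \<longrightarrow>
    (\<integral>\<^sup>+x. ennreal ((f x)\<^sup>2) \<partial>lborel) = 1 \<longrightarrow> (\<integral>\<^sup>+x. ennreal ((g x)\<^sup>2) \<partial>lborel) = 1 \<longrightarrow>
    (\<integral>\<^sup>+A. (\<integral>\<^sup>+x. ennreal (f x * g (A *v x)) \<partial>lborel) \<partial>\<mu>) \<le> ennreal q)"
proof (rule ccontr)
  assume neg: "\<not> ?thesis"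
  define q where "q j = 1 - 1 / real (j + 2)" for j
  have q: "0 < q j" "q j < 1" for j by (auto simp: q_def field_simps)
  define P where "P j \<mu> f g \<longleftrightarrow> \<mu> \<in> K \<and> f \<in> borel_measurable borel \<and> g \<in> borel_measurable borel \<and>
      (\<forall>x. 0 \<le> f x) \<and> (\<forall>x. 0 \<le> g x) \<and>
      (\<integral>\<^sup>+x. ennreal ((f x)\<^sup>2) \<partial>lborel) = 1 \<and> (\<integral>\<^sup>+x. ennreal ((g x)\<^sup>2) \<partial>lborel) = 1 \<and>
      \<not> (\<integral>\<^sup>+A. (\<integral>\<^sup>+x. ennreal (f x * g (A *v x)) \<partial>lborel) \<partial>\<mu>) \<le> ennreal (q j)"
    for j \<mu> and f g :: "real ^ 'n \<Rightarrow> real"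
  have "\<exists>\<mu> f g. P j \<mu> f g" for j
    using neg q[of j] unfolding P_def by blast
  then obtain \<mu> f g where "\<And>j. P j (\<mu> j) (f j) (g j)" by metis
  then have \<mu>: "\<And>j. \<mu> j \<in> K"
    and [measurable]: "\<And>j. f j \<in> borel_measurable borel" "\<And>j. g j \<in> borel_measurable borel"
    and nonneg: "\<And>j x. 0 \<le> f j x" "\<And>j x. 0 \<le> g j x"
    and f: "\<And>j. (\<integral>\<^sup>+x. ennreal ((f j x)\<^sup>2) \<partial>(lborel :: (real ^ 'n) measure)) = 1"
    and g: "\<And>j. (\<integral>\<^sup>+x. ennreal ((g j x)\<^sup>2) \<partial>(lborel :: (real ^ 'n) measure)) = 1"
    and big: "\<And>j. \<not> (\<integral>\<^sup>+A. (\<integral>\<^sup>+x. ennreal (f j x * g j (A *v x)) \<partial>lborel) \<partial>\<mu> j) \<le> ennreal (q j)"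
    unfolding P_def by blast+
  show False
  proof (rule no_almost_invariant_sequence[OF \<mu> _ _ f g])
    show "f j \<in> borel_measurable borel" "g j \<in> borel_measurable borel" for j by measurable
    fix j
    interpret prob_space "\<mu> j" by (rule SL_lawsD[OF K_SL[OF \<mu>]])
    note m = K_SL[OF \<mu>[of j]]
    define X where "X = (\<integral>\<^sup>+A. (\<integral>\<^sup>+x. ennreal (f j x * g j (A *v x)) \<partial>lborel) \<partial>\<mu> j)"
    define D where "D = (\<integral>\<^sup>+A. (\<integral>\<^sup>+x. ennreal ((f j x - g j (A *v x))\<^sup>2) \<partial>lborel) \<partial>\<mu> j)"
    have "D + 2 * X = (\<integral>\<^sup>+A. (\<integral>\<^sup>+x. ennreal ((f j x - g j (A *v x))\<^sup>2) \<partial>lborel) +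
        2 * (\<integral>\<^sup>+x. ennreal (f j x * g j (A *v x)) \<partial>lborel) \<partial>\<mu> j)"
    proof -
      have "(\<lambda>A. \<integral>\<^sup>+x. ennreal ((f j x - g j (A *v x))\<^sup>2) \<partial>lborel) \<in> borel_measurable (\<mu> j)"
        by (rule measurable_SL_law[OF m]) measurable
      moreover have "(\<lambda>A. \<integral>\<^sup>+x. ennreal (f j x * g j (A *v x)) \<partial>lborel) \<in> borel_measurable (\<mu> j)"
        by (rule measurable_SL_law[OF m]) measurable
      ultimately show ?thesis
        unfolding D_def X_def by (simp add: nn_integral_add nn_integral_cmult)
    qed
    also have "\<dots> = (\<integral>\<^sup>+A. 2 \<partial>\<mu> j)"
    proof (rule nn_integral_cong)
      fix A assume "A \<in> space (\<mu> j)"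
      then have A: "A \<in> SL" by (simp add: SL_lawsD(3)[OF m])
      have gA: "(\<integral>\<^sup>+x. ennreal ((g j (A *v x))\<^sup>2) \<partial>lborel) = 1"
        using nn_integral_lborel_SL[OF A, of "\<lambda>x. ennreal ((g j x)\<^sup>2)"] g by simp
      have "(\<integral>\<^sup>+x. ennreal ((f j x - g j (A *v x))\<^sup>2) \<partial>lborel) +
          2 * (\<integral>\<^sup>+x. ennreal (f j x * g j (A *v x)) \<partial>lborel) =
          (\<integral>\<^sup>+x. ennreal ((f j x - g j (A *v x))\<^sup>2) + 2 * ennreal (f j x * g j (A *v x)) \<partial>lborel)"
        by (subst nn_integral_add) (auto simp: nn_integral_cmult)
      also have "\<dots> = (\<integral>\<^sup>+x. ennreal ((f j x)\<^sup>2) + ennreal ((g j (A *v x))\<^sup>2) \<partial>lborel)"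
      proof (rule nn_integral_cong)
        fix x
        have "ennreal ((f j x - g j (A *v x))\<^sup>2) + 2 * ennreal (f j x * g j (A *v x)) =
            ennreal ((f j x - g j (A *v x))\<^sup>2 + 2 * (f j x * g j (A *v x)))"
          using nonneg by (simp add: ennreal_mult')
        also have "\<dots> = ennreal ((f j x)\<^sup>2 + (g j (A *v x))\<^sup>2)"
          by (simp add: power2_eq_square algebra_simps)
        finally show "ennreal ((f j x - g j (A *v x))\<^sup>2) + 2 * ennreal (f j x * g j (A *v x)) =
            ennreal ((f j x)\<^sup>2) + ennreal ((g j (A *v x))\<^sup>2)" by simp
      qed
      also have "\<dots> = 2" by (subst nn_integral_add) (auto simp: f gA)
      finally show "(\<integral>\<^sup>+x. ennreal ((f j x - g j (A *v x))\<^sup>2) \<partial>lborel) +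
          2 * (\<integral>\<^sup>+x. ennreal (f j x * g j (A *v x)) \<partial>lborel) = 2" .
    qed
    also have "\<dots> = 2" by (simp add: emeasure_space_1)
    finally have sum: "D + 2 * X = 2" .
    then have "D + 2 * X < \<top>" by simp
    then have fin: "D \<noteq> \<top>" "X \<noteq> \<top>" by (auto simp: ennreal_mult_less_top)
    then obtain d x where dx: "D = ennreal d" "X = ennreal x" "0 \<le> d" "0 \<le> x"
      by (metis ennreal_cases)
    from sum have "ennreal (d + 2 * x) = ennreal 2"
      using dx by (simp add: ennreal_mult')
    then have "d + 2 * x = 2" using dx by (subst (asm) ennreal_inj) auto
    moreover have "q j < x"
      using big[of j] ennreal_leI[of x "q j"] unfolding X_def[symmetric] dx by linarith
    ultimately have "d \<le> 2 * (1 / real (j + 2))" by (simp add: q_def)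
    then show "(\<integral>\<^sup>+A. (\<integral>\<^sup>+x. ennreal ((f j x - g j (A *v x))\<^sup>2) \<partial>lborel) \<partial>\<mu> j) \<le> ennreal (2 * (1 / real (j + 2)))"
      unfolding D_def[symmetric] dx by (rule ennreal_leI)
  next
    have "(\<lambda>j. 2 * (1 / real (j + 2))) \<longlonglongrightarrow> 2 * 0"
      by (intro tendsto_intros LIMSEQ_ignore_initial_segment[OF lim_1_over_n])
    then show "(\<lambda>j. 2 * (1 / real (j + 2))) \<longlonglongrightarrow> 0" by simp
  qed
qed

end

section \<open>Exponential growth\<close>

lemma ennreal_le_of_power2_le:
  assumes "x\<^sup>2 \<le> ennreal (y\<^sup>2)" "0 \<le> y"
  shows "x \<le> ennreal y"
proof (cases x)
  case (real r)
  with assms have "r\<^sup>2 \<le> y\<^sup>2" by (simp add: ennreal_power ennreal_le_iff)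
  with assms(2) real show ?thesis by (auto intro: ennreal_leI power2_le_imp_le)
next
  case top
  with assms(1) show ?thesis by (simp add: power2_eq_square top_unique)
qed

text \<open>The mean of the operators \<open>g \<mapsto> g \<circ> A\<close> over the law \<open>\<mu>\<close>. It is applied to functions with values
  between 0 and 1, for which the inner integral is finite.\<close>

definition average :: "(real ^ 'n ^ 'n) measure \<Rightarrow> (real ^ 'n \<Rightarrow> real) \<Rightarrow> real ^ 'n \<Rightarrow> real" where
  "average \<mu> g x = enn2real (\<integral>\<^sup>+A. ennreal (g (A *v x)) \<partial>\<mu>)"

lemma
  fixes \<mu> :: "(real ^ 'n ^ 'n) measure"
  assumes \<mu>: "\<mu> \<in> SL_laws" and g [measurable]: "g \<in> borel_measurable borel" and g01: "\<And>x. 0 \<le> g x" "\<And>x. g x \<le> 1"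
  shows ennreal_average: "ennreal (average \<mu> g x) = (\<integral>\<^sup>+A. ennreal (g (A *v x)) \<partial>\<mu>)"
    and average_nonneg: "0 \<le> average \<mu> g x"
    and average_le_1: "average \<mu> g x \<le> 1"
    and borel_measurable_average: "average \<mu> g \<in> borel_measurable borel"
    and average_l2_le: "(\<integral>\<^sup>+x. ennreal ((average \<mu> g x)\<^sup>2) \<partial>lborel) \<le> (\<integral>\<^sup>+x. ennreal ((g x)\<^sup>2) \<partial>lborel)"
proof -
  interpret prob_space \<mu> by (rule SL_lawsD[OF \<mu>])
  have [measurable]: "(\<lambda>A. f A) \<in> borel_measurable \<mu>" if "f \<in> borel_measurable borel" for f :: "_ \<Rightarrow> ennreal"
    using measurable_SL_law[OF \<mu> that] .
  have le: "(\<integral>\<^sup>+A. ennreal (g (A *v x)) \<partial>\<mu>) \<le> 1" for x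
  proof -
    have "(\<integral>\<^sup>+A. ennreal (g (A *v x)) \<partial>\<mu>) \<le> (\<integral>\<^sup>+A. 1 \<partial>\<mu>)"
      using g01 by (intro nn_integral_mono) (simp add: ennreal_le_1)
    then show ?thesis by (simp add: emeasure_space_1)
  qed
  show eq: "ennreal (average \<mu> g x) = (\<integral>\<^sup>+A. ennreal (g (A *v x)) \<partial>\<mu>)" for x
    unfolding average_def using le[of x] by (intro ennreal_enn2real) (auto simp: less_top[symmetric] top_unique)
  show "0 \<le> average \<mu> g x" by (simp add: average_def)
  show "average \<mu> g x \<le> 1"
    using le[of x] unfolding average_def by (metis enn2real_mono enn2real_1 ennreal_one_less_top)
  show "average \<mu> g \<in> borel_measurable borel"
  proof -
    have [measurable]: "(\<lambda>x. \<integral>\<^sup>+A. ennreal (g (A *v x)) \<partial>\<mu>) \<in> borel_measurable borel"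
      by (rule borel_measurable_nn_integral_SL[OF \<mu>]) (simp add: borel_prod[symmetric] split_beta')
    show ?thesis unfolding average_def[abs_def] by measurable
  qed
  have "(\<integral>\<^sup>+x. ennreal ((average \<mu> g x)\<^sup>2) \<partial>lborel) \<le> (\<integral>\<^sup>+x. (\<integral>\<^sup>+A. ennreal ((g (A *v x))\<^sup>2) \<partial>\<mu>) \<partial>lborel)"
  proof (rule nn_integral_mono)
    fix x
    have "ennreal ((average \<mu> g x)\<^sup>2) = (\<integral>\<^sup>+A. ennreal (g (A *v x)) * 1 \<partial>\<mu>)\<^sup>2"
      by (simp add: ennreal_power[symmetric] average_def eq[unfolded average_def])
    also have "\<dots> \<le> (\<integral>\<^sup>+A. (ennreal (g (A *v x)))\<^sup>2 \<partial>\<mu>) * (\<integral>\<^sup>+A. 1\<^sup>2 \<partial>\<mu>)"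
      by (rule Cauchy_Schwarz_nn_integral) measurable
    finally show "ennreal ((average \<mu> g x)\<^sup>2) \<le> (\<integral>\<^sup>+A. ennreal ((g (A *v x))\<^sup>2) \<partial>\<mu>)"
      using g01 by (simp add: ennreal_power emeasure_space_1)
  qed
  also have "\<dots> = (\<integral>\<^sup>+A. (\<integral>\<^sup>+x. ennreal ((g (A *v x))\<^sup>2) \<partial>lborel) \<partial>\<mu>)"
  proof -
    interpret pair_sigma_finite \<mu> "lborel :: (real ^ 'n) measure" ..
    have [measurable]: "(\<lambda>p. fst p) \<in> measurable (\<mu> \<Otimes>\<^sub>M (lborel :: (real ^ 'n) measure)) borel"
      using measurable_compose[OF measurable_fst measurable_SL_law[OF \<mu> measurable_ident]]
      by (simp add: id_def)
    have "(\<lambda>p. ennreal ((g (fst p *v snd p))\<^sup>2)) \<in> borel_measurable (\<mu> \<Otimes>\<^sub>M lborel)"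
      by measurable
    then show ?thesis by (intro Fubini') (simp add: split_beta')
  qed
  also have "\<dots> = (\<integral>\<^sup>+A. (\<integral>\<^sup>+x. ennreal ((g x)\<^sup>2) \<partial>lborel) \<partial>\<mu>)"
    by (intro nn_integral_cong nn_integral_lborel_SL) (auto simp: SL_lawsD(3)[OF \<mu>])
  finally show "(\<integral>\<^sup>+x. ennreal ((average \<mu> g x)\<^sup>2) \<partial>lborel) \<le> (\<integral>\<^sup>+x. ennreal ((g x)\<^sup>2) \<partial>lborel)"
    by (simp add: emeasure_space_1)
qed


context no_common_image
begin

text \<open>Pair the average \<open>h\<close> of \<open>g\<close> with \<open>h\<close> itself: after normalisation the pairing is the quotient of the
  two norms, and the spectral gap bounds it by \<open>q\<close>.\<close>

lemma average_contraction:
  "\<exists>q. 0 < q \<and> q < 1 \<and> (\<forall>\<mu>\<in>K. \<forall>g :: real ^ 'n \<Rightarrow> real.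
    g \<in> borel_measurable borel \<longrightarrow> (\<forall>x. 0 \<le> g x \<and> g x \<le> 1) \<longrightarrow>
    (\<integral>\<^sup>+x. ennreal ((g x)\<^sup>2) \<partial>lborel) < \<top> \<longrightarrow>
    (\<integral>\<^sup>+x. ennreal ((average \<mu> g x)\<^sup>2) \<partial>lborel) \<le> ennreal (q\<^sup>2) * (\<integral>\<^sup>+x. ennreal ((g x)\<^sup>2) \<partial>lborel))"
proof -
  obtain q where q: "0 < q" "q < 1"
    and gap: "\<And>\<mu> f g. \<mu> \<in> K \<Longrightarrow> f \<in> borel_measurable borel \<Longrightarrow> g \<in> borel_measurable borel \<Longrightarrow>
    (\<And>x. 0 \<le> f x) \<Longrightarrow> (\<And>x. 0 \<le> g x) \<Longrightarrow>
    (\<integral>\<^sup>+x. ennreal ((f x)\<^sup>2) \<partial>lborel) = 1 \<Longrightarrow> (\<integral>\<^sup>+x. ennreal ((g x)\<^sup>2) \<partial>lborel) = 1 \<Longrightarrow>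
    (\<integral>\<^sup>+A. (\<integral>\<^sup>+x. ennreal (f x * g (A *v x)) \<partial>(lborel :: (real ^ 'n) measure)) \<partial>\<mu>) \<le> ennreal q"
    using spectral_gap by blast
  have "(\<integral>\<^sup>+x. ennreal ((average \<mu> g x)\<^sup>2) \<partial>lborel) \<le> ennreal (q\<^sup>2) * (\<integral>\<^sup>+x. ennreal ((g x)\<^sup>2) \<partial>lborel)"
    if \<mu>: "\<mu> \<in> K" and g [measurable]: "g \<in> borel_measurable borel" and g01: "\<And>x. 0 \<le> g x" "\<And>x. g x \<le> 1"
      and fin: "(\<integral>\<^sup>+x. ennreal ((g x)\<^sup>2) \<partial>lborel) < \<top>" for \<mu> and g :: "real ^ 'n \<Rightarrow> real"
  proof -
    note m = K_SL[OF \<mu>]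
    interpret prob_space \<mu> by (rule SL_lawsD[OF m])
    let ?h = "average \<mu> g"
    note h [measurable] = borel_measurable_average[OF m g g01]
    have le: "(\<integral>\<^sup>+x. ennreal ((?h x)\<^sup>2) \<partial>lborel) \<le> (\<integral>\<^sup>+x. ennreal ((g x)\<^sup>2) \<partial>lborel)"
      by (rule average_l2_le[OF m g g01])
    obtain N where N: "(\<integral>\<^sup>+x. ennreal ((g x)\<^sup>2) \<partial>lborel) = ennreal N" "0 \<le> N"
      using fin by (metis ennreal_cases less_irrefl)
    obtain N' where N': "(\<integral>\<^sup>+x. ennreal ((?h x)\<^sup>2) \<partial>lborel) = ennreal N'" "0 \<le> N'"
      using le_less_trans[OF le fin] by (metis ennreal_cases less_irrefl)
    show ?thesis
    proof (cases "N' = 0")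
      case True
      then show ?thesis by (simp add: N'(1))
    next
      case False
      with N' le N have pos: "0 < N'" "0 < N" by (auto simp: ennreal_le_iff)
      define a where "a = sqrt N'"
      define b where "b = sqrt N"
      have ab: "0 < a" "0 < b" "a\<^sup>2 = N'" "b\<^sup>2 = N" using pos by (auto simp: a_def b_def)
      have unit: "(\<integral>\<^sup>+x. ennreal ((f x / c)\<^sup>2) \<partial>lborel) = 1"
        if "(\<integral>\<^sup>+x. ennreal ((f x)\<^sup>2) \<partial>lborel) = ennreal (c\<^sup>2)" "0 < c" "f \<in> borel_measurable borel"
        for f :: "real ^ 'n \<Rightarrow> real" and c
      proof -
        have "(\<integral>\<^sup>+x. ennreal ((f x / c)\<^sup>2) \<partial>lborel) = (\<integral>\<^sup>+x. ennreal (1 / c\<^sup>2) * ennreal ((f x)\<^sup>2) \<partial>lborel)"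
          by (simp add: ennreal_mult[symmetric] power_divide)
        also have "\<dots> = ennreal (1 / c\<^sup>2) * ennreal (c\<^sup>2)"
          using that by (simp add: nn_integral_cmult)
        also have "\<dots> = 1" using that(2) by (simp add: ennreal_mult[symmetric] del: ennreal_1 flip: ennreal_1)
        finally show ?thesis .
      qed
      have "ennreal (a / b) = (\<integral>\<^sup>+x. ennreal (1 / (a * b)) * ennreal ((?h x)\<^sup>2) \<partial>lborel)"
      proof -
        have "(\<integral>\<^sup>+x. ennreal (1 / (a * b)) * ennreal ((?h x)\<^sup>2) \<partial>lborel) = ennreal (1 / (a * b)) * ennreal (a\<^sup>2)"
          by (subst nn_integral_cmult) (simp_all add: N'(1) ab(3))
        also have "\<dots> = ennreal (a / b)"
          using ab(1,2) by (simp add: ennreal_mult[symmetric] power2_eq_square)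
        finally show ?thesis by simp
      qed
      also have "\<dots> = (\<integral>\<^sup>+x. ennreal (?h x / (a * b)) * (\<integral>\<^sup>+A. ennreal (g (A *v x)) \<partial>\<mu>) \<partial>lborel)"
        using ab average_nonneg[OF m g g01]
        by (simp add: ennreal_average[OF m g g01, symmetric] ennreal_mult[symmetric] power2_eq_square)
      also have "\<dots> = (\<integral>\<^sup>+x. (\<integral>\<^sup>+A. ennreal (?h x / (a * b)) * ennreal (g (A *v x)) \<partial>\<mu>) \<partial>lborel)"
        by (subst nn_integral_cmult) (auto intro: measurable_SL_law[OF m])
      also have "\<dots> = (\<integral>\<^sup>+x. (\<integral>\<^sup>+A. ennreal ((?h x / a) * (g (A *v x) / b)) \<partial>\<mu>) \<partial>lborel)"
        using ab average_nonneg[OF m g g01] g01 by (simp add: ennreal_mult[symmetric])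
      also have "\<dots> = (\<integral>\<^sup>+A. (\<integral>\<^sup>+x. ennreal ((?h x / a) * (g (A *v x) / b)) \<partial>lborel) \<partial>\<mu>)"
      proof -
        interpret pair_sigma_finite \<mu> "lborel :: (real ^ 'n) measure" ..
        have [measurable]: "(\<lambda>p. fst p) \<in> measurable (\<mu> \<Otimes>\<^sub>M (lborel :: (real ^ 'n) measure)) borel"
          using measurable_compose[OF measurable_fst measurable_SL_law[OF m measurable_ident]]
          by (simp add: id_def)
        have "(\<lambda>p. ennreal ((?h (snd p) / a) * (g (fst p *v snd p) / b))) \<in> borel_measurable (\<mu> \<Otimes>\<^sub>M lborel)"
          by measurable
        then show ?thesis by (intro Fubini') (simp add: split_beta')
      qed
      also have "\<dots> \<le> ennreal q"
        by (rule gap[OF \<mu>])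
          (use ab N N' g01 average_nonneg[OF m g g01] in \<open>auto intro!: unit divide_nonneg_pos\<close>)
      finally have "a \<le> q * b" using ab q by (simp add: ennreal_le_iff field_simps)
      then have "a\<^sup>2 \<le> (q * b)\<^sup>2" using ab by (intro power_mono) auto
      then have "N' \<le> q\<^sup>2 * N" using ab by (simp add: power_mult_distrib)
      then show ?thesis using N(2) by (simp add: N N' ennreal_mult[symmetric] ennreal_leI)
    qed
  qed
  with q show ?thesis by blast
qed

text \<open>Let \<open>u\<close> be the indicator of the unit ball. If \<open>norm x \<le> 1 / op_norm T\<close> then \<open>x\<close> and \<open>T *v x\<close> both lie
  in the unit ball, so the pairing of \<open>u\<close> with \<open>u \<circ> T\<close> is at least the volume of that small ball, which
  is \<open>op_norm T\<close> to the power \<open>- d\<close> times the volume of the unit ball. Averaged over \<open>T\<close>, the pairing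
  is at most \<open>q ^ n\<close> times that volume, as each of the \<open>n\<close> factors contracts by \<open>q\<close>.\<close>

lemma norm_inverse_moment:
  "\<exists>q. 0 < q \<and> q < 1 \<and> (\<forall>\<mu> n. (\<forall>i. \<mu> i \<in> K) \<longrightarrow>
    (\<integral>\<^sup>+T. ennreal (inverse (op_norm T ^ CARD('n))) \<partial>prod_law \<mu> n) \<le> ennreal (q ^ n))"
proof -
  obtain q where q: "0 < q" "q < 1"
    and contr: "\<And>\<mu> g. \<mu> \<in> K \<Longrightarrow> g \<in> borel_measurable borel \<Longrightarrow> (\<And>x. 0 \<le> g x) \<Longrightarrow> (\<And>x. g x \<le> 1) \<Longrightarrow>
    (\<integral>\<^sup>+x. ennreal ((g x)\<^sup>2) \<partial>lborel) < \<top> \<Longrightarrow>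
    (\<integral>\<^sup>+x. ennreal ((average \<mu> g x)\<^sup>2) \<partial>lborel) \<le> ennreal (q\<^sup>2) * (\<integral>\<^sup>+x. ennreal ((g x)\<^sup>2) \<partial>(lborel :: (real ^ 'n) measure))"
    using average_contraction by blast
  have iter: "(\<integral>\<^sup>+x. ennreal ((average (prod_law \<mu> n) g x)\<^sup>2) \<partial>lborel) \<le>
      ennreal ((q ^ n)\<^sup>2) * (\<integral>\<^sup>+x. ennreal ((g x)\<^sup>2) \<partial>lborel)"
    if \<mu>: "\<And>i. \<mu> i \<in> K" and "g \<in> borel_measurable borel" "\<And>x. 0 \<le> g x" "\<And>x. g x \<le> 1"
      "(\<integral>\<^sup>+x. ennreal ((g x)\<^sup>2) \<partial>lborel) < \<top>" for \<mu> and n and g :: "real ^ 'n \<Rightarrow> real"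
    using that(2-)
  proof (induction n arbitrary: g)
    case 0
    note [measurable] = 0(1)
    have "average (prod_law \<mu> 0) g x = g x" for x
      unfolding average_def using K_SL[OF \<mu>] 0 by (subst nn_integral_prod_law_0) auto
    then show ?case by simp
  next
    case (Suc n)
    note [measurable] = Suc.prems(1)
    note m = K_SL[OF \<mu>[of "Suc n"]]
    let ?h = "average (\<mu> (Suc n)) g"
    have "average (prod_law \<mu> (Suc n)) g x = average (prod_law \<mu> n) ?h x" for x
      unfolding average_def[of "prod_law \<mu> (Suc n)"] average_def[of "prod_law \<mu> n"]
      using K_SL[OF \<mu>]
      by (subst nn_integral_prod_law_Suc)
        (auto simp: ennreal_average[OF m Suc.prems(1-3)] matrix_vector_mul_assoc)
    then have "(\<integral>\<^sup>+x. ennreal ((average (prod_law \<mu> (Suc n)) g x)\<^sup>2) \<partial>lborel) =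
        (\<integral>\<^sup>+x. ennreal ((average (prod_law \<mu> n) ?h x)\<^sup>2) \<partial>lborel)" by simp
    also have "\<dots> \<le> ennreal ((q ^ n)\<^sup>2) * (\<integral>\<^sup>+x. ennreal ((?h x)\<^sup>2) \<partial>lborel)"
      by (rule Suc.IH)
        (use borel_measurable_average[OF m Suc.prems(1-3)] average_nonneg[OF m Suc.prems(1-3)]
          average_le_1[OF m Suc.prems(1-3)] le_less_trans[OF average_l2_le[OF m Suc.prems(1-3)] Suc.prems(4)]
          in auto)
    also have "\<dots> \<le> ennreal ((q ^ n)\<^sup>2) * (ennreal (q\<^sup>2) * (\<integral>\<^sup>+x. ennreal ((g x)\<^sup>2) \<partial>lborel))"
      by (intro mult_left_mono contr \<mu> Suc.prems) simp
    also have "\<dots> = ennreal ((q ^ Suc n)\<^sup>2) * (\<integral>\<^sup>+x. ennreal ((g x)\<^sup>2) \<partial>lborel)"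
      by (simp add: mult.assoc[symmetric] ennreal_mult[symmetric] power_mult_distrib) (simp add: mult.commute)
    finally show ?case .
  qed
  have "(\<integral>\<^sup>+T. ennreal (inverse (op_norm T ^ CARD('n))) \<partial>prod_law \<mu> n) \<le> ennreal (q ^ n)"
    if \<mu>: "\<And>i. \<mu> i \<in> K" for \<mu> n
  proof -
    note m = prod_law_SL[OF K_SL[OF \<mu>], where n = n]
    interpret prob_space "prod_law \<mu> n" by (rule SL_lawsD[OF m])
    define u :: "real ^ 'n \<Rightarrow> real" where "u = indicator (cball 0 1)"
    have u: "u \<in> borel_measurable borel" "0 \<le> u x" "u x \<le> 1" for x
      by (auto simp: u_def intro!: borel_measurable_indicator)
    note [measurable] = u(1) borel_measurable_average[OF m u]
    define b where "b = unit_ball_vol (real CARD('n))"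
    have b: "0 < b" by (simp add: b_def)
    have u_l2: "(\<integral>\<^sup>+x. ennreal ((u x)\<^sup>2) \<partial>lborel) = ennreal b"
    proof -
      have "ennreal ((u x)\<^sup>2) = indicator (cball 0 1) x" for x by (simp add: u_def indicator_def)
      then have "(\<integral>\<^sup>+x. ennreal ((u x)\<^sup>2) \<partial>lborel) = emeasure lborel (cball (0 :: real ^ 'n) 1)" by simp
      also have "\<dots> = ennreal b" by (simp add: emeasure_cball b_def)
      finally show ?thesis .
    qed
    have "ennreal b * (\<integral>\<^sup>+T. ennreal (inverse (op_norm T ^ CARD('n))) \<partial>prod_law \<mu> n) =
        (\<integral>\<^sup>+T. ennreal b * ennreal (inverse (op_norm T ^ CARD('n))) \<partial>prod_law \<mu> n)"
      by (rule nn_integral_cmult[symmetric]) (rule measurable_SL_law[OF m], measurable)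
    also have "\<dots> \<le> (\<integral>\<^sup>+T. (\<integral>\<^sup>+x. ennreal (u x * u (T *v x)) \<partial>lborel) \<partial>prod_law \<mu> n)"
    proof (rule nn_integral_mono)
      fix T :: "real ^ 'n ^ 'n" assume "T \<in> space (prod_law \<mu> n)"
      then have T: "1 \<le> op_norm T" by (simp add: SL_lawsD(3)[OF m] one_le_op_norm_SL)
      have "ennreal b * ennreal (inverse (op_norm T ^ CARD('n))) = emeasure lborel (cball (0 :: real ^ 'n) (inverse (op_norm T)))"
        using T b by (simp add: emeasure_cball b_def ennreal_mult[symmetric] power_inverse)
      also have "\<dots> = (\<integral>\<^sup>+x. indicator (cball (0 :: real ^ 'n) (inverse (op_norm T))) x \<partial>lborel)" by simp
      also have "\<dots> \<le> (\<integral>\<^sup>+x. ennreal (u x * u (T *v x)) \<partial>lborel)"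
      proof (rule nn_integral_mono)
        fix x :: "real ^ 'n"
        have "norm x \<le> 1 \<and> norm (T *v x) \<le> 1" if "norm x \<le> inverse (op_norm T)"
        proof
          show "norm x \<le> 1" using that T by (meson inverse_le_1_iff order_trans)
          have "norm (T *v x) \<le> op_norm T * norm x" by (rule norm_matrix_vector_mult_le)
          also have "\<dots> \<le> op_norm T * inverse (op_norm T)" using that T by (intro mult_left_mono) auto
          finally show "norm (T *v x) \<le> 1" using T by simp
        qed
        then show "indicator (cball 0 (inverse (op_norm T))) x \<le> ennreal (u x * u (T *v x))"
          by (auto simp: u_def indicator_def)
      qed
      finally show "ennreal b * ennreal (inverse (op_norm T ^ CARD('n))) \<le> (\<integral>\<^sup>+x. ennreal (u x * u (T *v x)) \<partial>lborel)" .
    qed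
    also have "\<dots> = (\<integral>\<^sup>+x. (\<integral>\<^sup>+T. ennreal (u x * u (T *v x)) \<partial>prod_law \<mu> n) \<partial>lborel)"
    proof -
      interpret pair_sigma_finite "prod_law \<mu> n" "lborel :: (real ^ 'n) measure" ..
      have [measurable]: "(\<lambda>p. fst p) \<in> measurable (prod_law \<mu> n \<Otimes>\<^sub>M (lborel :: (real ^ 'n) measure)) borel"
        using measurable_compose[OF measurable_fst measurable_SL_law[OF m measurable_ident]]
        by (simp add: id_def)
      have "(\<lambda>p. ennreal (u (snd p) * u (fst p *v snd p))) \<in> borel_measurable (prod_law \<mu> n \<Otimes>\<^sub>M lborel)"
        by measurable
      then show ?thesis by (intro Fubini'[symmetric]) (simp add: split_beta')
    qed
    also have "\<dots> = (\<integral>\<^sup>+x. ennreal (u x) * ennreal (average (prod_law \<mu> n) u x) \<partial>lborel)"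
    proof (rule nn_integral_cong)
      fix x
      have "(\<integral>\<^sup>+T. ennreal (u x * u (T *v x)) \<partial>prod_law \<mu> n) = (\<integral>\<^sup>+T. ennreal (u x) * ennreal (u (T *v x)) \<partial>prod_law \<mu> n)"
        using u(2) by (simp add: ennreal_mult)
      also have "\<dots> = ennreal (u x) * (\<integral>\<^sup>+T. ennreal (u (T *v x)) \<partial>prod_law \<mu> n)"
        by (rule nn_integral_cmult) (rule measurable_SL_law[OF m], measurable)
      finally show "(\<integral>\<^sup>+T. ennreal (u x * u (T *v x)) \<partial>prod_law \<mu> n) = ennreal (u x) * ennreal (average (prod_law \<mu> n) u x)"
        by (simp add: ennreal_average[OF m u])
    qed
    finally have "(ennreal b * (\<integral>\<^sup>+T. ennreal (inverse (op_norm T ^ CARD('n))) \<partial>prod_law \<mu> n))\<^sup>2 \<le>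
        (\<integral>\<^sup>+x. ennreal (u x) * ennreal (average (prod_law \<mu> n) u x) \<partial>lborel)\<^sup>2"
      by (rule power_mono) simp
    also have "\<dots> \<le> (\<integral>\<^sup>+x. (ennreal (u x))\<^sup>2 \<partial>lborel) * (\<integral>\<^sup>+x. (ennreal (average (prod_law \<mu> n) u x))\<^sup>2 \<partial>lborel)"
      by (rule Cauchy_Schwarz_nn_integral) measurable
    also have "\<dots> = ennreal b * (\<integral>\<^sup>+x. ennreal ((average (prod_law \<mu> n) u x)\<^sup>2) \<partial>lborel)"
      using u(2) average_nonneg[OF m u] by (simp add: ennreal_power u_l2)
    also have "\<dots> \<le> ennreal b * (ennreal ((q ^ n)\<^sup>2) * ennreal b)"
      using iter[OF \<mu> u] by (intro mult_left_mono) (auto simp: u_l2)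
    also have "\<dots> = ennreal ((b * q ^ n)\<^sup>2)"
      using b q by (simp add: power_mult_distrib ennreal_mult[symmetric] power2_eq_square mult_ac)
    finally have "ennreal b * (\<integral>\<^sup>+T. ennreal (inverse (op_norm T ^ CARD('n))) \<partial>prod_law \<mu> n) \<le> ennreal (b * q ^ n)"
      by (rule ennreal_le_of_power2_le) (use b q in simp)
    also have "\<dots> = ennreal b * ennreal (q ^ n)" using b q by (simp add: ennreal_mult)
    finally show ?thesis using b by (simp add: ennreal_mult_le_mult_iff)
  qed
  with q show ?thesis by blast
qed

text \<open>Jensen's inequality for the logarithm, in the form of the tangent bound \<open>ln z \<le> z - 1\<close> at the random
  variable \<open>z\<close> whose mean is at most one by \<open>norm_inverse_moment\<close>.\<close>

theorem expected_log_norm_growth: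
  "\<exists>lam>0. \<forall>\<mu> n. (\<forall>i. \<mu> i \<in> K) \<longrightarrow> real n * lam \<le> expected_log_norm \<mu> n"
proof -
  obtain q where q: "0 < q" "q < 1"
    and mom: "\<And>\<mu> n. (\<And>i. \<mu> i \<in> K) \<Longrightarrow> (\<integral>\<^sup>+T. ennreal (inverse (op_norm T ^ CARD('n))) \<partial>prod_law \<mu> n) \<le> ennreal (q ^ n)"
    using norm_inverse_moment by blast
  define lam where "lam = - ln q / real CARD('n)"
  have "real n * lam \<le> expected_log_norm \<mu> n" if \<mu>: "\<And>i. \<mu> i \<in> K" for \<mu> n
  proof -
    note m = prod_law_SL[OF K_SL[OF \<mu>], where n = n]
    interpret prob_space "prod_law \<mu> n" by (rule SL_lawsD[OF m])
    have int: "integrable (prod_law \<mu> n) (\<lambda>T. inverse (op_norm T ^ CARD('n)))"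
    proof (rule integrableI_nonneg)
      show "(\<lambda>T. inverse (op_norm T ^ CARD('n))) \<in> borel_measurable (prod_law \<mu> n)"
        by (rule measurable_SL_law[OF m]) measurable
      show "AE T in prod_law \<mu> n. 0 \<le> inverse (op_norm T ^ CARD('n))"
        by (simp add: op_norm_nonneg)
      show "(\<integral>\<^sup>+T. ennreal (inverse (op_norm T ^ CARD('n))) \<partial>prod_law \<mu> n) < \<infinity>"
        using le_less_trans[OF mom ennreal_less_top] \<mu> by simp
    qed
    have le: "(\<integral>T. inverse (op_norm T ^ CARD('n)) \<partial>prod_law \<mu> n) \<le> q ^ n"
    proof -
      have "ennreal (\<integral>T. inverse (op_norm T ^ CARD('n)) \<partial>prod_law \<mu> n) =
          (\<integral>\<^sup>+T. ennreal (inverse (op_norm T ^ CARD('n))) \<partial>prod_law \<mu> n)"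
        by (rule nn_integral_eq_integral[OF int, symmetric]) (simp add: op_norm_nonneg)
      also have "\<dots> \<le> ennreal (q ^ n)" by (rule mom[OF \<mu>])
      finally show ?thesis using q by (simp add: ennreal_le_iff)
    qed
    have "(\<integral>T. - real CARD('n) * ln (op_norm T) \<partial>prod_law \<mu> n) \<le>
        (\<integral>T. inverse (op_norm T ^ CARD('n)) / q ^ n - 1 + real n * ln q \<partial>prod_law \<mu> n)"
    proof (rule integral_mono)
      show "integrable (prod_law \<mu> n) (\<lambda>T. - real CARD('n) * ln (op_norm T))"
        using integrable_ln_op_norm[OF \<mu>] by (intro integrable_mult_right)
      show "integrable (prod_law \<mu> n) (\<lambda>T. inverse (op_norm T ^ CARD('n)) / q ^ n - 1 + real n * ln q)"
        using int by simp
      fix T :: "real ^ 'n ^ 'n" assume "T \<in> space (prod_law \<mu> n)"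
      then have T: "1 \<le> op_norm T" by (simp add: SL_lawsD(3)[OF m] one_le_op_norm_SL)
      define z where "z = inverse (op_norm T ^ CARD('n)) / q ^ n"
      have "0 < z" using T q by (simp add: z_def)
      have "ln z = - real CARD('n) * ln (op_norm T) - real n * ln q"
        using T q by (simp add: z_def ln_div ln_inverse ln_realpow)
      with ln_le_minus_one[OF \<open>0 < z\<close>]
      show "- real CARD('n) * ln (op_norm T) \<le> inverse (op_norm T ^ CARD('n)) / q ^ n - 1 + real n * ln q"
        by (simp add: z_def)
    qed
    also have "\<dots> = (\<integral>T. inverse (op_norm T ^ CARD('n)) \<partial>prod_law \<mu> n) / q ^ n - 1 + real n * ln q"
      using int by (simp add: prob_space)
    also have "\<dots> \<le> real n * ln q" using le q by (simp add: field_simps)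
    finally have "- real CARD('n) * expected_log_norm \<mu> n \<le> real n * ln q"
      by (simp add: expected_log_norm_eq[OF \<mu>])
    then show ?thesis by (simp add: lam_def field_simps)
  qed
  moreover have "0 < lam" using q by (simp add: lam_def divide_neg_pos)
  ultimately show ?thesis by blast
qed

end

section \<open>Laws of random directions\<close>

text \<open>This is the convolution \<open>M * \<nu>\<close> of Furstenberg's theory: the law of the direction of \<open>A *v x\<close> for
  independent \<open>A\<close> and \<open>x\<close> with laws \<open>M\<close> and \<open>\<nu>\<close>.\<close>

definition act :: "(real ^ 'n ^ 'n) measure \<Rightarrow> (real ^ 'n) measure \<Rightarrow> (real ^ 'n) measure" where
  "act M \<nu> = distr (M \<Otimes>\<^sub>M \<nu>) (restrict_space borel (sphere 0 1)) (\<lambda>p. sgn (fst p *v snd p))"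

definition dir_law :: "(nat \<Rightarrow> (real ^ 'n ^ 'n) measure) \<Rightarrow> nat \<Rightarrow> real ^ 'n \<Rightarrow> (real ^ 'n) measure" where
  "dir_law \<mu> n v = distr (prod_law \<mu> n) (restrict_space borel (sphere 0 1)) (\<lambda>T. sgn (T *v v))"

lemma
  fixes M :: "(real ^ 'n ^ 'n) measure" and \<phi> :: "real ^ 'n \<Rightarrow> real"
  assumes M: "M \<in> SL_laws" and \<nu>: "\<nu> \<in> sphere_laws"
  shows act_sphere: "act M \<nu> \<in> sphere_laws"
    and nn_integral_act: "h \<in> borel_measurable borel \<Longrightarrow>
      (\<integral>\<^sup>+x. h x \<partial>act M \<nu>) = (\<integral>\<^sup>+A. (\<integral>\<^sup>+x. h (sgn (A *v x)) \<partial>\<nu>) \<partial>M)"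
    and integral_act: "\<phi> \<in> borel_measurable borel \<Longrightarrow> (\<And>x. \<bar>\<phi> x\<bar> \<le> 1) \<Longrightarrow>
      (\<integral>x. \<phi> x \<partial>act M \<nu>) = (\<integral>A. (\<integral>x. \<phi> (sgn (A *v x)) \<partial>\<nu>) \<partial>M)"
proof -
  interpret M: prob_space M by (rule SL_lawsD[OF M])
  interpret N: prob_space \<nu> by (rule sphere_lawsD[OF \<nu>])
  interpret pair_prob_space M \<nu> ..
  have [measurable]: "(\<lambda>p. fst p) \<in> measurable (M \<Otimes>\<^sub>M \<nu>) borel"
    using measurable_compose[OF measurable_fst measurable_SL_law[OF M measurable_ident]]
    by (simp add: id_def)
  have [measurable]: "(\<lambda>p. snd p) \<in> measurable (M \<Otimes>\<^sub>M \<nu>) borel"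
    using measurable_compose[OF measurable_snd measurable_sphere_law[OF \<nu> measurable_ident]]
    by (simp add: id_def)
  have m: "(\<lambda>p. sgn (fst p *v snd p)) \<in> borel_measurable (M \<Otimes>\<^sub>M \<nu>)" by measurable
  have s: "sgn (fst p *v snd p) \<in> sphere 0 1" if "p \<in> space (M \<Otimes>\<^sub>M \<nu>)" for p
    using that SL_lawsD(3)[OF M] sphere_lawsD(3)[OF \<nu>]
    by (intro sgn_SL_sphere) (auto simp only: space_pair_measure mem_Times_iff)
  note * = borel_prob_measures_distr[OF P.prob_space_axioms closed_sphere m s]
  show "act M \<nu> \<in> sphere_laws" unfolding act_def by (rule *)
  show "h \<in> borel_measurable borel \<Longrightarrow>
      (\<integral>\<^sup>+x. h x \<partial>act M \<nu>) = (\<integral>\<^sup>+A. (\<integral>\<^sup>+x. h (sgn (A *v x)) \<partial>\<nu>) \<partial>M)"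
  proof -
    assume [measurable]: "h \<in> borel_measurable borel"
    have "(\<integral>\<^sup>+x. h x \<partial>act M \<nu>) = (\<integral>\<^sup>+p. h (sgn (fst p *v snd p)) \<partial>(M \<Otimes>\<^sub>M \<nu>))"
      unfolding act_def by (rule *(2)) auto
    also have "\<dots> = (\<integral>\<^sup>+A. (\<integral>\<^sup>+x. h (sgn (A *v x)) \<partial>\<nu>) \<partial>M)"
      by (subst N.nn_integral_fst[symmetric]) simp_all
    finally show ?thesis .
  qed
  show "\<phi> \<in> borel_measurable borel \<Longrightarrow> (\<And>x. \<bar>\<phi> x\<bar> \<le> 1) \<Longrightarrow>
      (\<integral>x. \<phi> x \<partial>act M \<nu>) = (\<integral>A. (\<integral>x. \<phi> (sgn (A *v x)) \<partial>\<nu>) \<partial>M)"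
  proof -
    assume [measurable]: "\<phi> \<in> borel_measurable borel" and b: "\<And>x. \<bar>\<phi> x\<bar> \<le> 1"
    have "(\<integral>x. \<phi> x \<partial>act M \<nu>) = (\<integral>p. \<phi> (sgn (fst p *v snd p)) \<partial>(M \<Otimes>\<^sub>M \<nu>))"
      unfolding act_def by (rule *(3)) (auto intro: measurable_restrict_space1)
    also have "\<dots> = (\<integral>A. (\<integral>x. \<phi> (sgn (A *v x)) \<partial>\<nu>) \<partial>M)"
    proof -
      have "integrable (M \<Otimes>\<^sub>M \<nu>) (\<lambda>p. \<phi> (sgn (fst p *v snd p)))"
        using b by (intro P.integrable_const_bound[of _ 1]) auto
      from integral_fst'[OF this] show ?thesis by simp
    qed
    finally show ?thesis .
  qed
qed

lemma
  fixes \<mu> :: "nat \<Rightarrow> (real ^ 'n ^ 'n) measure"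
  assumes \<mu>: "\<And>i. \<mu> i \<in> SL_laws" and v: "v \<noteq> 0"
  shows dir_law_sphere: "dir_law \<mu> n v \<in> sphere_laws"
    and nn_integral_dir_law: "h \<in> borel_measurable borel \<Longrightarrow>
      (\<integral>\<^sup>+x. h x \<partial>dir_law \<mu> n v) = (\<integral>\<^sup>+T. h (sgn (T *v v)) \<partial>prod_law \<mu> n)"
proof -
  note m = prod_law_SL[OF \<mu>, where n = n]
  have meas: "(\<lambda>T. sgn (T *v v)) \<in> borel_measurable (prod_law \<mu> n)"
    by (rule measurable_SL_law[OF m]) measurable
  have s: "sgn (T *v v) \<in> sphere 0 1" if "T \<in> space (prod_law \<mu> n)" for T
    using that v SL_mult_eq_0_iff[of T v] by (simp add: SL_lawsD(3)[OF m] norm_sgn)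
  note * = borel_prob_measures_distr[OF SL_lawsD(1)[OF m] closed_sphere meas s]
  show "dir_law \<mu> n v \<in> sphere_laws" unfolding dir_law_def by (rule *)
  show "h \<in> borel_measurable borel \<Longrightarrow>
      (\<integral>\<^sup>+x. h x \<partial>dir_law \<mu> n v) = (\<integral>\<^sup>+T. h (sgn (T *v v)) \<partial>prod_law \<mu> n)"
    unfolding dir_law_def by (rule *(2)) auto
qed

lemma sphere_law_eqI:
  assumes "\<nu> \<in> sphere_laws" "\<rho> \<in> sphere_laws"
    and "\<And>h. h \<in> borel_measurable borel \<Longrightarrow> (\<integral>\<^sup>+x. h x \<partial>\<nu>) = (\<integral>\<^sup>+x. h x \<partial>\<rho>)"
  shows "\<nu> = \<rho>"
proof (rule measure_eqI)
  show "sets \<nu> = sets \<rho>" using sphere_lawsD(2)[OF assms(1)] sphere_lawsD(2)[OF assms(2)] by simp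
  fix X assume X: "X \<in> sets \<nu>"
  then obtain Y where "Y \<in> sets borel" "X = sphere 0 1 \<inter> Y"
    by (auto simp: sphere_lawsD(2)[OF assms(1)] sets_restrict_space)
  then have [measurable]: "X \<in> sets borel" by simp
  have "(\<integral>\<^sup>+x. indicator X x \<partial>\<nu>) = (\<integral>\<^sup>+x. indicator X x \<partial>\<rho>)"
    by (rule assms(3)) simp
  with X \<open>sets \<nu> = sets \<rho>\<close> show "emeasure \<nu> X = emeasure \<rho> X" by simp
qed

lemma dir_law_Suc:
  fixes \<mu> :: "nat \<Rightarrow> (real ^ 'n ^ 'n) measure"
  assumes \<mu>: "\<And>i. \<mu> i \<in> SL_laws" and v: "v \<noteq> 0"
  shows "dir_law \<mu> (Suc n) v = act (\<mu> (Suc n)) (dir_law \<mu> n v)"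
proof (rule sphere_law_eqI)
  note d = dir_law_sphere[OF \<mu> v]
  show "dir_law \<mu> (Suc n) v \<in> sphere_laws" by (rule d)
  show "act (\<mu> (Suc n)) (dir_law \<mu> n v) \<in> sphere_laws" by (rule act_sphere[OF \<mu> d])
  fix h :: "real ^ 'n \<Rightarrow> ennreal" assume h [measurable]: "h \<in> borel_measurable borel"
  note m = prod_law_SL[OF \<mu>, where n = n]
  interpret M: prob_space "\<mu> (Suc n)" by (rule SL_lawsD[OF \<mu>])
  interpret N: prob_space "prod_law \<mu> n" by (rule SL_lawsD[OF m])
  interpret pair_sigma_finite "\<mu> (Suc n)" "prod_law \<mu> n" ..
  have [measurable]: "(\<lambda>p. fst p) \<in> measurable (\<mu> (Suc n) \<Otimes>\<^sub>M prod_law \<mu> n) borel"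
    using measurable_compose[OF measurable_fst measurable_SL_law[OF \<mu> measurable_ident]]
    by (simp add: id_def)
  have [measurable]: "(\<lambda>p. snd p) \<in> measurable (\<mu> (Suc n) \<Otimes>\<^sub>M prod_law \<mu> n) borel"
    using measurable_compose[OF measurable_snd measurable_SL_law[OF m measurable_ident]]
    by (simp add: id_def)
  have "(\<integral>\<^sup>+x. h x \<partial>act (\<mu> (Suc n)) (dir_law \<mu> n v)) =
      (\<integral>\<^sup>+A. (\<integral>\<^sup>+T. h (sgn (A *v sgn (T *v v))) \<partial>prod_law \<mu> n) \<partial>\<mu> (Suc n))"
    by (subst nn_integral_act[OF \<mu> d h], subst nn_integral_dir_law[OF \<mu> v]) auto
  also have "\<dots> = (\<integral>\<^sup>+T. (\<integral>\<^sup>+A. h (sgn (A *v sgn (T *v v))) \<partial>\<mu> (Suc n)) \<partial>prod_law \<mu> n)"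
  proof -
    have "(\<lambda>p. h (sgn (fst p *v sgn (snd p *v v)))) \<in> borel_measurable (\<mu> (Suc n) \<Otimes>\<^sub>M prod_law \<mu> n)"
      by measurable
    then show ?thesis by (intro Fubini'[symmetric]) (simp add: split_beta')
  qed
  also have "\<dots> = (\<integral>\<^sup>+T. (\<integral>\<^sup>+A. h (sgn ((A ** T) *v v)) \<partial>\<mu> (Suc n)) \<partial>prod_law \<mu> n)"
  proof (intro nn_integral_cong)
    fix T A assume "T \<in> space (prod_law \<mu> n)"
    then have "T *v v \<noteq> 0" using v SL_mult_eq_0_iff[of T v] by (simp add: SL_lawsD(3)[OF m])
    then show "h (sgn (A *v sgn (T *v v))) = h (sgn ((A ** T) *v v))"
      by (simp add: sgn_mult_sgn matrix_vector_mul_assoc)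
  qed
  also have "\<dots> = (\<integral>\<^sup>+T. h (sgn (T *v v)) \<partial>prod_law \<mu> (Suc n))"
    by (rule nn_integral_prod_law_Suc[OF \<mu>, symmetric]) measurable
  also have "\<dots> = (\<integral>\<^sup>+x. h x \<partial>dir_law \<mu> (Suc n) v)"
    by (rule nn_integral_dir_law[OF \<mu> v h, symmetric])
  finally show "(\<integral>\<^sup>+x. h x \<partial>dir_law \<mu> (Suc n) v) = (\<integral>\<^sup>+x. h x \<partial>act (\<mu> (Suc n)) (dir_law \<mu> n v))"
    by simp
qed

lemma nn_integral_dir_law_add:
  fixes \<mu> :: "nat \<Rightarrow> (real ^ 'n ^ 'n) measure"
  assumes \<mu>: "\<And>i. \<mu> i \<in> SL_laws" and v: "v \<noteq> 0" and h [measurable]: "h \<in> borel_measurable borel"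
  shows "(\<integral>\<^sup>+x. h x \<partial>dir_law \<mu> (n + m) v) =
    (\<integral>\<^sup>+T. (\<integral>\<^sup>+x. h x \<partial>dir_law (\<lambda>i. \<mu> (n + i)) m (T *v v)) \<partial>prod_law \<mu> n)"
proof -
  note m = prod_law_SL[OF \<mu>, where n = n]
  have "(\<integral>\<^sup>+x. h x \<partial>dir_law \<mu> (n + m) v) = (\<integral>\<^sup>+T. h (sgn (T *v v)) \<partial>prod_law \<mu> (n + m))"
    by (rule nn_integral_dir_law[OF \<mu> v h])
  also have "\<dots> = (\<integral>\<^sup>+T. (\<integral>\<^sup>+B. h (sgn ((B ** T) *v v)) \<partial>prod_law (\<lambda>i. \<mu> (n + i)) m) \<partial>prod_law \<mu> n)"
    by (rule nn_integral_prod_law_add[OF \<mu>]) measurable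
  also have "\<dots> = (\<integral>\<^sup>+T. (\<integral>\<^sup>+x. h x \<partial>dir_law (\<lambda>i. \<mu> (n + i)) m (T *v v)) \<partial>prod_law \<mu> n)"
  proof (rule nn_integral_cong)
    fix T assume "T \<in> space (prod_law \<mu> n)"
    then have "T *v v \<noteq> 0" using v SL_mult_eq_0_iff[of T v] by (simp add: SL_lawsD(3)[OF m])
    from nn_integral_dir_law[OF \<mu> this h, where n = m]
    show "(\<integral>\<^sup>+B. h (sgn ((B ** T) *v v)) \<partial>prod_law (\<lambda>i. \<mu> (n + i)) m) =
        (\<integral>\<^sup>+x. h x \<partial>dir_law (\<lambda>i. \<mu> (n + i)) m (T *v v))"
      by (simp add: matrix_vector_mul_assoc)
  qed
  finally show ?thesis .
qed

text \<open>Conditionally on the first \<open>n - r\<close> factors, the last \<open>r\<close> act on a fixed vector, and the hypothesis is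
  uniform in the vector and in the laws.\<close>

lemma (in compact_moment) dir_law_mass_later:
  assumes \<mu>: "\<And>i. \<mu> i \<in> K" and v: "v \<noteq> 0" and S: "S \<in> sets borel" "S \<subseteq> sphere 0 1"
    and le: "\<And>\<mu> v. (\<And>i. \<mu> i \<in> K) \<Longrightarrow> v \<noteq> 0 \<Longrightarrow> measure (dir_law \<mu> r v) S \<le> \<eta>"
    and n: "r \<le> n"
  shows "measure (dir_law \<mu> n v) S \<le> \<eta>"
proof -
  note d = dir_law_sphere[OF K_SL]
  have S_sets: "S \<in> sets (dir_law \<mu> n v)" if "\<And>i. \<mu> i \<in> K" "v \<noteq> 0" for \<mu> n v
    using S by (auto simp: sphere_lawsD(2)[OF d[OF that]] sets_restrict_space)
  have eq: "(\<integral>\<^sup>+x. indicator S x \<partial>dir_law \<mu> n v) = ennreal (measure (dir_law \<mu> n v) S)"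
    if "\<And>i. \<mu> i \<in> K" "v \<noteq> 0" for \<mu> n v
  proof -
    interpret prob_space "dir_law \<mu> n v" by (rule sphere_lawsD[OF d[OF that]])
    show ?thesis using S_sets[OF that] by (simp add: emeasure_eq_measure)
  qed
  have "0 \<le> \<eta>" using le[OF \<mu> v] measure_nonneg order_trans by blast
  note m = prod_law_SL[OF K_SL[OF \<mu>], where n = "n - r"]
  interpret prob_space "prod_law \<mu> (n - r)" by (rule SL_lawsD[OF m])
  have "ennreal (measure (dir_law \<mu> n v) S) = (\<integral>\<^sup>+x. indicator S x \<partial>dir_law \<mu> ((n - r) + r) v)"
    using n by (simp add: eq[OF \<mu> v])
  also have "\<dots> = (\<integral>\<^sup>+T. (\<integral>\<^sup>+x. indicator S x \<partial>dir_law (\<lambda>i. \<mu> ((n - r) + i)) r (T *v v)) \<partial>prod_law \<mu> (n - r))"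
    by (rule nn_integral_dir_law_add[OF K_SL[OF \<mu>] v]) (use S in auto)
  also have "\<dots> \<le> (\<integral>\<^sup>+T. ennreal \<eta> \<partial>prod_law \<mu> (n - r))"
  proof (rule nn_integral_mono)
    fix T assume "T \<in> space (prod_law \<mu> (n - r))"
    then have "T *v v \<noteq> 0" using v SL_mult_eq_0_iff[of T v] by (simp add: SL_lawsD(3)[OF m])
    then show "(\<integral>\<^sup>+x. indicator S x \<partial>dir_law (\<lambda>i. \<mu> ((n - r) + i)) r (T *v v)) \<le> ennreal \<eta>"
      by (subst eq) (use \<mu> in \<open>auto intro!: ennreal_leI le\<close>)
  qed
  also have "\<dots> = ennreal \<eta>" by (simp add: emeasure_space_1)
  finally show ?thesis using \<open>0 \<le> \<eta>\<close> by (simp add: ennreal_le_iff)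
qed

text \<open>Tested on a bounded continuous function, \<open>act\<close> is an iterated integral; the inner integral converges
  continuously in the matrix, and \<open>K\<close> is tight.\<close>

lemma (in free_ultrafilter) weak_limit_act:
  fixes Mj :: "nat \<Rightarrow> (real ^ 'n ^ 'n) measure"
  assumes K: "compact_moment K \<gamma> C"
    and M: "\<And>j. Mj j \<in> K" "M \<in> K" "weak_limit SL Mj M"
    and \<nu>: "\<And>j. \<nu>j j \<in> sphere_laws" "\<nu> \<in> sphere_laws" "weak_limit (sphere 0 1) \<nu>j \<nu>"
    and \<rho>: "\<And>j. \<rho>j j \<in> sphere_laws" "\<rho> \<in> sphere_laws" "weak_limit (sphere 0 1) \<rho>j \<rho>"
    and eq: "eventually (\<lambda>j. \<rho>j j = act (Mj j) (\<nu>j j)) F"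
  shows "\<rho> = act M \<nu>"
proof -
  interpret compact_moment K \<gamma> C by fact
  note a = act_sphere[OF K_SL[OF M(2)] \<nu>(2)]
  obtain \<Phi> :: "(real ^ 'n \<Rightarrow> real) set" where \<Phi>: "countable \<Phi>"
    "\<And>\<phi>. \<phi> \<in> \<Phi> \<Longrightarrow> continuous_on UNIV \<phi>" "\<And>\<phi> x. \<phi> \<in> \<Phi> \<Longrightarrow> \<bar>\<phi> x\<bar> \<le> 1"
    "\<And>M N. M \<in> sphere_laws \<Longrightarrow> N \<in> sphere_laws \<Longrightarrow>
      (\<And>\<phi>. \<phi> \<in> \<Phi> \<Longrightarrow> (\<integral>x. \<phi> x \<partial>M) = (\<integral>x. \<phi> x \<partial>N)) \<Longrightarrow> M = N"
    by (rule measure_determining_family[OF closed_sphere[of 0 1]]) blast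
  show ?thesis
  proof (rule \<Phi>(4)[OF \<rho>(2) a])
    fix \<phi> assume "\<phi> \<in> \<Phi>"
    then have \<phi>: "continuous_on UNIV \<phi>" "\<And>x. \<bar>\<phi> x\<bar> \<le> 1" using \<Phi> by auto
    then have [measurable]: "\<phi> \<in> borel_measurable borel" by (intro borel_measurable_continuous_onI)
    have "bounded (\<phi> ` sphere 0 1)" using \<phi>(2) by (intro boundedI[of _ 1]) auto
    with \<rho>(3) continuous_on_subset[OF \<phi>(1)] have "((\<lambda>j. \<integral>x. \<phi> x \<partial>\<rho>j j) \<longlongrightarrow> (\<integral>x. \<phi> x \<partial>\<rho>)) F"
      unfolding weak_limit_def by blast
    moreover have "eventually (\<lambda>j. (\<integral>x. \<phi> x \<partial>\<rho>j j) = (\<integral>A. (\<integral>x. \<phi> (sgn (A *v x)) \<partial>\<nu>j j) \<partial>Mj j)) F"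
      using eq by eventually_elim (simp add: integral_act[OF K_SL[OF M(1)] \<nu>(1)] \<phi>(2))
    ultimately have 1: "((\<lambda>j. \<integral>A. (\<integral>x. \<phi> (sgn (A *v x)) \<partial>\<nu>j j) \<partial>Mj j) \<longlongrightarrow> (\<integral>x. \<phi> x \<partial>\<rho>)) F"
      by (rule Lim_transform_eventually)
    have 2: "((\<lambda>j. \<integral>A. (\<integral>x. \<phi> (sgn (A *v x)) \<partial>\<nu>j j) \<partial>Mj j) \<longlongrightarrow> (\<integral>A. (\<integral>x. \<phi> (sgn (A *v x)) \<partial>\<nu>) \<partial>M)) F"
    proof (rule weak_limit_continuous_convergence[OF closed_SL K_SL[OF M(1)] K_SL[OF M(2)] M(3), where B = 1])
      show "\<exists>D. compact D \<and> D \<subseteq> SL \<and> (\<forall>j. measure (Mj j) (SL - D) \<le> e)" if "e > 0" for e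
        using K_tight[OF that] M(1) by blast
      show "(\<lambda>A. \<integral>x. \<phi> (sgn (A *v x)) \<partial>\<nu>j j) \<in> borel_measurable (restrict_space borel SL)" for j
        by (intro measurable_restrict_space1 borel_measurable_action_integral \<nu>) measurable
      show "\<bar>\<integral>x. \<phi> (sgn (A *v x)) \<partial>\<nu>j j\<bar> \<le> 1" for j and A :: "real ^ 'n ^ 'n"
      proof -
        interpret prob_space "\<nu>j j" by (rule sphere_lawsD[OF \<nu>(1)])
        have "integrable (\<nu>j j) (\<lambda>x. \<phi> (sgn (A *v x)))"
          using \<phi>(2) by (intro integrable_const_bound[of _ 1]) (auto intro: measurable_sphere_law[OF \<nu>(1)])
        from integral_diff_le[OF this integrable_const[of 0], of 1] \<phi>(2) show ?thesis by simp
      qed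
    qed (use tendsto_action_integral[OF \<phi> \<nu>] in blast)
    have "(\<integral>x. \<phi> x \<partial>\<rho>) = (\<integral>A. (\<integral>x. \<phi> (sgn (A *v x)) \<partial>\<nu>) \<partial>M)"
      by (rule tendsto_unique[OF nontrivial 1 2])
    then show "(\<integral>x. \<phi> x \<partial>\<rho>) = (\<integral>x. \<phi> x \<partial>act M \<nu>)"
      by (simp add: integral_act[OF K_SL[OF M(2)] \<nu>(2)] \<phi>(2))
  qed
qed

section \<open>Limits of subspaces\<close>

text \<open>Padding an orthonormal basis with zero vectors gives frames of the same length for all subspaces
  of dimension at most \<open>k\<close>, so that a sequence of frames can converge.\<close>

lemma subspace_frame:
  fixes W :: "'a :: euclidean_space set"
  assumes W: "subspace W" "dim W \<le> k"
  obtains e :: "nat \<Rightarrow> 'a" where "\<And>i. norm (e i) \<le> 1" "\<And>y. y \<in> W \<Longrightarrow> y = (\<Sum>i<k. (y \<bullet> e i) *\<^sub>R e i)"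
proof -
  obtain B where B: "B \<subseteq> W" "pairwise orthogonal B" "\<And>x. x \<in> B \<Longrightarrow> norm x = 1" "independent B" "card B = dim W" "span B = W"
    using orthonormal_basis_subspace[OF W(1)] by blast
  have fin: "finite B" using B(4) by (rule independent_imp_finite)
  obtain b where b: "bij_betw b {..<card B} B"
    using ex_bij_betw_nat_finite[OF fin] by (auto simp: atLeast0LessThan)
  define e where "e i = (if i < card B then b i else 0)" for i
  show ?thesis
  proof
    show "norm (e i) \<le> 1" for i
      using B(3) bij_betwE[OF b] by (auto simp: e_def)
    fix y assume "y \<in> W"
    then have "y = (\<Sum>c\<in>B. (y \<bullet> c) *\<^sub>R c)"
      using orthonormal_basis_expand[OF B(2,3) _ fin, of y] B(6) by simp
    also have "\<dots> = (\<Sum>i<card B. (y \<bullet> e i) *\<^sub>R e i)"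
      by (subst sum.reindex_bij_betw[OF b, symmetric]) (simp add: e_def)
    also have "\<dots> = (\<Sum>i<k. (y \<bullet> e i) *\<^sub>R e i)"
      by (rule sum.mono_neutral_left) (use W(2) B(5) in \<open>auto simp: e_def\<close>)
    finally show "y = (\<Sum>i<k. (y \<bullet> e i) *\<^sub>R e i)" .
  qed
qed

text \<open>Take the span of the limits of the frame vectors: the expansion \<open>y = (\<Sum>i<k. (y \<bullet> e i) *\<^sub>R e i)\<close> of
  points of \<open>W j\<close> passes to the limit.\<close>

lemma (in free_ultrafilter) subspace_limit:
  fixes W :: "nat \<Rightarrow> 'a :: euclidean_space set"
  assumes W: "\<And>j. subspace (W j)" "\<And>j. dim (W j) \<le> k"
  shows "\<exists>V. subspace V \<and> dim V \<le> k \<and>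
    (\<forall>x l. (x \<longlongrightarrow> l) F \<longrightarrow> ((\<lambda>j. infdist (x j) (W j)) \<longlongrightarrow> 0) F \<longrightarrow> l \<in> V)"
proof -
  have "\<exists>e :: nat \<Rightarrow> 'a. (\<forall>i. norm (e i) \<le> 1) \<and> (\<forall>y\<in>W j. y = (\<Sum>i<k. (y \<bullet> e i) *\<^sub>R e i))" for j
    using subspace_frame[OF W(1)[of j] W(2)[of j]] by metis
  then obtain e where e: "\<And>j i. norm (e j i) \<le> 1" "\<And>j y. y \<in> W j \<Longrightarrow> y = (\<Sum>i<k. (y \<bullet> e j i) *\<^sub>R e j i)"
    by metis
  have "\<exists>l\<in>cball 0 1. ((\<lambda>j. e j i) \<longlongrightarrow> l) F" for i
    by (rule compact_limit) (use e(1) in auto)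
  then obtain e' where e': "\<And>i. ((\<lambda>j. e j i) \<longlongrightarrow> e' i) F" by metis
  show ?thesis
  proof (intro exI[of _ "span (e' ` {..<k})"] conjI allI impI)
    show "subspace (span (e' ` {..<k}))" by (rule subspace_span)
    have "dim (span (e' ` {..<k})) \<le> card (e' ` {..<k})" by (rule dim_le_card) auto
    also have "\<dots> \<le> k" using card_image_le[of "{..<k}" e'] by simp
    finally show "dim (span (e' ` {..<k})) \<le> k" .
    fix x l assume x: "(x \<longlongrightarrow> l) F" "((\<lambda>j. infdist (x j) (W j)) \<longlongrightarrow> 0) F"
    have "\<exists>y\<in>W j. infdist (x j) (W j) = dist (x j) y" for j
    proof -
      have "closed (W j)" "W j \<noteq> {}" using W(1)[of j] subspace_0 by (auto intro: closed_subspace)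
      then show ?thesis by (rule infdist_attains_inf[of "W j" "x j"]) blast
    qed
    then obtain y where y: "\<And>j. y j \<in> W j" "\<And>j. infdist (x j) (W j) = dist (x j) (y j)" by metis
    have "((\<lambda>j. dist (x j) (y j)) \<longlongrightarrow> 0) F" using x(2) by (simp add: y(2))
    then have "((\<lambda>j. x j - y j) \<longlongrightarrow> 0) F"
      by (simp add: dist_norm tendsto_norm_zero_iff)
    from tendsto_diff[OF x(1) this] have "(y \<longlongrightarrow> l) F" by simp
    then have "((\<lambda>j. \<Sum>i<k. (y j \<bullet> e j i) *\<^sub>R e j i) \<longlongrightarrow> (\<Sum>i<k. (l \<bullet> e' i) *\<^sub>R e' i)) F"
      by (intro tendsto_intros e')
    then have "(y \<longlongrightarrow> (\<Sum>i<k. (l \<bullet> e' i) *\<^sub>R e' i)) F"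
      using e(2)[OF y(1)] by simp
    with \<open>(y \<longlongrightarrow> l) F\<close> have "l = (\<Sum>i<k. (l \<bullet> e' i) *\<^sub>R e' i)"
      by (rule tendsto_unique[OF nontrivial])
    moreover have "(\<Sum>i<k. (l \<bullet> e' i) *\<^sub>R e' i) \<in> span (e' ` {..<k})"
      by (intro span_sum span_scale span_base) auto
    ultimately show "l \<in> span (e' ` {..<k})" by simp
  qed
qed


section \<open>Random directions avoid subspaces\<close>

locale strongly_irreducible = compact_moment K \<gamma> C
  for K :: "(real ^ 'n ^ 'n) measure set" and \<gamma> C :: real +
  assumes no_common_subspaces: "\<And>\<mu>. \<mu> \<in> K \<Longrightarrow> \<not> (\<exists>U U'. union_of_proper_subspaces U \<and>
    union_of_proper_subspaces U' \<and> (AE A in \<mu>. (*v) A ` U = U'))"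

lemma sphere_law_sets_subspace:
  assumes "\<rho> \<in> sphere_laws" "subspace W"
  shows "sphere 0 1 \<inter> W \<in> sets \<rho>"
  unfolding sphere_lawsD(2)[OF assms(1)] sets_restrict_space
  by (rule imageI) (rule borel_closed[OF closed_subspace[OF assms(2)]])

text \<open>Furstenberg's argument, run along an infinite past: \<open>\<nu> i\<close> is the law of the direction \<open>i\<close> steps
  before the present. Let \<open>\<W> i\<close> be the set of subspaces of dimension \<open>k + 1\<close> with the maximal mass \<open>a\<close>
  under \<open>\<nu> i\<close>. Two of them meet in a null set, so there are at most \<open>1 / a\<close>. The mass \<open>a\<close> of \<open>W\<close> in
  \<open>\<W> i\<close> is the mean over \<open>A\<close> of the masses of the preimages of \<open>W\<close> one step earlier, none of which
  exceeds \<open>a\<close>; so almost every \<open>A\<close> pulls \<open>\<W> i\<close> back into \<open>\<W> (i + 1)\<close>, injectively. The cardinalities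
  do not decrease into the past and are bounded, hence two consecutive ones agree. Then \<open>A\<close> maps the
  union of \<open>\<W> (i + 1)\<close> onto the union of \<open>\<W> i\<close>, which is what the spaces condition forbids.\<close>

lemma (in strongly_irreducible) no_ancient_concentration:
  fixes \<nu> :: "nat \<Rightarrow> (real ^ 'n) measure" and M :: "nat \<Rightarrow> (real ^ 'n ^ 'n) measure"
  assumes \<nu>: "\<And>i. \<nu> i \<in> sphere_laws" and M: "\<And>i. M i \<in> K" and act: "\<And>i. \<nu> i = act (M i) (\<nu> (Suc i))"
    and k: "Suc k < CARD('n)" and a: "0 < a"
    and small: "\<And>i W. subspace W \<Longrightarrow> dim W \<le> k \<Longrightarrow> measure (\<nu> i) (sphere 0 1 \<inter> W) = 0"
    and le: "\<And>i W. subspace W \<Longrightarrow> dim W \<le> Suc k \<Longrightarrow> measure (\<nu> i) (sphere 0 1 \<inter> W) \<le> a"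
    and W0: "subspace W0" "dim W0 \<le> Suc k" "a \<le> measure (\<nu> 0) (sphere 0 1 \<inter> W0)"
  shows False
proof -
  interpret \<nu>: prob_space "\<nu> i" for i by (rule sphere_lawsD[OF \<nu>])
  have sp: "space (\<nu> i) = sphere 0 1" for i by (rule sphere_lawsD[OF \<nu>])
  have sub_sets: "sphere 0 1 \<inter> W \<in> sets (\<nu> i)" if "subspace W" for W i
    by (rule sphere_law_sets_subspace[OF \<nu> that])
  define \<W> where "\<W> i = {W. subspace W \<and> dim W = Suc k \<and> measure (\<nu> i) (sphere 0 1 \<inter> W) = a}" for i
  have card_le: "real (card G) * a \<le> 1" if G: "G \<subseteq> \<W> i" "finite G" for G i
  proof -
    have "AE x in \<nu> i. \<not> (x \<in> V \<and> x \<in> W)" if "V \<in> G" "W \<in> G" "V \<noteq> W" for V W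
    proof -
      have VW: "subspace V" "subspace W" "dim V = Suc k" "dim W = Suc k" using that G(1) by (auto simp: \<W>_def)
      have "dim (V \<inter> W) \<le> k"
      proof (rule ccontr)
        assume "\<not> dim (V \<inter> W) \<le> k"
        moreover have "dim (V \<inter> W) \<le> dim V" by (intro dim_subset) auto
        ultimately have "dim (V \<inter> W) = Suc k" using VW by linarith
        then have dim: "dim V \<le> dim (V \<inter> W)" "dim W \<le> dim (V \<inter> W)" using VW by auto
        have "V \<inter> W = V" by (rule subspace_dim_equal[OF subspace_inter]) (use VW dim in auto)
        moreover have "V \<inter> W = W" by (rule subspace_dim_equal[OF subspace_inter]) (use VW dim in auto)
        ultimately show False using that(3) by blast
      qed
      then have "measure (\<nu> i) (sphere 0 1 \<inter> (V \<inter> W)) = 0"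
        using VW by (intro small subspace_inter)
      then have "sphere 0 1 \<inter> (V \<inter> W) \<in> null_sets (\<nu> i)"
        using sub_sets[of "V \<inter> W"] VW by (auto simp: null_sets_def \<nu>.emeasure_eq_measure subspace_inter)
      then show ?thesis
        by (rule AE_I') (auto simp: sp)
    qed
    then have "AE x in \<nu> i. \<forall>V\<in>G. \<forall>W\<in>G. V \<noteq> W \<longrightarrow> \<not> (x \<in> V \<and> x \<in> W)"
      using G(2) by (simp add: AE_finite_all AE_ball_countable countable_finite)
    then have ae: "AE x in \<nu> i. (\<Sum>W\<in>G. indicator (sphere 0 1 \<inter> W) x) \<le> (1 :: real)"
    proof eventually_elim
      case (elim x)
      show ?case
      proof (cases "\<exists>V\<in>G. x \<in> V")
        case True
        then obtain V where V: "V \<in> G" "x \<in> V" by blast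
        have "(\<Sum>W\<in>G. indicator (sphere 0 1 \<inter> W) x) = (\<Sum>W\<in>G. if W = V then indicator (sphere 0 1) x else (0 :: real))"
          by (rule sum.cong) (use elim V in \<open>auto simp: indicator_def\<close>)
        also have "\<dots> = indicator (sphere 0 1) x" using V G(2) by simp
        finally show ?thesis by (simp add: indicator_def)
      next
        case False
        then have "(\<Sum>W\<in>G. indicator (sphere 0 1 \<inter> W) x) = (0 :: real)"
          by (intro sum.neutral) (auto simp: indicator_def)
        then show ?thesis by simp
      qed
    qed
    have int: "integrable (\<nu> i) (\<lambda>x. indicator (sphere 0 1 \<inter> W) x :: real)" if "W \<in> G" for W
      using sub_sets[of W i] that G(1) by (auto simp: \<W>_def \<nu>.emeasure_eq_measure)
    have "(\<integral>x. (\<Sum>W\<in>G. indicator (sphere 0 1 \<inter> W) x) \<partial>\<nu> i) \<le> (\<integral>x. (1 :: real) \<partial>\<nu> i)"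
    proof (rule integral_mono_AE)
      show "integrable (\<nu> i) (\<lambda>x. \<Sum>W\<in>G. indicator (sphere 0 1 \<inter> W) x :: real)"
        by (rule Bochner_Integration.integrable_sum) (rule int)
    qed (use ae in auto)
    moreover have "(\<integral>x. (\<Sum>W\<in>G. indicator (sphere 0 1 \<inter> W) x) \<partial>\<nu> i) = (\<Sum>W\<in>G. measure (\<nu> i) (sphere 0 1 \<inter> W))"
    proof -
      have "sphere 0 1 \<inter> W \<inter> space (\<nu> i) = sphere 0 1 \<inter> W" for W by (auto simp: sp)
      then show ?thesis by (subst Bochner_Integration.integral_sum[OF int]) simp_all
    qed
    moreover have "(\<Sum>W\<in>G. measure (\<nu> i) (sphere 0 1 \<inter> W)) = real (card G) * a"
      using G(1) by (subst sum.cong[OF refl, of _ _ "\<lambda>_. a"]) (auto simp: \<W>_def)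
    ultimately show ?thesis by (simp add: \<nu>.prob_space)
  qed
  define N where "N = nat \<lceil>1 / a\<rceil>"
  have "card G \<le> N" if "G \<subseteq> \<W> i" "finite G" for G i
  proof -
    have "real (card G) \<le> 1 / a" using card_le[OF that] a by (simp add: field_simps)
    then show ?thesis unfolding N_def by linarith
  qed
  from finite_if_finite_subsets_card_bdd[OF this]
  have fin: "finite (\<W> i)" and card_N: "card (\<W> i) \<le> N" for i by auto
  have dim_vimage: "subspace ((*v) A -` W) \<and> dim ((*v) A -` W) = dim W" if A: "A \<in> SL" and W: "subspace W"
    for A and W :: "(real ^ 'n) set"
  proof -
    obtain A' where A': "A ** A' = mat 1" "A' ** A = mat 1" using SL_inv[OF A] .
    have "(*v) A -` W = (*v) A' ` W"
    proof (intro set_eqI iffI)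
      fix x assume "x \<in> (*v) A -` W"
      then show "x \<in> (*v) A' ` W"
        using A'(2) by (intro image_eqI[of _ _ "A *v x"]) (auto simp: matrix_vector_mul_assoc)
    next
      fix x assume "x \<in> (*v) A' ` W"
      then show "x \<in> (*v) A -` W" using A'(1) by (auto simp: matrix_vector_mul_assoc)
    qed
    moreover have "inj ((*v) A')" using A'(1) matrix_left_invertible_injective[of A'] by blast
    ultimately show ?thesis
      using W by (auto intro!: linear_subspace_image dim_image_eq inj_on_subset[OF _ subset_UNIV])
  qed
  have step: "AE A in M i. \<forall>W\<in>\<W> i. (*v) A -` W \<in> \<W> (Suc i)" for i
  proof -
    note m = K_SL[OF M[of i]]
    interpret M: prob_space "M i" by (rule SL_lawsD[OF m])
    have "AE A in M i. (*v) A -` W \<in> \<W> (Suc i)" if "W \<in> \<W> i" for W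
    proof -
      have W: "subspace W" "dim W = Suc k" "measure (\<nu> i) (sphere 0 1 \<inter> W) = a" using that by (auto simp: \<W>_def)
      have [measurable]: "W \<in> sets borel" using closed_subspace[OF W(1)] by simp
      define g where "g A = measure (\<nu> (Suc i)) (sphere 0 1 \<inter> (*v) A -` W)" for A
      have g_le: "g A \<le> a" if "A \<in> SL" for A
        unfolding g_def using dim_vimage[OF that W(1)] W(2) by (intro le) auto
      have inner: "(\<integral>\<^sup>+x. indicator W (sgn (A *v x)) \<partial>\<nu> (Suc i)) = ennreal (g A)" if A: "A \<in> SL" for A
      proof -
        have "(\<integral>\<^sup>+x. indicator W (sgn (A *v x)) \<partial>\<nu> (Suc i)) = (\<integral>\<^sup>+x. indicator (sphere 0 1 \<inter> (*v) A -` W) x \<partial>\<nu> (Suc i))"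
        proof (rule nn_integral_cong)
          fix x assume "x \<in> space (\<nu> (Suc i))"
          then have x: "x \<in> sphere 0 1" by (simp only: sp)
          then have "A *v x \<noteq> 0" by (rule SL_mult_sphere_neq_0[OF A])
          then have "sgn (A *v x) \<in> W \<longleftrightarrow> A *v x \<in> W"
            using subspace_scale[OF W(1), of "sgn (A *v x)" "norm (A *v x)"] subspace_scale[OF W(1), of "A *v x" "inverse (norm (A *v x))"]
            by (auto simp: sgn_div_norm)
          with x show "indicator W (sgn (A *v x)) = (indicator (sphere 0 1 \<inter> (*v) A -` W) x :: ennreal)"
            by (simp add: indicator_def)
        qed
        also have "\<dots> = ennreal (g A)"
          using sub_sets[of "(*v) A -` W"] dim_vimage[OF A W(1)] by (simp add: g_def \<nu>.emeasure_eq_measure)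
        finally show ?thesis .
      qed
      have g_meas: "g \<in> borel_measurable (M i)"
      proof -
        have [measurable]: "(\<lambda>p. snd p) \<in> measurable ((borel :: (real ^ 'n ^ 'n) measure) \<Otimes>\<^sub>M \<nu> (Suc i)) borel"
          using measurable_compose[OF measurable_snd measurable_sphere_law[OF \<nu> measurable_ident]]
          by (simp add: id_def)
        have "(\<lambda>p. indicator W (sgn (fst p *v snd p)) :: ennreal) \<in> borel_measurable ((borel :: (real ^ 'n ^ 'n) measure) \<Otimes>\<^sub>M \<nu> (Suc i))"
          by measurable
        then have "(\<lambda>A :: real ^ 'n ^ 'n. \<integral>\<^sup>+x. indicator W (sgn (A *v x)) \<partial>\<nu> (Suc i)) \<in> borel_measurable borel"
          by (intro \<nu>.borel_measurable_nn_integral) (simp add: split_beta')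
        then have "(\<lambda>A. enn2real (\<integral>\<^sup>+x. indicator W (sgn (A *v x)) \<partial>\<nu> (Suc i))) \<in> borel_measurable (M i)"
          by (intro measurable_SL_law[OF m]) measurable
        then show ?thesis
          by (rule measurable_cong[THEN iffD1, rotated]) (simp add: inner SL_lawsD(3)[OF m] g_def)
      qed
      have g_int: "integrable (M i) g"
        using g_le by (intro M.integrable_const_bound[OF _ g_meas, of a]) (auto simp: SL_lawsD(3)[OF m] g_def)
      have "ennreal a = (\<integral>\<^sup>+x. indicator (sphere 0 1 \<inter> W) x \<partial>\<nu> i)"
        using sub_sets[OF W(1), of i] W(3) by (simp add: \<nu>.emeasure_eq_measure)
      also have "\<dots> = (\<integral>\<^sup>+x. indicator W x \<partial>\<nu> i)"
        by (rule nn_integral_cong) (simp add: indicator_def sp)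
      also have "\<dots> = (\<integral>\<^sup>+A. (\<integral>\<^sup>+x. indicator W (sgn (A *v x)) \<partial>\<nu> (Suc i)) \<partial>M i)"
        by (subst act) (rule nn_integral_act[OF m \<nu>], measurable)
      also have "\<dots> = (\<integral>\<^sup>+A. ennreal (g A) \<partial>M i)"
        by (rule nn_integral_cong) (simp add: inner SL_lawsD(3)[OF m])
      also have "\<dots> = ennreal (\<integral>A. g A \<partial>M i)"
        by (rule nn_integral_eq_integral[OF g_int]) (simp add: g_def)
      finally have "ennreal a = ennreal (\<integral>A. g A \<partial>M i)" .
      moreover have "0 \<le> (\<integral>A. g A \<partial>M i)" by (rule integral_nonneg_AE) (simp add: g_def)
      ultimately have "(\<integral>A. g A \<partial>M i) = a" using a by simp
      then have "(\<integral>A. a - g A \<partial>M i) = 0" using g_int by (simp add: M.prob_space)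
      then have "AE A in M i. a - g A = 0"
        by (subst (asm) integral_nonneg_eq_0_iff_AE) (use g_int g_le in \<open>auto simp: SL_lawsD(3)[OF m]\<close>)
      then show ?thesis
        using AE_space
      proof eventually_elim
        case (elim A)
        then have "A \<in> SL" by (simp add: SL_lawsD(3)[OF m])
        with elim(1) dim_vimage[OF _ W(1), of A] W(2) show ?case by (simp add: \<W>_def g_def)
      qed
    qed
    then show ?thesis using fin[of i] by (simp add: AE_finite_all)
  qed
  have inj: "inj_on (\<lambda>W. (*v) A -` W) X" if "A \<in> SL" for A :: "real ^ 'n ^ 'n" and X
    using surj_SL[OF that] by (intro inj_onI) (metis surj_image_vimage_eq)
  have mono: "card (\<W> i) \<le> card (\<W> (Suc i))" for i
  proof -
    note m = K_SL[OF M[of i]]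
    interpret M: prob_space "M i" by (rule SL_lawsD[OF m])
    have "AE A in M i. A \<in> SL \<and> (\<forall>W\<in>\<W> i. (*v) A -` W \<in> \<W> (Suc i))"
      using step[of i] AE_space by eventually_elim (simp add: SL_lawsD(3)[OF m])
    then obtain A where A: "A \<in> SL" "\<forall>W\<in>\<W> i. (*v) A -` W \<in> \<W> (Suc i)"
      using eventually_happens'[OF M.ae_filter_bot] by blast
    show ?thesis
      by (rule card_inj_on_le[OF inj[OF A(1)] _ fin]) (use A(2) in blast)
  qed
  have "W0 \<in> \<W> 0"
  proof -
    have "measure (\<nu> 0) (sphere 0 1 \<inter> W0) = a" using W0 le[OF W0(1,2), of 0] by simp
    moreover from this have "dim W0 = Suc k" using small[OF W0(1), of 0] W0(2) a by fastforce
    ultimately show ?thesis using W0(1) by (simp add: \<W>_def)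
  qed
  then have nonempty: "\<W> i \<noteq> {}" for i
  proof (induction i)
    case (Suc i)
    then have "0 < card (\<W> i)" using fin by (simp add: card_gt_0_iff)
    with mono[of i] have "0 < card (\<W> (Suc i))" by linarith
    then show ?case by (simp add: card_gt_0_iff)
  qed auto
  have "\<exists>i. card (\<W> i) = card (\<W> (Suc i))"
  proof (rule ccontr)
    assume "\<not> ?thesis"
    then have less: "card (\<W> i) < card (\<W> (Suc i))" for i using mono[of i] by (metis le_neq_implies_less)
    have "i \<le> card (\<W> i)" for i
    proof (induction i)
      case (Suc i)
      with less[of i] show ?case by linarith
    qed simp
    from this[of "Suc N"] card_N[of "Suc N"] show False by simp
  qed
  then obtain i where i: "card (\<W> i) = card (\<W> (Suc i))" ..
  note m = K_SL[OF M[of i]]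
  have "AE A in M i. (*v) A ` \<Union>(\<W> (Suc i)) = \<Union>(\<W> i)"
    using step[of i] AE_space
  proof eventually_elim
    case (elim A)
    then have A: "A \<in> SL" by (simp add: SL_lawsD(3)[OF m])
    have "(\<lambda>W. (*v) A -` W) ` \<W> i = \<W> (Suc i)"
      by (rule card_subset_eq) (use fin elim(1) i in \<open>auto simp: card_image[OF inj[OF A]]\<close>)
    then have "(*v) A ` \<Union>(\<W> (Suc i)) = (*v) A ` (\<Union>W\<in>\<W> i. (*v) A -` W)" by simp
    also have "\<dots> = (\<Union>W\<in>\<W> i. (*v) A ` ((*v) A -` W))" by blast
    also have "\<dots> = \<Union>(\<W> i)" using surj_SL[OF A] by (simp add: surj_image_vimage_eq)
    finally show ?case .
  qed
  moreover have "union_of_proper_subspaces (\<Union>(\<W> i))" for i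
    unfolding union_of_proper_subspaces_def
  proof (intro exI[of _ "\<W> i"] conjI ballI)
    fix W assume "W \<in> \<W> i"
    then have W: "subspace W" "dim W = Suc k" by (auto simp: \<W>_def)
    then show "subspace W" "W \<noteq> {0}" by (auto simp: dim_eq_0)
    show "W \<noteq> UNIV" using W(2) k by (auto simp: dim_UNIV)
  qed (use fin nonempty in auto)
  ultimately show False using no_common_subspaces[OF M[of i]] by blast
qed


context strongly_irreducible
begin

text \<open>The bound is on a neighbourhood of the subspace, not on the subspace itself. In this form it
  survives weak limits, and its failure for every \<open>\<delta>\<close> and \<open>r\<close> yields a limit law with mass on a
  subspace.\<close>

definition avoids :: "nat \<Rightarrow> real \<Rightarrow> bool" where
  "avoids k \<eta> \<longleftrightarrow> (\<exists>r. \<exists>\<delta>>0. \<forall>\<mu> v W. (\<forall>i. \<mu> i \<in> K) \<longrightarrow> v \<noteq> 0 \<longrightarrow> subspace W \<longrightarrow> dim W \<le> k \<longrightarrow>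
     measure (dir_law \<mu> r v) {x \<in> sphere 0 1. infdist x W \<le> \<delta>} \<le> \<eta>)"

lemma sets_infdist_le [measurable]: "{x \<in> sphere (0 :: real ^ 'n) 1. infdist x W \<le> \<delta>} \<in> sets borel"
proof -
  have "closed {x :: real ^ 'n. infdist x W \<le> \<delta>}"
    by (intro closed_Collect_le continuous_intros)
  then have "closed (sphere (0 :: real ^ 'n) 1 \<inter> {x. infdist x W \<le> \<delta>})" by (intro closed_Int) auto
  then have "sphere (0 :: real ^ 'n) 1 \<inter> {x. infdist x W \<le> \<delta>} \<in> sets borel" by (rule borel_closed)
  then show ?thesis by (simp add: Int_def)
qed

lemma avoids_later:
  assumes "avoids k \<eta>"
  obtains r \<delta> where "0 < \<delta>" "\<And>\<mu> v W n. (\<And>i. \<mu> i \<in> K) \<Longrightarrow> v \<noteq> 0 \<Longrightarrow> subspace W \<Longrightarrow> dim W \<le> k \<Longrightarrow> r \<le> n \<Longrightarrow>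
    measure (dir_law \<mu> n v) {x \<in> sphere 0 1. infdist x W \<le> \<delta>} \<le> \<eta>"
proof -
  from assms obtain r \<delta> where r: "0 < \<delta>" "\<And>\<mu> v W. (\<And>i. \<mu> i \<in> K) \<Longrightarrow> v \<noteq> 0 \<Longrightarrow> subspace W \<Longrightarrow> dim W \<le> k \<Longrightarrow>
     measure (dir_law \<mu> r v) {x \<in> sphere 0 1. infdist x W \<le> \<delta>} \<le> \<eta>"
    unfolding avoids_def by blast
  show ?thesis
  proof (rule that[OF r(1)])
    fix \<mu> :: "nat \<Rightarrow> (real ^ 'n ^ 'n) measure" and v :: "real ^ 'n" and W :: "(real ^ 'n) set" and n
    assume *: "\<And>i. \<mu> i \<in> K" "v \<noteq> 0" "subspace W" "dim W \<le> k" "r \<le> n"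
    show "measure (dir_law \<mu> n v) {x \<in> sphere 0 1. infdist x W \<le> \<delta>} \<le> \<eta>"
      by (rule dir_law_mass_later[OF *(1,2) sets_infdist_le _ _ *(5)]) (use r(2) *(3,4) in auto)
  qed
qed

lemma sphere_law_measurable_infdist:
  assumes "\<rho> \<in> sphere_laws"
  shows "{x \<in> sphere (0 :: real ^ 'n) 1. infdist x W \<le> \<delta>} \<in> sets \<rho>"
  unfolding sphere_lawsD(2)[OF assms] sets_restrict_space
  using sets_infdist_le[of W \<delta>] by (intro image_eqI[of _ _ "{x \<in> sphere 0 1. infdist x W \<le> \<delta>}"]) auto

lemma sphere_law_integral_bounds:
  fixes \<phi> :: "real ^ 'n \<Rightarrow> real"
  assumes \<rho>: "\<rho> \<in> sphere_laws" and \<phi>: "continuous_on UNIV \<phi>" and S: "S \<in> sets \<rho>"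
  shows "(\<And>x. x \<in> sphere 0 1 \<Longrightarrow> indicator S x \<le> \<phi> x \<and> \<phi> x \<le> 1) \<Longrightarrow> measure \<rho> S \<le> (\<integral>x. \<phi> x \<partial>\<rho>)"
    and "(\<And>x. x \<in> sphere 0 1 \<Longrightarrow> 0 \<le> \<phi> x \<and> \<phi> x \<le> indicator S x) \<Longrightarrow> (\<integral>x. \<phi> x \<partial>\<rho>) \<le> measure \<rho> S"
proof -
  interpret prob_space \<rho> by (rule sphere_lawsD[OF \<rho>])
  have sp: "space \<rho> = sphere 0 1" by (rule sphere_lawsD[OF \<rho>])
  have meas: "\<phi> \<in> borel_measurable (restrict_space borel (sphere 0 1))"
    using \<phi> by (intro measurable_restrict_space1 borel_measurable_continuous_onI)
  have ind: "integrable \<rho> (\<lambda>x. indicator S x :: real)" "(\<integral>x. indicator S x \<partial>\<rho>) = measure \<rho> S"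
    using S by (simp_all add: emeasure_eq_measure)
  show "measure \<rho> S \<le> (\<integral>x. \<phi> x \<partial>\<rho>)" if *: "\<And>x. x \<in> sphere 0 1 \<Longrightarrow> indicator S x \<le> \<phi> x \<and> \<phi> x \<le> 1"
  proof -
    have "\<bar>\<phi> x\<bar> \<le> 1" if "x \<in> sphere 0 1" for x
    proof -
      have "0 \<le> (indicator S x :: real)" by simp
      with *[OF that] show ?thesis by linarith
    qed
    then have "integrable \<rho> \<phi>" by (rule borel_prob_measures_integrable[OF \<rho> closed_sphere meas])
    from integral_mono[OF ind(1) this] * ind(2) show ?thesis by (simp add: sp)
  qed
  show "(\<integral>x. \<phi> x \<partial>\<rho>) \<le> measure \<rho> S" if *: "\<And>x. x \<in> sphere 0 1 \<Longrightarrow> 0 \<le> \<phi> x \<and> \<phi> x \<le> indicator S x"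
  proof -
    have "\<bar>\<phi> x\<bar> \<le> 1" if "x \<in> sphere 0 1" for x
    proof -
      have "(indicator S x :: real) \<le> 1" by (simp add: indicator_def)
      with *[OF that] show ?thesis by linarith
    qed
    then have "integrable \<rho> \<phi>" by (rule borel_prob_measures_integrable[OF \<rho> closed_sphere meas])
    from integral_mono[OF this ind(1)] * ind(2) show ?thesis by (simp add: sp)
  qed
qed

lemma (in free_ultrafilter) weak_limitD_sphere:
  fixes \<phi> :: "real ^ 'n \<Rightarrow> real"
  assumes "weak_limit (sphere 0 1) \<rho>j \<rho>" "continuous_on UNIV \<phi>"
  shows "((\<lambda>j. \<integral>x. \<phi> x \<partial>\<rho>j j) \<longlongrightarrow> (\<integral>x. \<phi> x \<partial>\<rho>)) F"
proof -
  have "continuous_on (sphere 0 1) \<phi>" using assms(2) continuous_on_subset by blast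
  moreover from this have "bounded (\<phi> ` sphere 0 1)"
    by (intro compact_imp_bounded compact_continuous_image) auto
  ultimately show ?thesis using assms(1) unfolding weak_limit_def by blast
qed

text \<open>Let \<open>a\<close> be the infimum of the bounds attainable in dimension \<open>k + 1\<close>, and assume that it is
  positive. For each \<open>j\<close> there is a product of length \<open>j\<close> that puts almost \<open>a\<close> near some subspace, in a
  neighbourhood that shrinks with \<open>j\<close>. For fixed \<open>i\<close>, let \<open>\<nu> i\<close> be the limit over \<open>j\<close> of the laws
  of the direction \<open>i\<close> steps before the end. Then \<open>\<nu> 0\<close> gives mass \<open>a\<close> to the limit subspace; no \<open>\<nu> i\<close> gives
  more than \<open>a\<close> to a subspace of dimension \<open>k + 1\<close>, by the choice of \<open>a\<close>, nor anything to one of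
  dimension \<open>k\<close>, by induction. This is the situation of \<open>no_ancient_concentration\<close>.\<close>

lemma avoids_all:
  assumes "k < CARD('n)" "0 < \<eta>"
  shows "avoids k \<eta>"
  using assms
proof (induction k arbitrary: \<eta>)
  case 0
  have "measure (dir_law \<mu> 0 v) {x \<in> sphere 0 1. infdist x W \<le> 1 / 2} \<le> \<eta>"
    if "subspace W" "dim W \<le> 0" for \<mu> v and W :: "(real ^ 'n) set"
  proof -
    have "W = {0}" using that subspace_0[OF that(1)] by (auto simp: dim_eq_0)
    then have empty: "{x \<in> sphere 0 1. infdist x W \<le> 1 / 2} = {}" by (auto simp: infdist_def)
    show ?thesis unfolding empty using 0(2) by simp
  qed
  then show ?case unfolding avoids_def by (intro exI[of _ 0] exI[of _ "1 / 2"]) auto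
next
  case (Suc k)
  show ?case
  proof (rule ccontr)
    assume neg: "\<not> avoids (Suc k) \<eta>"
    have mono: "avoids (Suc k) \<eta>2" if "avoids (Suc k) \<eta>1" "\<eta>1 \<le> \<eta>2" for \<eta>1 \<eta>2
      using that unfolding avoids_def by (meson order_trans)
    define a where "a = Inf {\<eta>. 0 \<le> \<eta> \<and> avoids (Suc k) \<eta>}"
    have "avoids (Suc k) 1"
    proof -
      have "measure (dir_law \<mu> 0 v) S \<le> 1" if "\<And>i. \<mu> i \<in> K" "v \<noteq> 0" for \<mu> v S
      proof -
        interpret prob_space "dir_law \<mu> 0 v" by (rule sphere_lawsD[OF dir_law_sphere[OF K_SL[OF that(1)] that(2)]])
        show ?thesis by simp
      qed
      then show ?thesis unfolding avoids_def by (intro exI[of _ 0] exI[of _ 1]) auto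
    qed
    then have ne: "{\<eta>. 0 \<le> \<eta> \<and> avoids (Suc k) \<eta>} \<noteq> {}" by (auto intro: exI[of _ 1])
    have bdd: "bdd_below {\<eta>. 0 \<le> \<eta> \<and> avoids (Suc k) \<eta>}" by (auto intro: bdd_belowI[of _ 0])
    have "\<eta> \<le> a"
      unfolding a_def
    proof (rule cInf_greatest[OF ne])
      fix z assume "z \<in> {\<eta>. 0 \<le> \<eta> \<and> avoids (Suc k) \<eta>}"
      then show "\<eta> \<le> z" using neg mono[of z \<eta>] by force
    qed
    with Suc.prems(2) have a: "0 < a" by linarith
    have above: "avoids (Suc k) z" if "a < z" for z
    proof -
      from that ne bdd obtain y where "0 \<le> y" "avoids (Suc k) y" "y < z"
        unfolding a_def by (auto simp: cInf_less_iff)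
      then show ?thesis using mono by simp
    qed
    have below: "\<not> avoids (Suc k) z" if "0 \<le> z" "z < a" for z
      using cInf_lower[OF _ bdd, of z] that unfolding a_def by auto
    \<comment> \<open>The bound \<open>a - a / (j + 2)\<close> is nonnegative and below \<open>a\<close>, hence not attainable, and tends
      to \<open>a\<close>.\<close>
    define P where "P j \<mu> v W \<longleftrightarrow> (\<forall>i. \<mu> i \<in> K) \<and> v \<noteq> 0 \<and> subspace W \<and> dim W \<le> Suc k \<and>
      a - a / real (j + 2) < measure (dir_law \<mu> j v) {x \<in> sphere 0 1. infdist x W \<le> 1 / real (j + 1)}"
      for j \<mu> and v :: "real ^ 'n" and W :: "(real ^ 'n) set"
    have "\<exists>\<mu> v W. P j \<mu> v W" for j
    proof -
      have "\<not> avoids (Suc k) (a - a / real (j + 2))"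
        using a by (intro below) (auto simp: field_simps)
      moreover have "0 < 1 / real (j + 1)" by simp
      ultimately show ?thesis unfolding avoids_def P_def by (meson not_less)
    qed
    then obtain \<mu> v W where "\<And>j. P j (\<mu> j) (v j) (W j)" by metis
    then have \<mu>: "\<And>j i. \<mu> j i \<in> K" and v: "\<And>j. v j \<noteq> 0"
      and W: "\<And>j. subspace (W j)" "\<And>j. dim (W j) \<le> Suc k"
      and big: "\<And>j. a - a / real (j + 2) < measure (dir_law (\<mu> j) j (v j)) {x \<in> sphere 0 1. infdist x (W j) \<le> 1 / real (j + 1)}"
      unfolding P_def by blast+
    obtain F where "free_ultrafilter F" using free_ultrafilter_exists by blast
    interpret free_ultrafilter F by fact
    \<comment> \<open>Truncated subtraction makes \<open>N i j\<close> meaningless for \<open>j < i\<close>; limits along the ultrafilter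
      ignore these indices.\<close>
    define N where "N i j = dir_law (\<mu> j) (j - i) (v j)" for i j
    define m where "m i j = \<mu> j (j - i)" for i j
    have N_sphere: "N i j \<in> sphere_laws" for i j
      unfolding N_def by (rule dir_law_sphere[OF K_SL[OF \<mu>] v])
    have m_K: "m i j \<in> K" for i j unfolding m_def by (rule \<mu>)
    have "\<exists>\<rho>\<in>sphere_laws. weak_limit (sphere 0 1) (N i) \<rho>" for i
      using weak_limit_exists[OF compact_sphere, of "N i"] N_sphere by blast
    then obtain \<nu> where \<nu>: "\<And>i. \<nu> i \<in> sphere_laws" "\<And>i. weak_limit (sphere 0 1) (N i) (\<nu> i)" by metis
    have "\<exists>L\<in>K. weak_limit SL (m i) L" for i
      using compactin_weak_limit[OF compact, of "m i"] m_K by blast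
    then obtain M where M: "\<And>i. M i \<in> K" "\<And>i. weak_limit SL (m i) (M i)" by metis
    have act: "\<nu> i = act (M i) (\<nu> (Suc i))" for i
    proof (rule weak_limit_act[OF compact_moment_axioms m_K M(1) M(2) N_sphere \<nu>(1) \<nu>(2) N_sphere \<nu>(1) \<nu>(2)])
      show "eventually (\<lambda>j. N i j = act (m i j) (N (Suc i) j)) F"
        using eventually_at_least[of "Suc i"]
      proof eventually_elim
        case (elim j)
        then have "j - i = Suc (j - Suc i)" by simp
        then show ?case unfolding N_def m_def using dir_law_Suc[OF K_SL[OF \<mu>] v] by simp
      qed
    qed
    \<comment> \<open>\<open>N i j\<close> is the law after \<open>j - i\<close> steps, which for almost all \<open>j\<close> exceeds the number \<open>r\<close> of steps
      that an attainable bound requires. A tent function on the neighbourhood carries it to \<open>\<nu> i\<close>.\<close>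
    have mass_le: "measure (\<nu> i) (sphere 0 1 \<inter> V) \<le> z"
      if av: "avoids k' z" and V: "subspace V" "dim V \<le> k'" for k' z i and V :: "(real ^ 'n) set"
    proof (rule avoids_later[OF av])
      fix r \<delta> assume \<delta>: "0 < \<delta>"
        and later: "\<And>\<mu> v W n. (\<And>i. \<mu> i \<in> K) \<Longrightarrow> v \<noteq> 0 \<Longrightarrow> subspace W \<Longrightarrow> dim W \<le> k' \<Longrightarrow> r \<le> n \<Longrightarrow>
          measure (dir_law \<mu> n v) {x \<in> sphere 0 1. infdist x W \<le> \<delta>} \<le> z"
      define \<phi> where "\<phi> x = max 0 (1 - infdist x V / \<delta>)" for x
      have \<phi>: "continuous_on UNIV \<phi>" unfolding \<phi>_def using \<delta> by (intro continuous_intros) auto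
      have V_sets: "sphere 0 1 \<inter> V \<in> sets (\<nu> i)"
        by (rule sphere_law_sets_subspace[OF \<nu>(1) V(1)])
      have "measure (\<nu> i) (sphere 0 1 \<inter> V) \<le> (\<integral>x. \<phi> x \<partial>\<nu> i)"
        by (rule sphere_law_integral_bounds(1)[OF \<nu>(1) \<phi> V_sets])
          (use \<delta> in \<open>simp add: \<phi>_def indicator_def infdist_nonneg\<close>)
      also have "\<dots> \<le> z"
      proof (rule tendsto_upperbound[OF weak_limitD_sphere[OF \<nu>(2) \<phi>] _ nontrivial])
        show "eventually (\<lambda>j. (\<integral>x. \<phi> x \<partial>N i j) \<le> z) F"
          using eventually_at_least[of "r + i"]
        proof eventually_elim
          case (elim j)
          have "(\<integral>x. \<phi> x \<partial>N i j) \<le> measure (N i j) {x \<in> sphere 0 1. infdist x V \<le> \<delta>}"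
            by (rule sphere_law_integral_bounds(2)[OF N_sphere \<phi> sphere_law_measurable_infdist[OF N_sphere]])
              (use \<delta> in \<open>auto simp: \<phi>_def indicator_def field_simps infdist_nonneg\<close>)
          also have "\<dots> \<le> z" unfolding N_def using elim by (intro later \<mu> v V) simp
          finally show ?case .
        qed
      qed
      finally show ?thesis .
    qed
    obtain V where V: "subspace V" "dim V \<le> Suc k"
      "\<forall>x l. (x \<longlongrightarrow> l) F \<longrightarrow> ((\<lambda>j. infdist (x j) (W j)) \<longlongrightarrow> 0) F \<longrightarrow> l \<in> V"
      using subspace_limit[of W "Suc k"] W by blast
    have ge: "a \<le> measure (\<nu> 0) {x \<in> sphere 0 1. infdist x V \<le> 2 * \<kappa>}" if \<kappa>: "0 < \<kappa>" for \<kappa>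
    proof -
      define \<phi> where "\<phi> x = min 1 (max 0 (2 - infdist x V / \<kappa>))" for x
      have \<phi>: "continuous_on UNIV \<phi>" unfolding \<phi>_def using \<kappa> by (intro continuous_intros) auto
      have near: "eventually (\<lambda>j. \<forall>x\<in>sphere 0 1. infdist x (W j) \<le> 1 / real (j + 1) \<longrightarrow> infdist x V \<le> \<kappa>) F"
      proof (rule ccontr)
        define Q where "Q j x \<longleftrightarrow> x \<in> sphere 0 1 \<and> infdist x (W j) \<le> 1 / real (j + 1) \<and> \<not> infdist x V \<le> \<kappa>" for j x
        assume "\<not> ?thesis"
        then have ev: "eventually (\<lambda>j. \<exists>x. Q j x) F"
          unfolding not_eventually_iff Q_def by eventually_elim blast
        define x where "x j = (SOME x. Q j x)" for j
        have Qx: "eventually (\<lambda>j. Q j (x j)) F"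
          using ev by eventually_elim (auto simp: x_def intro: someI)
        then have "eventually (\<lambda>j. x j \<in> sphere 0 1) F" by eventually_elim (simp add: Q_def)
        from compact_limit[OF compact_sphere this] obtain l where l: "(x \<longlongrightarrow> l) F" by blast
        have "((\<lambda>j. infdist (x j) (W j)) \<longlongrightarrow> 0) F"
        proof (rule tendsto_sandwich[of "\<lambda>_. 0"])
          show "eventually (\<lambda>j. 0 \<le> infdist (x j) (W j)) F" by (simp add: infdist_nonneg)
          show "eventually (\<lambda>j. infdist (x j) (W j) \<le> 1 / real (j + 1)) F"
            using Qx by eventually_elim (simp add: Q_def)
          show "((\<lambda>j. 1 / real (j + 1)) \<longlongrightarrow> 0) F"
            by (intro tendsto_of_sequentially LIMSEQ_ignore_initial_segment[OF lim_1_over_n])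
        qed simp
        with l V(3) have "l \<in> V" by blast
        have "((\<lambda>j. infdist (x j) V) \<longlongrightarrow> infdist l V) F" using l by (rule tendsto_infdist)
        then have "\<kappa> \<le> infdist l V"
          by (rule tendsto_lowerbound) (use Qx nontrivial in \<open>auto simp: Q_def elim: eventually_mono\<close>)
        with \<open>l \<in> V\<close> \<kappa> show False by simp
      qed
      have "a \<le> (\<integral>x. \<phi> x \<partial>\<nu> 0)"
      proof (rule tendsto_le[OF nontrivial weak_limitD_sphere[OF \<nu>(2) \<phi>]])
        have "(\<lambda>j. a - a / real (j + 2)) \<longlonglongrightarrow> a - 0"
          by (intro tendsto_intros LIMSEQ_ignore_initial_segment[OF lim_const_over_n])
        then show "((\<lambda>j. a - a / real (j + 2)) \<longlongrightarrow> a) F" by (simp add: tendsto_of_sequentially)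
        show "eventually (\<lambda>j. a - a / real (j + 2) \<le> (\<integral>x. \<phi> x \<partial>N 0 j)) F"
          using near
        proof eventually_elim
          case (elim j)
          have "measure (N 0 j) {x \<in> sphere 0 1. infdist x (W j) \<le> 1 / real (j + 1)} \<le> (\<integral>x. \<phi> x \<partial>N 0 j)"
          proof (rule sphere_law_integral_bounds(1)[OF N_sphere \<phi> sphere_law_measurable_infdist[OF N_sphere]])
            fix x :: "real ^ 'n" assume x: "x \<in> sphere 0 1"
            show "indicator {x \<in> sphere 0 1. infdist x (W j) \<le> 1 / real (j + 1)} x \<le> \<phi> x \<and> \<phi> x \<le> 1"
            proof (cases "infdist x (W j) \<le> 1 / real (j + 1)")
              case True
              then have "infdist x V / \<kappa> \<le> 1" using elim x \<kappa> by simp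
              then show ?thesis by (simp add: \<phi>_def indicator_def)
            qed (simp add: \<phi>_def indicator_def)
          qed
          with big[of j] show ?case by (simp add: N_def)
        qed
      qed
      also have "\<dots> \<le> measure (\<nu> 0) {x \<in> sphere 0 1. infdist x V \<le> 2 * \<kappa>}"
        by (rule sphere_law_integral_bounds(2)[OF \<nu>(1) \<phi> sphere_law_measurable_infdist[OF \<nu>(1)]])
          (use \<kappa> in \<open>auto simp: \<phi>_def indicator_def field_simps\<close>)
      finally show ?thesis .
    qed
    have "a \<le> measure (\<nu> 0) (sphere 0 1 \<inter> V)"
    proof -
      interpret \<nu>: prob_space "\<nu> 0" by (rule sphere_lawsD[OF \<nu>(1)])
      define S where "S n = {x \<in> sphere 0 1. infdist x V \<le> 2 * (1 / real (n + 1))}" for n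
      have "(\<Inter>n. S n) = sphere 0 1 \<inter> V"
      proof (intro set_eqI iffI)
        fix x assume x: "x \<in> (\<Inter>n. S n)"
        then have "infdist x V \<le> 2 * (1 / real (n + 1))" for n by (auto simp: S_def)
        moreover have "(\<lambda>n. 2 * (1 / real (n + 1))) \<longlonglongrightarrow> 2 * 0"
          by (intro tendsto_intros LIMSEQ_ignore_initial_segment[OF lim_1_over_n])
        ultimately have "infdist x V \<le> 2 * 0" by (intro LIMSEQ_le_const) auto
        then have "infdist x V = 0" using infdist_nonneg[of x V] by simp
        then have "x \<in> V"
          using V(1) subspace_0[OF V(1)] closed_subspace[OF V(1)] in_closed_iff_infdist_zero[of V x] by auto
        with x show "x \<in> sphere 0 1 \<inter> V" by (auto simp: S_def)
      qed (auto simp: S_def)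
      moreover have "(\<lambda>n. measure (\<nu> 0) (S n)) \<longlonglongrightarrow> measure (\<nu> 0) (\<Inter>n. S n)"
      proof (rule \<nu>.finite_Lim_measure_decseq)
        show "range S \<subseteq> sets (\<nu> 0)"
          unfolding S_def using sphere_law_measurable_infdist[OF \<nu>(1)] by blast
        show "decseq S"
          unfolding decseq_def S_def by (auto intro: order_trans simp: frac_le)
      qed
      ultimately have "(\<lambda>n. measure (\<nu> 0) (S n)) \<longlonglongrightarrow> measure (\<nu> 0) (sphere 0 1 \<inter> V)" by simp
      then show ?thesis
        by (rule LIMSEQ_le_const) (use ge[of "1 / real (_ + 1)"] in \<open>auto simp: S_def\<close>)
    qed
    show False
    proof (rule no_ancient_concentration[of \<nu> M k a V])
      show "measure (\<nu> i) (sphere 0 1 \<inter> U) = 0" if "subspace U" "dim U \<le> k" for i and U :: "(real ^ 'n) set"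
      proof (rule antisym)
        have "measure (\<nu> i) (sphere 0 1 \<inter> U) \<le> 0 + e" if "0 < e" for e
          using mass_le[OF Suc.IH[OF _ that] \<open>subspace U\<close> \<open>dim U \<le> k\<close>] Suc.prems(1) by simp
        then show "measure (\<nu> i) (sphere 0 1 \<inter> U) \<le> 0" by (rule field_le_epsilon)
      qed simp
      show "measure (\<nu> i) (sphere 0 1 \<inter> U) \<le> a" if "subspace U" "dim U \<le> Suc k" for i and U :: "(real ^ 'n) set"
      proof (rule field_le_epsilon)
        fix e :: real assume "0 < e"
        then show "measure (\<nu> i) (sphere 0 1 \<inter> U) \<le> a + e"
          by (intro mass_le[OF above that]) simp
      qed
    qed fact+
  qed
qed

end

section \<open>Exponential moments\<close>

lemma exp_le_quadratic: "exp y \<le> 1 + y + y\<^sup>2 * exp \<bar>y\<bar>" for y :: real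
proof -
  obtain z where z: "\<bar>z\<bar> \<le> \<bar>y\<bar>" "exp y = (\<Sum>m<2. y ^ m / fact m) + exp z / fact 2 * y ^ 2"
    using Maclaurin_exp_le[of y 2] by blast
  have "exp z / 2 * y\<^sup>2 \<le> exp \<bar>y\<bar> * y\<^sup>2"
  proof (rule mult_right_mono)
    have "exp z \<le> exp \<bar>y\<bar>" using z(1) by simp
    then show "exp z / 2 \<le> exp \<bar>y\<bar>" using exp_gt_zero[of z] by linarith
  qed simp
  with z(2) show ?thesis by (simp add: numeral_2_eq_2 mult.commute)
qed

lemma square_le_exp: "0 \<le> x \<Longrightarrow> x\<^sup>2 \<le> 2 * exp x" for x :: real
proof -
  assume x: "0 \<le> x"
  obtain z where z: "exp x = (\<Sum>m<3. x ^ m / fact m) + exp z / fact 3 * x ^ 3"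
    using Maclaurin_exp_le[of x 3] by blast
  have "0 \<le> exp z / fact 3 * x ^ 3" using x by simp
  with z have "(\<Sum>m<3. x ^ m / fact m) \<le> exp x" by linarith
  then show ?thesis using x by (simp add: numeral_3_eq_3 power2_eq_square)
qed

context prob_space
begin

text \<open>Expand the exponential to second order: for \<open>t \<le> \<sigma> / 2\<close> the error \<open>(t * W)\<^sup>2 * exp (t * \<bar>W\<bar>)\<close> is at
  most \<open>t\<^sup>2\<close> times a multiple of \<open>exp (\<sigma> * \<bar>W\<bar>)\<close>. So for small \<open>t\<close> the cumulant generating function is
  as good as linear, uniformly over all \<open>W\<close> with the same bound \<open>B\<close>.\<close>

lemma exp_moment_le:
  fixes W :: "'a \<Rightarrow> real"
  assumes W: "integrable M W" and \<sigma>: "0 < \<sigma>" "integrable M (\<lambda>x. exp (\<sigma> * \<bar>W x\<bar>))" "(\<integral>x. exp (\<sigma> * \<bar>W x\<bar>) \<partial>M) \<le> B"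
    and t: "0 \<le> t" "t \<le> \<sigma> / 2"
  shows "integrable M (\<lambda>x. exp (t * W x))"
    and "(\<integral>x. exp (t * W x) \<partial>M) \<le> exp (t * (\<integral>x. W x \<partial>M) + t\<^sup>2 * (8 / \<sigma>\<^sup>2) * B)"
proof -
  have [measurable]: "W \<in> borel_measurable M" using W by simp
  show int: "integrable M (\<lambda>x. exp (t * W x))"
  proof (rule Bochner_Integration.integrable_bound[OF \<sigma>(2)])
    have "t * W x \<le> \<sigma> * \<bar>W x\<bar>" for x
    proof -
      have "t * W x \<le> t * \<bar>W x\<bar>" using t(1) by (intro mult_left_mono) auto
      also have "\<dots> \<le> \<sigma> * \<bar>W x\<bar>" using t \<sigma>(1) by (intro mult_right_mono) auto
      finally show ?thesis .
    qed
    then show "AE x in M. norm (exp (t * W x)) \<le> norm (exp (\<sigma> * \<bar>W x\<bar>))" by simp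
  qed simp
  have "(\<integral>x. exp (t * W x) \<partial>M) \<le> (\<integral>x. 1 + t * W x + t\<^sup>2 * (8 / \<sigma>\<^sup>2) * exp (\<sigma> * \<bar>W x\<bar>) \<partial>M)"
  proof (rule integral_mono[OF int])
    show "integrable M (\<lambda>x. 1 + t * W x + t\<^sup>2 * (8 / \<sigma>\<^sup>2) * exp (\<sigma> * \<bar>W x\<bar>))"
      using W \<sigma>(2) by simp
    fix x
    have "(\<sigma> / 2 * \<bar>W x\<bar>)\<^sup>2 \<le> 2 * exp (\<sigma> / 2 * \<bar>W x\<bar>)" using \<sigma>(1) by (intro square_le_exp) simp
    then have sq: "(W x)\<^sup>2 \<le> 8 / \<sigma>\<^sup>2 * exp (\<sigma> / 2 * \<bar>W x\<bar>)"
      using \<sigma>(1) by (simp add: power_mult_distrib power_divide field_simps)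
    have "exp (t * W x) \<le> 1 + t * W x + (t * W x)\<^sup>2 * exp \<bar>t * W x\<bar>" by (rule exp_le_quadratic)
    also have "(t * W x)\<^sup>2 * exp \<bar>t * W x\<bar> = t\<^sup>2 * ((W x)\<^sup>2 * exp (t * \<bar>W x\<bar>))"
      using t(1) by (simp add: power_mult_distrib abs_mult)
    also have "(W x)\<^sup>2 * exp (t * \<bar>W x\<bar>) \<le> (8 / \<sigma>\<^sup>2 * exp (\<sigma> / 2 * \<bar>W x\<bar>)) * exp (\<sigma> / 2 * \<bar>W x\<bar>)"
    proof (rule mult_mono[OF sq])
      show "exp (t * \<bar>W x\<bar>) \<le> exp (\<sigma> / 2 * \<bar>W x\<bar>)"
        using mult_right_mono[OF t(2), of "\<bar>W x\<bar>"] by simp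
    qed simp_all
    also have "\<dots> = 8 / \<sigma>\<^sup>2 * exp (\<sigma> * \<bar>W x\<bar>)"
      by (simp add: exp_add[symmetric])
    finally show "exp (t * W x) \<le> 1 + t * W x + t\<^sup>2 * (8 / \<sigma>\<^sup>2) * exp (\<sigma> * \<bar>W x\<bar>)"
      by (simp add: mult_left_mono mult.assoc)
  qed
  also have "\<dots> = 1 + t * (\<integral>x. W x \<partial>M) + t\<^sup>2 * (8 / \<sigma>\<^sup>2) * (\<integral>x. exp (\<sigma> * \<bar>W x\<bar>) \<partial>M)"
    using W \<sigma>(2) by (simp add: prob_space)
  also have "\<dots> \<le> 1 + (t * (\<integral>x. W x \<partial>M) + t\<^sup>2 * (8 / \<sigma>\<^sup>2) * B)"
    using \<sigma>(3) by (simp add: mult_left_mono divide_right_mono)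
  also have "\<dots> \<le> exp (t * (\<integral>x. W x \<partial>M) + t\<^sup>2 * (8 / \<sigma>\<^sup>2) * B)"
    by (rule exp_ge_add_one_self)
  finally show "(\<integral>x. exp (t * W x) \<partial>M) \<le> exp (t * (\<integral>x. W x \<partial>M) + t\<^sup>2 * (8 / \<sigma>\<^sup>2) * B)" .
qed

text \<open>One exponential moment has two uses: by Jensen's inequality, here \<open>1 + y \<le> exp y\<close>, it locates the
  expectation, and by Markov's inequality it bounds the tail.\<close>

lemma
  fixes X :: "'a \<Rightarrow> real"
  assumes X: "integrable M X" and t: "0 < t" and E: "0 < E"
    and exp: "integrable M (\<lambda>x. exp (t * X x))" "(\<integral>x. exp (t * X x) \<partial>M) \<le> E * exp (t * b)"
  shows exp_moment_expectation_le: "(\<integral>x. X x \<partial>M) \<le> b + ln E / t"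
    and exp_moment_tail_le: "measure M {x \<in> space M. b + \<rho> \<le> X x} \<le> E * exp (- t * \<rho>)"
proof -
  have [measurable]: "X \<in> borel_measurable M" using X by simp
  have "(\<integral>x. 1 + (t * X x - (t * b + ln E)) \<partial>M) \<le> (\<integral>x. exp (t * X x) * (exp (- t * b) / E) \<partial>M)"
  proof (rule integral_mono)
    show "integrable M (\<lambda>x. 1 + (t * X x - (t * b + ln E)))" using X by simp
    show "integrable M (\<lambda>x. exp (t * X x) * (exp (- t * b) / E))" using exp(1) by simp
    fix x
    have "1 + (t * X x - (t * b + ln E)) \<le> exp (t * X x - (t * b + ln E))" by (rule exp_ge_add_one_self)
    also have "\<dots> = exp (t * X x) * (exp (- t * b) / E)"
      using E by (simp add: exp_diff exp_add exp_minus field_simps)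
    finally show "1 + (t * X x - (t * b + ln E)) \<le> exp (t * X x) * (exp (- t * b) / E)" .
  qed
  also have "\<dots> = (\<integral>x. exp (t * X x) \<partial>M) * (exp (- t * b) / E)" by simp
  also have "\<dots> \<le> (E * exp (t * b)) * (exp (- t * b) / E)"
    using exp(2) E by (intro mult_right_mono) auto
  also have "\<dots> = 1" using E by (simp add: exp_minus field_simps)
  finally have "t * (\<integral>x. X x \<partial>M) \<le> t * b + ln E" using X by (simp add: prob_space)
  then show "(\<integral>x. X x \<partial>M) \<le> b + ln E / t" using t by (simp add: field_simps)
  have "measure M {x \<in> space M. b + \<rho> \<le> X x} = measure M {x \<in> space M. exp (t * (b + \<rho>)) \<le> exp (t * X x)}"
    using t by simp
  also have "\<dots> \<le> (\<integral>x. exp (t * X x) \<partial>M) / exp (t * (b + \<rho>))"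
    by (rule integral_Markov_inequality_measure[where A = "space M"]) (use exp(1) in auto)
  also have "\<dots> \<le> E * exp (t * b) / exp (t * (b + \<rho>))" using exp(2) by (intro divide_right_mono) auto
  also have "\<dots> = E * exp (- t * \<rho>)" by (simp add: exp_add exp_minus field_simps)
  finally show "measure M {x \<in> space M. b + \<rho> \<le> X x} \<le> E * exp (- t * \<rho>)" .
qed

end

section \<open>No loss along a typical direction\<close>

lemma ln_norm_SL_bounds:
  "\<exists>c\<ge>1. \<forall>T\<in>SL. \<forall>v :: real ^ 'n. norm v \<le> c * op_norm T ^ (CARD('n) - 1) * norm (T *v v) \<and>
    (norm v = 1 \<longrightarrow> ln (norm (T *v v)) \<le> ln (op_norm T) \<and>
      - ln (norm (T *v v)) \<le> ln c + real (CARD('n) - 1) * ln (op_norm T))"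
proof -
  define c :: real where "c = real CARD('n) * fact CARD('n)"
  have c: "1 \<le> c"
  proof -
    have "1 \<le> real CARD('n)" by (simp add: Suc_leI)
    moreover have "1 \<le> (fact CARD('n) :: real)" by (rule fact_ge_1)
    ultimately show ?thesis unfolding c_def using mult_mono[of 1 "real CARD('n)" 1 "fact CARD('n) :: real"] by simp
  qed
  have low: "norm x \<le> c * op_norm T ^ (CARD('n) - 1) * norm (T *v x)" if "T \<in> SL" for T and x :: "real ^ 'n"
    unfolding c_def by (rule norm_le_norm_SL_mult[OF that])
  have pos: "0 < norm (T *v v)" if "T \<in> SL" "norm v = 1" for T and v :: "real ^ 'n"
    using SL_mult_sphere_neq_0[OF that(1), of v] that(2) by simp
  show ?thesis
  proof (intro exI[of _ c] conjI c ballI allI impI)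
    show "norm v \<le> c * op_norm T ^ (CARD('n) - 1) * norm (T *v v)" if "T \<in> SL" for T and v :: "real ^ 'n"
      by (rule low[OF that])
    fix T :: "real ^ 'n ^ 'n" and v :: "real ^ 'n" assume T: "T \<in> SL" and v: "norm v = 1"
    note p = pos[OF T v]
    have o: "1 \<le> op_norm T" by (rule one_le_op_norm_SL[OF T])
    show "ln (norm (T *v v)) \<le> ln (op_norm T)"
      using norm_matrix_vector_mult_le[of T v] v p o by (intro ln_mono) auto
    have "1 \<le> c * op_norm T ^ (CARD('n) - 1) * norm (T *v v)" using low[OF T, of v] v by simp
    then have "ln 1 \<le> ln (c * op_norm T ^ (CARD('n) - 1) * norm (T *v v))" by (intro ln_mono) auto
    also have "\<dots> = ln c + real (CARD('n) - 1) * ln (op_norm T) + ln (norm (T *v v))"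
      using c o p by (simp add: ln_mult ln_realpow)
    finally show "- ln (norm (T *v v)) \<le> ln c + real (CARD('n) - 1) * ln (op_norm T)" by simp
  qed
qed

lemma (in compact_moment) integrable_ln_norm:
  assumes \<mu>: "\<And>i. \<mu> i \<in> K" and v: "norm v = 1"
  shows "integrable (prod_law \<mu> n) (\<lambda>T. ln (norm (T *v v)))"
proof -
  note m = prod_law_SL[OF K_SL[OF \<mu>], where n = n]
  interpret prob_space "prod_law \<mu> n" by (rule SL_lawsD[OF m])
  obtain c where c: "1 \<le> c"
    "\<And>T (x :: real ^ 'n). T \<in> SL \<Longrightarrow> norm x \<le> c * op_norm T ^ (CARD('n) - 1) * norm (T *v x)"
    "\<And>T (v :: real ^ 'n). T \<in> SL \<Longrightarrow> norm v = 1 \<Longrightarrow> ln (norm (T *v v)) \<le> ln (op_norm T)"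
    "\<And>T (v :: real ^ 'n). T \<in> SL \<Longrightarrow> norm v = 1 \<Longrightarrow>
      - ln (norm (T *v v)) \<le> ln c + real (CARD('n) - 1) * ln (op_norm T)"
    using ln_norm_SL_bounds[where 'n = 'n] by blast
  show ?thesis
  proof (rule Bochner_Integration.integrable_bound)
    show "integrable (prod_law \<mu> n) (\<lambda>T. ln c + (real (CARD('n) - 1) + 1) * ln (op_norm T))"
      using integrable_ln_op_norm[OF \<mu>] by simp
    show "(\<lambda>T. ln (norm (T *v v))) \<in> borel_measurable (prod_law \<mu> n)"
      by (rule measurable_SL_law[OF m]) measurable
    show "AE T in prod_law \<mu> n. norm (ln (norm (T *v v))) \<le> norm (ln c + (real (CARD('n) - 1) + 1) * ln (op_norm T))"
    proof (rule AE_I2)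
      fix T assume "T \<in> space (prod_law \<mu> n)"
      then have T: "T \<in> SL" by (simp add: SL_lawsD(3)[OF m])
      have "0 \<le> ln c" using c(1) by simp
      moreover have "0 \<le> real (CARD('n) - 1) * ln (op_norm T)"
        using ln_op_norm_nonneg[OF T] by simp
      ultimately show "norm (ln (norm (T *v v))) \<le> norm (ln c + (real (CARD('n) - 1) + 1) * ln (op_norm T))"
        using c(3,4)[OF T v] ln_op_norm_nonneg[OF T] by (simp add: algebra_simps abs_le_iff)
    qed
  qed
qed

text \<open>With \<open>w\<close> the most expanded direction of \<open>B\<close>, from \<open>op_norm_le_norm_mult_inner\<close>, the event forces the
  direction of \<open>T *v v\<close> to lie within \<open>\<delta>\<close> of the hyperplane orthogonal to \<open>w\<close>.\<close>

lemma (in strongly_irreducible) small_inner_product: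
  assumes \<eta>: "0 < \<eta>"
  shows "\<exists>r. \<exists>\<delta>>0. \<forall>\<mu> v B. (\<forall>i. \<mu> i \<in> K) \<longrightarrow> v \<noteq> 0 \<longrightarrow> B \<in> SL \<longrightarrow>
    measure (prod_law \<mu> r) {T \<in> SL. norm (B *v (T *v v)) \<le> \<delta> * op_norm B * norm (T *v v)} \<le> \<eta>"
proof -
  have "CARD('n) - 1 < CARD('n)" by simp
  from avoids_all[OF this \<eta>] obtain r \<delta> where \<delta>: "0 < \<delta>"
    and av: "\<And>\<mu> v W. (\<forall>i. \<mu> i \<in> K) \<Longrightarrow> v \<noteq> 0 \<Longrightarrow> subspace W \<Longrightarrow> dim W \<le> CARD('n) - 1 \<Longrightarrow>
      measure (dir_law \<mu> r v) {x \<in> sphere 0 1. infdist x W \<le> \<delta>} \<le> \<eta>"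
    unfolding avoids_def by blast
  have "measure (prod_law \<mu> r) {T \<in> SL. norm (B *v (T *v v)) \<le> \<delta> * op_norm B * norm (T *v v)} \<le> \<eta>"
    if \<mu>: "\<And>i. \<mu> i \<in> K" and v: "v \<noteq> 0" and B: "B \<in> SL" for \<mu> v and B :: "real ^ 'n ^ 'n"
  proof -
    note m = prod_law_SL[OF K_SL[OF \<mu>], where n = r]
    interpret prob_space "prod_law \<mu> r" by (rule SL_lawsD[OF m])
    obtain w where w: "norm w = 1" "\<And>x. op_norm B * \<bar>x \<bullet> w\<bar> \<le> norm (B *v x)"
      using op_norm_le_norm_mult_inner[of B] by blast
    define W where "W = {x. w \<bullet> x = 0}"
    have "w \<noteq> 0" using w(1) by auto
    then have W: "subspace W" "dim W \<le> CARD('n) - 1"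
      by (auto simp: W_def subspace_hyperplane dim_hyperplane)
    let ?S = "{x \<in> sphere 0 1. infdist x W \<le> \<delta>}"
    let ?T = "{T \<in> SL. norm (B *v (T *v v)) \<le> \<delta> * op_norm B * norm (T *v v)}"
    let ?f = "\<lambda>T. sgn (T *v v)"
    have f: "?f \<in> measurable (prod_law \<mu> r) (restrict_space borel (sphere 0 1))"
    proof (rule measurable_restrict_space2)
      show "?f \<in> borel_measurable (prod_law \<mu> r)" by (rule measurable_SL_law[OF m]) measurable
      show "?f \<in> space (prod_law \<mu> r) \<rightarrow> sphere 0 1"
        unfolding SL_lawsD(3)[OF m] using v SL_mult_eq_0_iff[where x = v] by (simp add: norm_sgn)
    qed
    have S: "?S \<in> sets (restrict_space borel (sphere 0 1))"
      using sphere_law_measurable_infdist[OF dir_law_sphere[OF K_SL[OF \<mu>] v, where n = r]]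
      by (simp add: dir_law_def)
    have "?T \<subseteq> ?f -` ?S \<inter> space (prod_law \<mu> r)"
    proof
      fix T assume T: "T \<in> ?T"
      define x where "x = T *v v"
      have x: "x \<noteq> 0" using T v SL_mult_eq_0_iff[of T v] by (simp add: x_def)
      have "op_norm B * \<bar>x \<bullet> w\<bar> \<le> op_norm B * (\<delta> * norm x)"
        using w(2)[of x] T by (simp add: x_def mult_ac)
      then have "\<bar>x \<bullet> w\<bar> \<le> \<delta> * norm x"
        using one_le_op_norm_SL[OF B] by simp
      then have d: "\<bar>sgn x \<bullet> w\<bar> \<le> \<delta>"
        using x by (simp add: sgn_div_norm abs_mult field_simps)
      have "w \<bullet> (sgn x - (sgn x \<bullet> w) *\<^sub>R w) = 0"
        using w(1) by (simp add: inner_diff_right inner_commute dot_square_norm)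
      then have "sgn x - (sgn x \<bullet> w) *\<^sub>R w \<in> W" by (simp add: W_def)
      then have "infdist (sgn x) W \<le> dist (sgn x) (sgn x - (sgn x \<bullet> w) *\<^sub>R w)" by (rule infdist_le)
      also have "\<dots> \<le> \<delta>" using d w(1) by (simp add: dist_norm)
      finally show "T \<in> ?f -` ?S \<inter> space (prod_law \<mu> r)"
        using T x by (simp add: x_def SL_lawsD(3)[OF m] norm_sgn)
    qed
    then have "measure (prod_law \<mu> r) ?T \<le> measure (prod_law \<mu> r) (?f -` ?S \<inter> space (prod_law \<mu> r))"
      by (rule finite_measure_mono) (rule measurable_sets[OF f S])
    also have "\<dots> = measure (dir_law \<mu> r v) ?S"
      unfolding dir_law_def by (rule measure_distr[OF f S, symmetric])
    also have "\<dots> \<le> \<eta>" using av[OF _ v W] \<mu> by blast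
    finally show ?thesis .
  qed
  with \<delta> show ?thesis by (intro exI[of _ r] exI[of _ \<delta>]) auto
qed

lemma ennreal_add_mult:
  fixes a1 a2 a3 w z :: real
  assumes "0 \<le> a1" "0 \<le> a2" "0 \<le> a3" "0 \<le> w" "0 \<le> z"
  shows "ennreal (a1 + a2 * w + a3 * z) = ennreal a1 + ennreal a2 * ennreal w + ennreal a3 * ennreal z"
  using assms by (simp add: ennreal_mult)

text \<open>Split the product as \<open>B ** T\<close>, where \<open>T\<close> consists of the first \<open>r\<close> factors. Unless \<open>T *v v\<close> is
  almost orthogonal to the most expanded direction of \<open>B\<close>, the norm of \<open>B *v (T *v v)\<close> is at least
  \<open>\<delta> * op_norm B * norm (T *v v)\<close>, and nothing is lost beyond a constant and the logarithm of the norm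
  of the short product \<open>T\<close>. The exceptional event has conditional probability at most \<open>\<eta>\<close> given \<open>B\<close>, but
  the logarithm on it is unbounded. There one uses
  \<open>\<gamma> * ln (op_norm S) \<le> y + exp (\<gamma> * ln (op_norm S) - y)\<close> with \<open>y = m * ln C\<close>: the second term has mean
  at most one since the moment of a product of \<open>m\<close> factors is at most \<open>C ^ m\<close>, and \<open>y\<close> contributes only
  in proportion to \<open>\<eta>\<close>. Stating the event through norms instead of through the expanded direction makes
  it measurable in \<open>B\<close> and \<open>T\<close> jointly.\<close>

lemma (in strongly_irreducible) loss_bound:
  fixes \<eta> :: real
  assumes ne: "K \<noteq> {}" and \<eta>: "0 < \<eta>"
  shows "\<exists>Q r. \<forall>\<mu> v m. (\<forall>i. \<mu> i \<in> K) \<longrightarrow> norm v = 1 \<longrightarrow> r \<le> m \<longrightarrow>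
    expected_log_norm \<mu> m - (\<integral>T. ln (norm (T *v v)) \<partial>prod_law \<mu> m) \<le>
      Q + real m * (real CARD('n) * ln C / \<gamma> * \<eta>)"
proof -
  have C: "1 \<le> C" using ne C_ge_1 by blast
  obtain c where c: "1 \<le> c"
    "\<And>T (x :: real ^ 'n). T \<in> SL \<Longrightarrow> norm x \<le> c * op_norm T ^ (CARD('n) - 1) * norm (T *v x)"
    "\<And>T (v :: real ^ 'n). T \<in> SL \<Longrightarrow> norm v = 1 \<Longrightarrow> ln (norm (T *v v)) \<le> ln (op_norm T)"
    "\<And>T (v :: real ^ 'n). T \<in> SL \<Longrightarrow> norm v = 1 \<Longrightarrow>
      - ln (norm (T *v v)) \<le> ln c + real (CARD('n) - 1) * ln (op_norm T)"
    using ln_norm_SL_bounds[where 'n = 'n] by blast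
  from small_inner_product[OF \<eta>] obtain r \<delta> where \<delta>: "0 < \<delta>"
    and small: "\<And>\<mu> v B. (\<forall>i. \<mu> i \<in> K) \<Longrightarrow> v \<noteq> 0 \<Longrightarrow> B \<in> SL \<Longrightarrow>
    measure (prod_law \<mu> r) {T \<in> SL. norm (B *v (T *v v)) \<le> \<delta> * op_norm B * norm (T *v v)} \<le> \<eta>"
    by blast
  define c1 where "c1 = ln c + \<bar>ln \<delta>\<bar>"
  have c1: "0 \<le> c1" using c(1) by (simp add: c1_def)
  define D where "D = real CARD('n)"
  have D1: "1 \<le> D" by (simp add: D_def Suc_leI)
  have D2: "real (CARD('n) - 1) = D - 1" by (simp add: D_def of_nat_diff Suc_leI)
  define Q where "Q = c1 + D * (C ^ r / \<gamma>) + D / \<gamma>"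
  have "expected_log_norm \<mu> m - (\<integral>T. ln (norm (T *v v)) \<partial>prod_law \<mu> m) \<le> Q + real m * (D * ln C / \<gamma> * \<eta>)"
    if \<mu>: "\<And>i. \<mu> i \<in> K" and v: "norm v = 1" and m: "r \<le> m" for \<mu> v m
  proof -
    define \<mu>' where "\<mu>' = (\<lambda>i. \<mu> (r + i))"
    have \<mu>': "\<mu>' i \<in> K" for i by (simp add: \<mu>'_def \<mu>)
    note lm = prod_law_SL[OF K_SL[OF \<mu>], where n = m]
    note lr = prod_law_SL[OF K_SL[OF \<mu>], where n = r]
    note lb = prod_law_SL[OF K_SL[OF \<mu>'], where n = "m - r"]
    let ?B = "prod_law \<mu>' (m - r)"
    let ?T = "prod_law \<mu> r"
    interpret B: prob_space ?B by (rule SL_lawsD[OF lb])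
    interpret T: prob_space ?T by (rule SL_lawsD[OF lr])
    interpret pair_sigma_finite ?B ?T ..
    have v0: "v \<noteq> 0" using v by auto
    define loss where "loss S = ln (op_norm S) - ln (norm (S *v v))" for S
    define bad :: "((real ^ 'n ^ 'n) \<times> (real ^ 'n ^ 'n)) set"
      where "bad = {(B, T). norm (B *v (T *v v)) \<le> \<delta> * op_norm B * norm (T *v v)}"
    define y where "y = real m * ln C"
    have y: "0 \<le> y" using C by (simp add: y_def)
    have exp_y: "exp y = C ^ m" using C by (simp add: y_def exp_of_nat_mult)
    have ln_le: "ln (op_norm S) \<le> (op_norm S powr \<gamma> * exp (- y) + y) / \<gamma>" if S: "S \<in> SL" for S :: "real ^ 'n ^ 'n"
    proof -
      have o: "1 \<le> op_norm S" by (rule one_le_op_norm_SL[OF S])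
      have "\<gamma> * ln (op_norm S) - y \<le> exp (\<gamma> * ln (op_norm S) - y)"
        using exp_ge_add_one_self[of "\<gamma> * ln (op_norm S) - y"] by linarith
      also have "\<dots> = op_norm S powr \<gamma> * exp (- y)"
        using o by (simp add: powr_def exp_diff exp_minus field_simps)
      finally show ?thesis using \<gamma>_pos by (simp add: field_simps)
    qed
    have loss_le: "loss (B ** T) \<le> (c1 + D * ln (op_norm T) + D / \<gamma> * exp (- y) * op_norm (B ** T) powr \<gamma>) +
        D / \<gamma> * y * indicator bad (B, T)" if B: "B \<in> SL" and T: "T \<in> SL" for B T
    proof (cases "(B, T) \<in> bad")
      case True
      note S = SL_mult[OF B T]
      have "loss (B ** T) \<le> ln c + D * ln (op_norm (B ** T))"
        using c(4)[OF S v] unfolding loss_def D2 by (simp add: algebra_simps)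
      also have "\<dots> \<le> c1 + D * ((op_norm (B ** T) powr \<gamma> * exp (- y) + y) / \<gamma>)"
        using ln_le[OF S] D1 by (intro add_mono mult_left_mono) (auto simp: c1_def)
      also have "\<dots> \<le> (c1 + D * ln (op_norm T) + D / \<gamma> * exp (- y) * op_norm (B ** T) powr \<gamma>) + D / \<gamma> * y * indicator bad (B, T)"
        using True mult_nonneg_nonneg[of D "ln (op_norm T)"] ln_op_norm_nonneg[OF T] D1
        by (simp add: algebra_simps add_divide_distrib)
      finally show ?thesis .
    next
      case False
      define x where "x = T *v v"
      have x: "0 < norm x" using SL_mult_eq_0_iff[OF T, of v] v0 by (simp add: x_def)
      have oB: "1 \<le> op_norm B" and oT: "1 \<le> op_norm T" and oS: "1 \<le> op_norm (B ** T)"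
        using one_le_op_norm_SL B T SL_mult by blast+
      have "\<delta> * op_norm B * norm x \<le> norm (B *v x)" using False by (simp add: bad_def x_def)
      then have "ln (\<delta> * op_norm B * norm x) \<le> ln (norm (B *v x))"
        using \<delta> oB x by (intro ln_mono) auto
      then have 1: "ln \<delta> + ln (op_norm B) + ln (norm x) \<le> ln (norm ((B ** T) *v v))"
        using \<delta> oB x by (simp add: ln_mult x_def matrix_vector_mul_assoc)
      have "ln (op_norm (B ** T)) \<le> ln (op_norm B * op_norm T)"
        using op_norm_mult_le[of B T] oS by (intro ln_mono) auto
      then have 2: "ln (op_norm (B ** T)) \<le> ln (op_norm B) + ln (op_norm T)"
        using oB oT by (simp add: ln_mult)
      have "loss (B ** T) \<le> c1 + D * ln (op_norm T)"
        using 1 2 c(4)[OF T v] unfolding loss_def c1_def D2 x_def by (simp add: algebra_simps)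
      moreover have "0 \<le> D / \<gamma> * exp (- y) * op_norm (B ** T) powr \<gamma>" using D1 \<gamma>_pos by simp
      ultimately show ?thesis using False by simp
    qed
    have loss_meas [measurable]: "loss \<in> borel_measurable borel"
      unfolding loss_def[abs_def] by measurable
    have loss_nonneg: "0 \<le> loss S" if "S \<in> SL" for S
      using c(3)[OF that v] by (simp add: loss_def)
    have bad_sets [measurable]: "bad \<in> sets (borel \<Otimes>\<^sub>M borel)"
    proof -
      have "{p \<in> space ((borel :: (real ^ 'n ^ 'n) measure) \<Otimes>\<^sub>M (borel :: (real ^ 'n ^ 'n) measure)).
          norm (fst p *v (snd p *v v)) \<le> \<delta> * op_norm (fst p) * norm (snd p *v v)} \<in> sets (borel \<Otimes>\<^sub>M borel)"
        by measurable
      moreover have "{p \<in> space ((borel :: (real ^ 'n ^ 'n) measure) \<Otimes>\<^sub>M (borel :: (real ^ 'n ^ 'n) measure)).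
          norm (fst p *v (snd p *v v)) \<le> \<delta> * op_norm (fst p) * norm (snd p *v v)} = bad"
        by (auto simp: bad_def space_pair_measure)
      ultimately show ?thesis by simp
    qed
    define U where "U B T = ennreal (c1 + D * ln (op_norm T)) + ennreal (D / \<gamma> * exp (- y)) * ennreal (op_norm (B ** T) powr \<gamma>) +
      ennreal (D / \<gamma> * y) * indicator bad (B, T)" for B T
    have [measurable]: "(\<lambda>p. fst p) \<in> measurable (?B \<Otimes>\<^sub>M ?T) borel"
      using measurable_compose[OF measurable_fst measurable_SL_law[OF lb measurable_ident]]
      by (simp add: id_def)
    have [measurable]: "(\<lambda>p. snd p) \<in> measurable (?B \<Otimes>\<^sub>M ?T) borel"
      using measurable_compose[OF measurable_snd measurable_SL_law[OF lr measurable_ident]]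
      by (simp add: id_def)
    have bad_meas: "(\<lambda>p. indicator bad p :: ennreal) \<in> borel_measurable (?B \<Otimes>\<^sub>M ?T)"
    proof -
      have "(\<lambda>p. (fst p, snd p)) \<in> measurable (?B \<Otimes>\<^sub>M ?T) (borel \<Otimes>\<^sub>M borel)" by measurable
      from measurable_compose[OF this borel_measurable_indicator[OF bad_sets]] show ?thesis by simp
    qed
    have "ennreal (\<integral>S. loss S \<partial>prod_law \<mu> m) = (\<integral>\<^sup>+S. ennreal (loss S) \<partial>prod_law \<mu> m)"
    proof (rule nn_integral_eq_integral[symmetric])
      show "integrable (prod_law \<mu> m) loss"
        unfolding loss_def[abs_def] using integrable_ln_op_norm[OF \<mu>] integrable_ln_norm[OF \<mu> v] by simp
      show "AE S in prod_law \<mu> m. 0 \<le> loss S"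
        by (rule AE_I2) (simp add: loss_nonneg SL_lawsD(3)[OF lm])
    qed
    also have "\<dots> = (\<integral>\<^sup>+T. (\<integral>\<^sup>+B. ennreal (loss (B ** T)) \<partial>?B) \<partial>?T)"
      using nn_integral_prod_law_add[OF K_SL[OF \<mu>], where h = "\<lambda>S. ennreal (loss S)" and n = r and m = "m - r"] m
      by (simp add: \<mu>'_def)
    also have "\<dots> \<le> (\<integral>\<^sup>+T. (\<integral>\<^sup>+B. U B T \<partial>?B) \<partial>?T)"
    proof (intro nn_integral_mono)
      fix T B assume "T \<in> space ?T" "B \<in> space ?B"
      then have B: "B \<in> SL" and T: "T \<in> SL" by (simp_all add: SL_lawsD(3)[OF lr] SL_lawsD(3)[OF lb])
      have n: "0 \<le> c1 + D * ln (op_norm T)" "0 \<le> D / \<gamma> * exp (- y)" "0 \<le> D / \<gamma> * y"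
        using c1 D1 ln_op_norm_nonneg[OF T] \<gamma>_pos y by auto
      have "ennreal (loss (B ** T)) \<le> ennreal ((c1 + D * ln (op_norm T) + D / \<gamma> * exp (- y) * op_norm (B ** T) powr \<gamma>) +
        D / \<gamma> * y * indicator bad (B, T))" by (intro ennreal_leI loss_le B T)
      also have "\<dots> = U B T"
        unfolding U_def using n by (subst ennreal_add_mult) (simp_all add: ennreal_indicator)
      finally show "ennreal (loss (B ** T)) \<le> U B T" .
    qed
    also have "\<dots> = (\<integral>\<^sup>+p. U (fst p) (snd p) \<partial>(?B \<Otimes>\<^sub>M ?T))"
    proof -
      have "(\<lambda>p. U (fst p) (snd p)) \<in> borel_measurable (?B \<Otimes>\<^sub>M ?T)"
        unfolding U_def using bad_meas by simp
      from nn_integral_snd[OF this] show ?thesis by simp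
    qed
    also have "\<dots> = (\<integral>\<^sup>+p. ennreal (c1 + D * ln (op_norm (snd p))) \<partial>(?B \<Otimes>\<^sub>M ?T)) +
        ennreal (D / \<gamma> * exp (- y)) * (\<integral>\<^sup>+p. ennreal (op_norm (fst p ** snd p) powr \<gamma>) \<partial>(?B \<Otimes>\<^sub>M ?T)) +
        ennreal (D / \<gamma> * y) * (\<integral>\<^sup>+p. indicator bad p \<partial>(?B \<Otimes>\<^sub>M ?T))"
      unfolding U_def using bad_meas by (simp add: nn_integral_add nn_integral_cmult)
    also have "\<dots> \<le> ennreal (c1 + D * (C ^ r / \<gamma>)) + ennreal (D / \<gamma> * exp (- y)) * ennreal (C ^ m) +
        ennreal (D / \<gamma> * y) * ennreal \<eta>"
    proof (intro add_mono mult_left_mono)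
      have "(\<integral>\<^sup>+p. ennreal (c1 + D * ln (op_norm (snd p))) \<partial>(?B \<Otimes>\<^sub>M ?T)) =
          (\<integral>\<^sup>+T. (\<integral>\<^sup>+B. ennreal (c1 + D * ln (op_norm T)) \<partial>?B) \<partial>?T)"
        by (subst nn_integral_snd[symmetric]) simp_all
      also have "\<dots> = (\<integral>\<^sup>+T. ennreal (c1 + D * ln (op_norm T)) \<partial>?T)"
        by (simp add: B.emeasure_space_1)
      also have "\<dots> = ennreal (\<integral>T. c1 + D * ln (op_norm T) \<partial>?T)"
      proof (rule nn_integral_eq_integral)
        show "integrable ?T (\<lambda>T. c1 + D * ln (op_norm T))" using integrable_ln_op_norm[OF \<mu>] by simp
        show "AE T in ?T. 0 \<le> c1 + D * ln (op_norm T)"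
          by (rule AE_I2)
            (use c1 D1 ln_op_norm_nonneg in \<open>auto simp: SL_lawsD(3)[OF lr] intro!: add_nonneg_nonneg mult_nonneg_nonneg\<close>)
      qed
      also have "(\<integral>T. c1 + D * ln (op_norm T) \<partial>?T) = c1 + D * (\<integral>T. ln (op_norm T) \<partial>?T)"
        using integrable_ln_op_norm[OF \<mu>] by (simp add: T.prob_space)
      also have "ennreal \<dots> \<le> ennreal (c1 + D * (C ^ r / \<gamma>))"
      proof -
        have "(\<integral>T. ln (op_norm T) \<partial>?T) \<le> (\<integral>T. op_norm T powr \<gamma> / \<gamma> \<partial>?T)"
        proof (rule integral_mono[OF integrable_ln_op_norm[OF \<mu>]])
          show "integrable ?T (\<lambda>T. op_norm T powr \<gamma> / \<gamma>)"
            using integrable_op_norm_powr(1)[where t = \<gamma> and n = r, OF \<mu>] \<gamma>_pos by simp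
          show "ln (op_norm T) \<le> op_norm T powr \<gamma> / \<gamma>" if "T \<in> space ?T" for T
            using that by (intro ln_powr_bound one_le_op_norm_SL \<gamma>_pos) (simp add: SL_lawsD(3)[OF lr])
        qed
        also have "\<dots> \<le> C ^ r / \<gamma>"
          using integrable_op_norm_powr(2)[where t = \<gamma> and n = r, OF \<mu>] \<gamma>_pos by (simp add: divide_right_mono)
        finally show ?thesis using D1 by (intro ennreal_leI add_left_mono mult_left_mono) auto
      qed
      finally show "(\<integral>\<^sup>+p. ennreal (c1 + D * ln (op_norm (snd p))) \<partial>(?B \<Otimes>\<^sub>M ?T)) \<le> ennreal (c1 + D * (C ^ r / \<gamma>))" .
      have "(\<integral>\<^sup>+p. ennreal (op_norm (fst p ** snd p) powr \<gamma>) \<partial>(?B \<Otimes>\<^sub>M ?T)) =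
          (\<integral>\<^sup>+T. (\<integral>\<^sup>+B. ennreal (op_norm (B ** T) powr \<gamma>) \<partial>?B) \<partial>?T)"
        by (subst nn_integral_snd[symmetric]) simp_all
      also have "\<dots> = (\<integral>\<^sup>+S. ennreal (op_norm S powr \<gamma>) \<partial>prod_law \<mu> m)"
        using nn_integral_prod_law_add[OF K_SL[OF \<mu>], where h = "\<lambda>S. ennreal (op_norm S powr \<gamma>)" and n = r and m = "m - r"] m
        by (simp add: \<mu>'_def)
      also have "\<dots> \<le> ennreal (C ^ m)" by (rule moment_prod_law[OF \<mu>])
      finally show "(\<integral>\<^sup>+p. ennreal (op_norm (fst p ** snd p) powr \<gamma>) \<partial>(?B \<Otimes>\<^sub>M ?T)) \<le> ennreal (C ^ m)" .
      have "(\<integral>\<^sup>+p. indicator bad p \<partial>(?B \<Otimes>\<^sub>M ?T)) = (\<integral>\<^sup>+B. (\<integral>\<^sup>+T. indicator bad (B, T) \<partial>?T) \<partial>?B)"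
        using bad_meas by (rule T.nn_integral_fst[symmetric])
      also have "\<dots> \<le> (\<integral>\<^sup>+B. ennreal \<eta> \<partial>?B)"
      proof (rule nn_integral_mono)
        fix B assume "B \<in> space ?B"
        then have B: "B \<in> SL" by (simp add: SL_lawsD(3)[OF lb])
        let ?E = "{T \<in> SL. norm (B *v (T *v v)) \<le> \<delta> * op_norm B * norm (T *v v)}"
        have E: "?E \<in> sets ?T"
        proof -
          have "(\<lambda>T. norm (B *v (T *v v)) - \<delta> * op_norm B * norm (T *v v)) \<in> borel_measurable ?T"
            by (rule measurable_SL_law[OF lr]) measurable
          then have "{T \<in> space ?T. norm (B *v (T *v v)) - \<delta> * op_norm B * norm (T *v v) \<le> 0} \<in> sets ?T"
            by measurable
          then show ?thesis by (simp add: SL_lawsD(3)[OF lr])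
        qed
        have "(\<integral>\<^sup>+T. indicator bad (B, T) \<partial>?T) = (\<integral>\<^sup>+T. indicator ?E T \<partial>?T)"
          by (rule nn_integral_cong) (simp add: bad_def indicator_def SL_lawsD(3)[OF lr])
        also have "\<dots> = ennreal (measure ?T ?E)" using E by (simp add: T.emeasure_eq_measure)
        also have "\<dots> \<le> ennreal \<eta>" using small[OF _ v0 B] \<mu> by (intro ennreal_leI) blast
        finally show "(\<integral>\<^sup>+T. indicator bad (B, T) \<partial>?T) \<le> ennreal \<eta>" .
      qed
      also have "\<dots> = ennreal \<eta>" by (simp add: B.emeasure_space_1)
      finally show "(\<integral>\<^sup>+p. indicator bad p \<partial>(?B \<Otimes>\<^sub>M ?T)) \<le> ennreal \<eta>" .
    qed simp_all
    also have "\<dots> = ennreal (c1 + D * (C ^ r / \<gamma>) + D / \<gamma> * exp (- y) * C ^ m + D / \<gamma> * y * \<eta>)"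
      by (rule ennreal_add_mult[symmetric]) (use c1 D1 \<gamma>_pos C y \<eta> in auto)
    finally have "(\<integral>S. loss S \<partial>prod_law \<mu> m) \<le> c1 + D * (C ^ r / \<gamma>) + D / \<gamma> * exp (- y) * C ^ m + D / \<gamma> * y * \<eta>"
      using c1 D1 \<gamma>_pos C y \<eta> by (subst (asm) ennreal_le_iff) auto
    also have "D / \<gamma> * exp (- y) * C ^ m = D / \<gamma>"
      using C by (simp add: exp_minus exp_y)
    also have "c1 + D * (C ^ r / \<gamma>) + D / \<gamma> + D / \<gamma> * y * \<eta> = Q + real m * (D * ln C / \<gamma> * \<eta>)"
      by (simp add: Q_def y_def algebra_simps)
    also have "(\<integral>S. loss S \<partial>prod_law \<mu> m) = expected_log_norm \<mu> m - (\<integral>T. ln (norm (T *v v)) \<partial>prod_law \<mu> m)"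
      unfolding loss_def expected_log_norm_eq[OF \<mu>]
      using integrable_ln_op_norm[OF \<mu>] integrable_ln_norm[OF \<mu> v] by simp
    finally show ?thesis .
  qed
  then show ?thesis unfolding D_def by (intro exI[of _ Q] exI[of _ r]) blast
qed

section \<open>Moment bounds for long products\<close>

definition norm_moment_le :: "(nat \<Rightarrow> (real ^ 'n ^ 'n) measure) \<Rightarrow> nat \<Rightarrow> real \<Rightarrow> real \<Rightarrow> bool" where
  "norm_moment_le \<mu> n t a \<longleftrightarrow> (\<integral>\<^sup>+T. ennreal (op_norm T powr t) \<partial>prod_law \<mu> n) \<le> ennreal a"

text \<open>Uniformity in \<open>v\<close> and the factor \<open>norm v powr - t\<close> allow the bound for one block to be applied to the
  random vector that the preceding blocks produce.\<close>

definition inverse_moment_le :: "(nat \<Rightarrow> (real ^ 'n ^ 'n) measure) \<Rightarrow> nat \<Rightarrow> real \<Rightarrow> real \<Rightarrow> bool" where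
  "inverse_moment_le \<mu> n t a \<longleftrightarrow> (\<forall>v. v \<noteq> 0 \<longrightarrow>
     (\<integral>\<^sup>+T. ennreal (norm (T *v v) powr - t) \<partial>prod_law \<mu> n) \<le> ennreal (a * norm v powr - t))"

lemma norm_moment_le_add:
  fixes \<mu> :: "nat \<Rightarrow> (real ^ 'n ^ 'n) measure"
  assumes \<mu>: "\<And>i. \<mu> i \<in> SL_laws" and t: "0 \<le> t" and ab: "0 \<le> a" "0 \<le> b"
    and "norm_moment_le \<mu> n t a" "norm_moment_le (\<lambda>i. \<mu> (n + i)) m t b"
  shows "norm_moment_le \<mu> (n + m) t (a * b)"
proof -
  let ?B = "prod_law (\<lambda>i. \<mu> (n + i)) m" and ?T = "prod_law \<mu> n"
  note lb = prod_law_SL[of "\<lambda>i. \<mu> (n + i)", OF \<mu>, where n = m]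
  note lt = prod_law_SL[of \<mu>, OF \<mu>, where n = n]
  have "(\<integral>\<^sup>+T. ennreal (op_norm T powr t) \<partial>prod_law \<mu> (n + m)) =
      (\<integral>\<^sup>+T. (\<integral>\<^sup>+B. ennreal (op_norm (B ** T) powr t) \<partial>?B) \<partial>?T)"
    by (rule nn_integral_prod_law_add[OF \<mu>]) measurable
  also have "\<dots> \<le> (\<integral>\<^sup>+T. ennreal b * ennreal (op_norm T powr t) \<partial>?T)"
  proof (rule nn_integral_mono)
    fix T :: "real ^ 'n ^ 'n"
    have "(\<integral>\<^sup>+B. ennreal (op_norm (B ** T) powr t) \<partial>?B) \<le>
        (\<integral>\<^sup>+B. ennreal (op_norm B powr t) * ennreal (op_norm T powr t) \<partial>?B)"
      using t op_norm_nonneg op_norm_mult_le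
      by (intro nn_integral_mono)
        (auto simp: ennreal_mult[symmetric] powr_mult[symmetric] intro!: ennreal_leI powr_mono2)
    also have "\<dots> = (\<integral>\<^sup>+B. ennreal (op_norm B powr t) \<partial>?B) * ennreal (op_norm T powr t)"
      by (rule nn_integral_multc) (rule measurable_SL_law[OF lb], measurable)
    also have "\<dots> \<le> ennreal b * ennreal (op_norm T powr t)"
      using assms(6) by (intro mult_right_mono) (auto simp: norm_moment_le_def)
    finally show "(\<integral>\<^sup>+B. ennreal (op_norm (B ** T) powr t) \<partial>?B) \<le> ennreal b * ennreal (op_norm T powr t)" .
  qed
  also have "\<dots> = ennreal b * (\<integral>\<^sup>+T. ennreal (op_norm T powr t) \<partial>?T)"
    by (rule nn_integral_cmult) (rule measurable_SL_law[OF lt], measurable)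
  also have "\<dots> \<le> ennreal b * ennreal a"
    using assms(5) by (intro mult_left_mono) (auto simp: norm_moment_le_def)
  finally show ?thesis
    using ab by (simp add: norm_moment_le_def ennreal_mult[symmetric] mult.commute)
qed

lemma inverse_moment_le_add:
  fixes \<mu> :: "nat \<Rightarrow> (real ^ 'n ^ 'n) measure"
  assumes \<mu>: "\<And>i. \<mu> i \<in> SL_laws" and ab: "0 \<le> a" "0 \<le> b"
    and "inverse_moment_le \<mu> n t a" "inverse_moment_le (\<lambda>i. \<mu> (n + i)) m t b"
  shows "inverse_moment_le \<mu> (n + m) t (a * b)"
  unfolding inverse_moment_le_def
proof (intro allI impI)
  fix v :: "real ^ 'n" assume v: "v \<noteq> 0"
  let ?B = "prod_law (\<lambda>i. \<mu> (n + i)) m" and ?T = "prod_law \<mu> n"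
  note lt = prod_law_SL[of \<mu>, OF \<mu>, where n = n]
  have "(\<integral>\<^sup>+T. ennreal (norm (T *v v) powr - t) \<partial>prod_law \<mu> (n + m)) =
      (\<integral>\<^sup>+T. (\<integral>\<^sup>+B. ennreal (norm ((B ** T) *v v) powr - t) \<partial>?B) \<partial>?T)"
    by (rule nn_integral_prod_law_add[OF \<mu>]) measurable
  also have "\<dots> \<le> (\<integral>\<^sup>+T. ennreal b * ennreal (norm (T *v v) powr - t) \<partial>?T)"
  proof (rule nn_integral_mono)
    fix T assume "T \<in> space ?T"
    then have "T *v v \<noteq> 0" using v SL_mult_eq_0_iff[of T v] by (simp add: SL_lawsD(3)[OF lt])
    with assms(5) have "(\<integral>\<^sup>+B. ennreal (norm (B *v (T *v v)) powr - t) \<partial>?B) \<le> ennreal (b * norm (T *v v) powr - t)"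
      unfolding inverse_moment_le_def by blast
    then show "(\<integral>\<^sup>+B. ennreal (norm ((B ** T) *v v) powr - t) \<partial>?B) \<le> ennreal b * ennreal (norm (T *v v) powr - t)"
      using ab by (simp add: matrix_vector_mul_assoc ennreal_mult)
  qed
  also have "\<dots> = ennreal b * (\<integral>\<^sup>+T. ennreal (norm (T *v v) powr - t) \<partial>?T)"
    by (rule nn_integral_cmult) (rule measurable_SL_law[OF lt], measurable)
  also have "\<dots> \<le> ennreal b * ennreal (a * norm v powr - t)"
    using assms(4) v by (intro mult_left_mono) (auto simp: inverse_moment_le_def)
  also have "\<dots> = ennreal (a * b * norm v powr - t)"
    using ab by (simp add: ennreal_mult[symmetric] mult_ac)
  finally show "(\<integral>\<^sup>+T. ennreal (norm (T *v v) powr - t) \<partial>prod_law \<mu> (n + m)) \<le> ennreal (a * b * norm v powr - t)" .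
qed

context strongly_irreducible
begin

text \<open>First choose the length \<open>m\<close> so large that along every vector at most \<open>\<epsilon> * m\<close> of the expected
  logarithm is lost; only then choose \<open>t\<close>, depending on \<open>m\<close>, so small that the quadratic term in the
  exponential moments is at most \<open>t * \<epsilon> * m\<close>. It adds \<open>\<epsilon> * m\<close> to both rates.\<close>

lemma block_moments:
  assumes ne: "K \<noteq> {}" and \<epsilon>: "0 < \<epsilon>"
  shows "\<exists>m\<ge>1. \<exists>t>0. real CARD('n) * t \<le> \<gamma> \<and> (\<forall>\<mu>. (\<forall>i. \<mu> i \<in> K) \<longrightarrow>
    norm_moment_le \<mu> m t (exp (t * (expected_log_norm \<mu> m + \<epsilon> * real m))) \<and>
    inverse_moment_le \<mu> m t (exp (- t * (expected_log_norm \<mu> m - 2 * \<epsilon> * real m))))"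
proof -
  have C: "1 \<le> C" using ne C_ge_1 by blast
  define D where "D = real CARD('n)"
  have D1: "1 \<le> D" by (simp add: D_def Suc_leI)
  have D2: "real (CARD('n) - 1) = D - 1" by (simp add: D_def of_nat_diff Suc_leI)
  obtain c where c: "1 \<le> c"
    "\<And>T (v :: real ^ 'n). T \<in> SL \<Longrightarrow> norm v = 1 \<Longrightarrow> ln (norm (T *v v)) \<le> ln (op_norm T)"
    "\<And>T (v :: real ^ 'n). T \<in> SL \<Longrightarrow> norm v = 1 \<Longrightarrow>
      - ln (norm (T *v v)) \<le> ln c + real (CARD('n) - 1) * ln (op_norm T)"
    using ln_norm_SL_bounds[where 'n = 'n] by blast
  have lnC: "0 \<le> ln C" using C by simp
  \<comment> \<open>The summand 1 only keeps \<open>L\<close> positive when \<open>C = 1\<close>. With this \<open>\<eta>\<close> the rate of \<open>loss_bound\<close> is at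
    most \<open>\<epsilon> / 2\<close>; the other half absorbs the constant \<open>Q\<close>.\<close>
  define L where "L = ln C + 1"
  have L: "0 < L" "ln C / L \<le> 1" using lnC by (auto simp: L_def)
  define \<eta> where "\<eta> = \<epsilon> / 2 * (\<gamma> / (D * L))"
  have \<eta>: "0 < \<eta>" using \<epsilon> \<gamma>_pos D1 L by (simp add: \<eta>_def)
  have "D * ln C / \<gamma> * \<eta> = \<epsilon> / 2 * (ln C / L)"
    using D1 \<gamma>_pos L by (simp add: \<eta>_def field_simps)
  also have "\<dots> \<le> \<epsilon> / 2 * 1" using \<epsilon> L by (intro mult_left_mono) auto
  finally have rate: "D * ln C / \<gamma> * \<eta> \<le> \<epsilon> / 2" by simp
  from loss_bound[OF ne \<eta>] obtain Q r where loss: "\<And>\<mu> v m. (\<forall>i. \<mu> i \<in> K) \<Longrightarrow> norm v = 1 \<Longrightarrow> r \<le> m \<Longrightarrow>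
    expected_log_norm \<mu> m - (\<integral>T. ln (norm (T *v v)) \<partial>prod_law \<mu> m) \<le> Q + real m * (D * ln C / \<gamma> * \<eta>)"
    unfolding D_def by blast
  define m where "m = max (max 1 r) (nat \<lceil>2 * Q / \<epsilon>\<rceil>)"
  have m: "1 \<le> m" "r \<le> m" "2 * Q / \<epsilon> \<le> real m" unfolding m_def by linarith+
  have Q: "Q \<le> \<epsilon> / 2 * real m" using m(3) \<epsilon> by (simp add: field_simps)
  have loss': "expected_log_norm \<mu> m - \<epsilon> * real m \<le> (\<integral>T. ln (norm (T *v v)) \<partial>prod_law \<mu> m)"
    if "\<forall>i. \<mu> i \<in> K" "norm v = 1" for \<mu> v
  proof -
    have "real m * (D * ln C / \<gamma> * \<eta>) \<le> real m * (\<epsilon> / 2)" by (intro mult_left_mono rate) simp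
    moreover have "real m * (\<epsilon> / 2) + \<epsilon> / 2 * real m = \<epsilon> * real m" by simp
    ultimately show ?thesis using loss[OF that m(2)] Q by linarith
  qed
  \<comment> \<open>\<open>\<bar>ln (norm (T *v v))\<bar>\<close> is at most a constant plus \<open>D * ln (op_norm T)\<close>, so its exponential moment
    of order \<open>\<gamma> / D\<close> is controlled by the moment of order \<open>\<gamma>\<close> of the norm.\<close>
  define \<sigma> where "\<sigma> = \<gamma> / D"
  have \<sigma>: "0 < \<sigma>" "\<sigma> \<le> \<gamma>" "\<sigma> * D = \<gamma>" using \<gamma>_pos D1 by (auto simp: \<sigma>_def field_simps)
  define B where "B = c powr \<sigma> * C ^ m"
  have cs: "1 \<le> c powr \<sigma>" using c(1) \<sigma>(1) by (intro ge_one_powr_ge_zero) auto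
  have Cm: "1 \<le> C ^ m" using C by (rule one_le_power)
  have B: "C ^ m \<le> B" using mult_right_mono[OF cs, of "C ^ m"] Cm by (simp add: B_def)
  with Cm have B0: "0 < B" by linarith
  define t where "t = min (\<sigma> / 2) (\<epsilon> * real m * \<sigma>\<^sup>2 / (8 * B))"
  have t: "0 < t" "t \<le> \<sigma> / 2" using \<sigma>(1) \<epsilon> m(1) B0 by (auto simp: t_def)
  have "t \<le> \<epsilon> * real m * \<sigma>\<^sup>2 / (8 * B)" by (simp add: t_def)
  then have tB: "t * (8 / \<sigma>\<^sup>2) * B \<le> \<epsilon> * real m" using \<sigma>(1) B0 by (simp add: field_simps)
  have quad: "t\<^sup>2 * (8 / \<sigma>\<^sup>2) * B \<le> t * (\<epsilon> * real m)"
    using mult_left_mono[OF tB, of t] t(1) by (simp add: power2_eq_square mult.assoc)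
  have Dt: "D * t \<le> \<gamma>"
  proof -
    have "D * t \<le> D * \<sigma>" using t \<sigma>(1) D1 by (intro mult_left_mono) auto
    then show ?thesis using \<sigma>(3) by (simp add: mult.commute)
  qed
  have "norm_moment_le \<mu> m t (exp (t * (expected_log_norm \<mu> m + \<epsilon> * real m))) \<and>
      inverse_moment_le \<mu> m t (exp (- t * (expected_log_norm \<mu> m - 2 * \<epsilon> * real m)))"
    if \<mu>: "\<And>i. \<mu> i \<in> K" for \<mu>
  proof
    let ?P = "prod_law \<mu> m"
    note l = prod_law_SL[OF K_SL[OF \<mu>], where n = m]
    interpret prob_space ?P by (rule SL_lawsD[OF l])
    have SL: "T \<in> SL" if "T \<in> space ?P" for T using that by (simp add: SL_lawsD(3)[OF l])
    let ?W = "\<lambda>T :: real ^ 'n ^ 'n. ln (op_norm T)"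
    have W: "integrable ?P ?W" by (rule integrable_ln_op_norm[OF \<mu>])
    have eq: "exp (\<sigma> * \<bar>?W T\<bar>) = op_norm T powr \<sigma>" "exp (t * ?W T) = op_norm T powr t" if "T \<in> space ?P" for T
      using one_le_op_norm_SL[OF SL[OF that]] ln_op_norm_nonneg[OF SL[OF that]] by (auto simp: powr_def)
    have int: "integrable ?P (\<lambda>T. exp (\<sigma> * \<bar>?W T\<bar>))"
      using integrable_op_norm_powr(1)[where t = \<sigma> and n = m, OF \<mu>] \<sigma>
      by (subst Bochner_Integration.integrable_cong[OF refl eq(1)]) auto
    have intB: "(\<integral>T. exp (\<sigma> * \<bar>?W T\<bar>) \<partial>?P) \<le> B"
    proof -
      have "(\<integral>T. op_norm T powr \<sigma> \<partial>?P) \<le> B"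
        by (rule order_trans[OF integrable_op_norm_powr(2)[OF \<mu>] B]) (use \<sigma> in auto)
      then show ?thesis by (subst Bochner_Integration.integral_cong[OF refl eq(1)]) auto
    qed
    note em = exp_moment_le[OF W \<sigma>(1) int intB less_imp_le[OF t(1)] t(2)]
    have "(\<integral>\<^sup>+T. ennreal (op_norm T powr t) \<partial>?P) = (\<integral>\<^sup>+T. ennreal (exp (t * ?W T)) \<partial>?P)"
      by (rule nn_integral_cong) (simp add: eq(2))
    also have "\<dots> = ennreal (\<integral>T. exp (t * ?W T) \<partial>?P)"
      by (rule nn_integral_eq_integral[OF em(1)]) simp
    also have "\<dots> \<le> ennreal (exp (t * (expected_log_norm \<mu> m + \<epsilon> * real m)))"
      using em(2) quad by (intro ennreal_leI) (auto simp: expected_log_norm_eq[OF \<mu>] distrib_left elim!: order_trans)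
    finally show "norm_moment_le \<mu> m t (exp (t * (expected_log_norm \<mu> m + \<epsilon> * real m)))"
      by (simp add: norm_moment_le_def)
    have unit: "(\<integral>\<^sup>+T. ennreal (norm (T *v v) powr - t) \<partial>?P) \<le> ennreal (exp (- t * (expected_log_norm \<mu> m - 2 * \<epsilon> * real m)))"
      if v: "norm v = 1" for v
    proof -
      let ?V = "\<lambda>T. - ln (norm (T *v v))"
      have V: "integrable ?P ?V" using integrable_ln_norm[OF \<mu> v] by simp
      have abs: "exp (\<sigma> * \<bar>?V T\<bar>) \<le> c powr \<sigma> * op_norm T powr \<gamma>" if "T \<in> space ?P" for T
      proof -
        note T = SL[OF that]
        have "\<bar>?V T\<bar> \<le> ln c + D * ln (op_norm T)"
        proof -
          have "0 \<le> ln c" using c(1) by simp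
          moreover have "0 \<le> (D - 1) * ln (op_norm T)" using D1 ln_op_norm_nonneg[OF T] by simp
          ultimately show ?thesis
            using c(2,3)[OF T v] ln_op_norm_nonneg[OF T] unfolding D2 by (simp add: algebra_simps abs_le_iff)
        qed
        then have "\<sigma> * \<bar>?V T\<bar> \<le> \<sigma> * (ln c + D * ln (op_norm T))" using \<sigma>(1) by (intro mult_left_mono) auto
        also have "\<dots> = \<sigma> * ln c + \<gamma> * ln (op_norm T)" using \<sigma>(3) by (simp add: algebra_simps)
        finally have "exp (\<sigma> * \<bar>?V T\<bar>) \<le> exp (\<sigma> * ln c + \<gamma> * ln (op_norm T))" by simp
        also have "\<dots> = c powr \<sigma> * op_norm T powr \<gamma>"
          using c(1) one_le_op_norm_SL[OF T] by (auto simp: exp_add powr_def)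
        finally show ?thesis .
      qed
      have big: "integrable ?P (\<lambda>T. c powr \<sigma> * op_norm T powr \<gamma>)"
        using integrable_op_norm_powr(1)[where t = \<gamma> and n = m, OF \<mu>] \<gamma>_pos by simp
      have int: "integrable ?P (\<lambda>T. exp (\<sigma> * \<bar>?V T\<bar>))"
      proof (rule Bochner_Integration.integrable_bound[OF big])
        show "(\<lambda>T. exp (\<sigma> * \<bar>?V T\<bar>)) \<in> borel_measurable ?P"
          by (rule measurable_SL_law[OF l]) measurable
        show "AE T in ?P. norm (exp (\<sigma> * \<bar>?V T\<bar>)) \<le> norm (c powr \<sigma> * op_norm T powr \<gamma>)"
          by (rule AE_I2) (use abs in simp)
      qed
      have "(\<integral>T. exp (\<sigma> * \<bar>?V T\<bar>) \<partial>?P) \<le> (\<integral>T. c powr \<sigma> * op_norm T powr \<gamma> \<partial>?P)"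
        by (rule integral_mono[OF int big abs])
      also have "\<dots> \<le> B"
        using integrable_op_norm_powr(2)[where t = \<gamma> and n = m, OF \<mu>] \<gamma>_pos
        by (simp add: B_def mult_left_mono)
      finally have intB: "(\<integral>T. exp (\<sigma> * \<bar>?V T\<bar>) \<partial>?P) \<le> B" .
      note em = exp_moment_le[OF V \<sigma>(1) int intB less_imp_le[OF t(1)] t(2)]
      have "(\<integral>\<^sup>+T. ennreal (norm (T *v v) powr - t) \<partial>?P) = (\<integral>\<^sup>+T. ennreal (exp (t * ?V T)) \<partial>?P)"
      proof (rule nn_integral_cong)
        fix T assume "T \<in> space ?P"
        then have "T *v v \<noteq> 0" using SL_mult_sphere_neq_0[OF SL, of T v] v by simp
        then show "ennreal (norm (T *v v) powr - t) = ennreal (exp (t * ?V T))" by (simp add: powr_def)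
      qed
      also have "\<dots> = ennreal (\<integral>T. exp (t * ?V T) \<partial>?P)"
        by (rule nn_integral_eq_integral[OF em(1)]) simp
      also have "\<dots> \<le> ennreal (exp (- t * (expected_log_norm \<mu> m - 2 * \<epsilon> * real m)))"
      proof (rule ennreal_leI)
        have "(\<integral>T. ?V T \<partial>?P) \<le> - (expected_log_norm \<mu> m - \<epsilon> * real m)"
          using loss'[of \<mu> v] \<mu> v integrable_ln_norm[OF \<mu> v] by simp
        then have "t * (\<integral>T. ?V T \<partial>?P) \<le> t * - (expected_log_norm \<mu> m - \<epsilon> * real m)"
          using t(1) by (intro mult_left_mono) auto
        with quad have "t * (\<integral>T. ?V T \<partial>?P) + t\<^sup>2 * (8 / \<sigma>\<^sup>2) * B \<le> - t * (expected_log_norm \<mu> m - 2 * \<epsilon> * real m)"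
          by (simp add: algebra_simps)
        with em(2) show "(\<integral>T. exp (t * ?V T) \<partial>?P) \<le> exp (- t * (expected_log_norm \<mu> m - 2 * \<epsilon> * real m))"
          by (meson exp_le_cancel_iff order_trans)
      qed
      finally show ?thesis .
    qed
    show "inverse_moment_le \<mu> m t (exp (- t * (expected_log_norm \<mu> m - 2 * \<epsilon> * real m)))"
      unfolding inverse_moment_le_def
    proof (intro allI impI)
      fix v :: "real ^ 'n" assume v: "v \<noteq> 0"
      have scale: "norm (T *v v) powr - t = norm v powr - t * norm (T *v sgn v) powr - t" for T :: "real ^ 'n ^ 'n"
      proof -
        have "norm (T *v v) = norm v * norm (T *v sgn v)"
          using v by (simp add: sgn_div_norm matrix_vector_mult_scaleR)
        then show ?thesis by (simp add: powr_mult)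
      qed
      have "(\<integral>\<^sup>+T. ennreal (norm (T *v v) powr - t) \<partial>?P) =
          (\<integral>\<^sup>+T. ennreal (norm v powr - t) * ennreal (norm (T *v sgn v) powr - t) \<partial>?P)"
        unfolding scale by (simp add: ennreal_mult)
      also have "\<dots> = ennreal (norm v powr - t) * (\<integral>\<^sup>+T. ennreal (norm (T *v sgn v) powr - t) \<partial>?P)"
        by (rule nn_integral_cmult) (rule measurable_SL_law[OF l], measurable)
      also have "\<dots> \<le> ennreal (norm v powr - t) * ennreal (exp (- t * (expected_log_norm \<mu> m - 2 * \<epsilon> * real m)))"
        using v by (intro mult_left_mono unit) (auto simp: norm_sgn)
      finally show "(\<integral>\<^sup>+T. ennreal (norm (T *v v) powr - t) \<partial>?P) \<le>
          ennreal (exp (- t * (expected_log_norm \<mu> m - 2 * \<epsilon> * real m)) * norm v powr - t)"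
        by (simp add: ennreal_mult mult.commute)
    qed
  qed
  with m(1) t(1) Dt show ?thesis unfolding D_def by blast
qed

text \<open>The bounds of the blocks multiply, and \<open>\<beta>\<close> is the sum of the expected logarithms over the blocks. The
  fewer than \<open>m\<close> remaining factors cost only the constant \<open>E\<close>.\<close>

lemma long_moments:
  assumes ne: "K \<noteq> {}" and \<epsilon>: "0 < \<epsilon>"
  shows "\<exists>t>0. \<exists>E\<ge>1. \<forall>\<mu> n. (\<forall>i. \<mu> i \<in> K) \<longrightarrow> (\<exists>\<beta>.
    norm_moment_le \<mu> n t (E * exp (t * (\<beta> + \<epsilon> * real n))) \<and>
    inverse_moment_le \<mu> n t (E * exp (- t * (\<beta> - 2 * \<epsilon> * real n))))"
proof -
  have C: "1 \<le> C" using ne C_ge_1 by blast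
  obtain c where c: "1 \<le> c"
    "\<And>T (x :: real ^ 'n). T \<in> SL \<Longrightarrow> norm x \<le> c * op_norm T ^ (CARD('n) - 1) * norm (T *v x)"
    using ln_norm_SL_bounds[where 'n = 'n] by blast
  from block_moments[OF ne \<epsilon>] obtain m t where m: "1 \<le> m" and t: "0 < t" "real CARD('n) * t \<le> \<gamma>"
    and block: "\<And>\<mu>. (\<And>i. \<mu> i \<in> K) \<Longrightarrow> norm_moment_le \<mu> m t (exp (t * (expected_log_norm \<mu> m + \<epsilon> * real m)))"
      "\<And>\<mu>. (\<And>i. \<mu> i \<in> K) \<Longrightarrow> inverse_moment_le \<mu> m t (exp (- t * (expected_log_norm \<mu> m - 2 * \<epsilon> * real m)))"
    by blast
  define E where "E = c powr t * C ^ m"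
  have ct: "1 \<le> c powr t" using c(1) t(1) by (intro ge_one_powr_ge_zero) auto
  have Cm: "C ^ s \<le> C ^ m" if "s < m" for s using C that by (intro power_increasing) auto
  have E: "1 \<le> E" unfolding E_def using mult_mono[of 1 "c powr t" 1 "C ^ m"] ct one_le_power[OF C, of m] by simp
  have rest: "norm_moment_le \<mu> s t E" "inverse_moment_le \<mu> s t E" if \<mu>: "\<And>i. \<mu> i \<in> K" and s: "s < m" for \<mu> s
  proof -
    let ?P = "prod_law \<mu> s"
    note l = prod_law_SL[OF K_SL[OF \<mu>], where n = s]
    have mom: "(\<integral>\<^sup>+T. ennreal (op_norm T powr u) \<partial>?P) \<le> ennreal (C ^ m)" if u: "0 \<le> u" "u \<le> \<gamma>" for u
    proof -
      have "(\<integral>\<^sup>+T. ennreal (op_norm T powr u) \<partial>?P) = ennreal (\<integral>T. op_norm T powr u \<partial>?P)"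
        by (rule nn_integral_eq_integral) (use integrable_op_norm_powr(1)[where t = u and n = s, OF \<mu> u] in auto)
      also have "\<dots> \<le> ennreal (C ^ m)"
        by (intro ennreal_leI order_trans[OF integrable_op_norm_powr(2)[OF \<mu> u] Cm[OF s]])
      finally show ?thesis .
    qed
    have card: "1 \<le> real CARD('n)" by (simp add: Suc_leI)
    have "t \<le> real CARD('n) * t" using mult_right_mono[OF card, of t] t(1) by simp
    with t have "t \<le> \<gamma>" by linarith
    then have "(\<integral>\<^sup>+T. ennreal (op_norm T powr t) \<partial>?P) \<le> ennreal (C ^ m)" using t(1) by (intro mom) auto
    also have "\<dots> \<le> ennreal E"
      unfolding E_def using mult_right_mono[OF ct, of "C ^ m"] C by (intro ennreal_leI) simp
    finally show "norm_moment_le \<mu> s t E" by (simp add: norm_moment_le_def)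
    define u where "u = real (CARD('n) - 1) * t"
    have u: "0 \<le> u" "u \<le> \<gamma>"
      using t(1) order_trans[OF mult_right_mono t(2), of "real (CARD('n) - 1)"] by (auto simp: u_def)
    show "inverse_moment_le \<mu> s t E"
      unfolding inverse_moment_le_def
    proof (intro allI impI)
      fix v :: "real ^ 'n" assume v: "v \<noteq> 0"
      have "(\<integral>\<^sup>+T. ennreal (norm (T *v v) powr - t) \<partial>?P) \<le>
          (\<integral>\<^sup>+T. ennreal (c powr t * norm v powr - t) * ennreal (op_norm T powr u) \<partial>?P)"
      proof (rule nn_integral_mono)
        fix T assume "T \<in> space ?P"
        then have T: "T \<in> SL" by (simp add: SL_lawsD(3)[OF l])
        have o: "1 \<le> op_norm T" by (rule one_le_op_norm_SL[OF T])
        have p: "0 < norm (T *v v)" using v SL_mult_eq_0_iff[OF T, of v] by simp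
        have "norm v powr t \<le> (c * op_norm T ^ (CARD('n) - 1) * norm (T *v v)) powr t"
          using c(2)[OF T, of v] t(1) by (intro powr_mono2) auto
        also have "\<dots> = c powr t * op_norm T powr u * norm (T *v v) powr t"
        proof -
          have "(op_norm T ^ (CARD('n) - 1)) powr t = op_norm T powr u"
            unfolding u_def powr_powr[symmetric] using o by (subst powr_realpow) auto
          then show ?thesis using c(1) o by (simp only: powr_mult)
        qed
        finally have "norm (T *v v) powr - t \<le> c powr t * norm v powr - t * op_norm T powr u"
          using p v by (simp add: powr_minus field_simps)
        then show "ennreal (norm (T *v v) powr - t) \<le> ennreal (c powr t * norm v powr - t) * ennreal (op_norm T powr u)"
          by (simp add: ennreal_mult[symmetric] ennreal_leI)
      qed
      also have "\<dots> = ennreal (c powr t * norm v powr - t) * (\<integral>\<^sup>+T. ennreal (op_norm T powr u) \<partial>?P)"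
        by (rule nn_integral_cmult) (rule measurable_SL_law[OF l], measurable)
      also have "\<dots> \<le> ennreal (c powr t * norm v powr - t) * ennreal (C ^ m)"
        by (intro mult_left_mono mom u) simp
      also have "\<dots> = ennreal (E * norm v powr - t)"
        using C by (simp add: E_def ennreal_mult[symmetric] mult_ac)
      finally show "(\<integral>\<^sup>+T. ennreal (norm (T *v v) powr - t) \<partial>?P) \<le> ennreal (E * norm v powr - t)" .
    qed
  qed
  have "\<exists>\<beta>. norm_moment_le \<mu> n t (E * exp (t * (\<beta> + \<epsilon> * real n))) \<and>
      inverse_moment_le \<mu> n t (E * exp (- t * (\<beta> - 2 * \<epsilon> * real n)))" if \<mu>: "\<And>i. \<mu> i \<in> K" for \<mu> n
  proof -
    define b where "b j = expected_log_norm (\<lambda>i. \<mu> (j * m + i)) m" for j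
    define \<beta> where "\<beta> k = (\<Sum>j<k. b j)" for k
    have blocks: "norm_moment_le \<mu> (k * m) t (exp (t * (\<beta> k + \<epsilon> * real (k * m)))) \<and>
        inverse_moment_le \<mu> (k * m) t (exp (- t * (\<beta> k - 2 * \<epsilon> * real (k * m))))" for k
    proof (induction k)
      case 0
      have 1: "op_norm (mat 1 :: real ^ 'n ^ 'n) = 1"
      proof (rule antisym)
        show "op_norm (mat 1 :: real ^ 'n ^ 'n) \<le> 1" unfolding op_norm_def by (rule onorm_le) simp
      qed (rule one_le_op_norm_SL[OF SL_mat_1])
      show ?case
        unfolding norm_moment_le_def inverse_moment_le_def
        by (auto simp: nn_integral_prod_law_0[OF K_SL[OF \<mu>]] 1 \<beta>_def)
    next
      case (Suc k)
      have sm: "\<And>i. \<mu> (k * m + i) \<in> K" by (rule \<mu>)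
      have "norm_moment_le \<mu> (k * m + m) t (exp (t * (\<beta> k + \<epsilon> * real (k * m))) * exp (t * (b k + \<epsilon> * real m)))"
        by (rule norm_moment_le_add[OF K_SL[OF \<mu>]]) (use t Suc block(1)[OF sm] in \<open>auto simp: b_def\<close>)
      moreover have "inverse_moment_le \<mu> (k * m + m) t
          (exp (- t * (\<beta> k - 2 * \<epsilon> * real (k * m))) * exp (- t * (b k - 2 * \<epsilon> * real m)))"
        by (rule inverse_moment_le_add[OF K_SL[OF \<mu>]]) (use t Suc block(2)[OF sm] in \<open>auto simp: b_def\<close>)
      ultimately show ?case
        by (simp add: exp_add[symmetric] \<beta>_def algebra_simps)
    qed
    define k where "k = n div m"
    define s where "s = n mod m"
    have n: "n = k * m + s" and s: "s < m" using m by (auto simp: k_def s_def)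
    have km: "\<epsilon> * real (k * m) \<le> \<epsilon> * real n" using \<epsilon> n by (intro mult_left_mono) auto
    have sm: "\<And>i. \<mu> (k * m + i) \<in> K" by (rule \<mu>)
    have "norm_moment_le \<mu> (k * m + s) t (exp (t * (\<beta> k + \<epsilon> * real (k * m))) * E)"
      by (rule norm_moment_le_add[OF K_SL[OF \<mu>]]) (use t E blocks[of k] rest(1)[OF sm s] in auto)
    moreover have "exp (t * (\<beta> k + \<epsilon> * real (k * m))) * E \<le> E * exp (t * (\<beta> k + \<epsilon> * real n))"
      using t(1) E km by (auto intro!: mult_left_mono simp: mult.commute)
    ultimately have 1: "norm_moment_le \<mu> n t (E * exp (t * (\<beta> k + \<epsilon> * real n)))"
      unfolding norm_moment_le_def n[symmetric] by (meson ennreal_leI order_trans)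
    have inv: "inverse_moment_le \<mu> (k * m + s) t (exp (- t * (\<beta> k - 2 * \<epsilon> * real (k * m))) * E)"
      by (rule inverse_moment_le_add[OF K_SL[OF \<mu>]]) (use t E blocks[of k] rest(2)[OF sm s] in auto)
    have le: "exp (- t * (\<beta> k - 2 * \<epsilon> * real (k * m))) * E \<le> E * exp (- t * (\<beta> k - 2 * \<epsilon> * real n))"
    proof -
      have "- t * (\<beta> k - 2 * \<epsilon> * real (k * m)) \<le> - t * (\<beta> k - 2 * \<epsilon> * real n)"
        using mult_left_mono[OF km, of "2 * t"] t(1) by (simp add: algebra_simps)
      then show ?thesis using E by (auto intro!: mult_left_mono simp: mult.commute)
    qed
    have 2: "inverse_moment_le \<mu> n t (E * exp (- t * (\<beta> k - 2 * \<epsilon> * real n)))"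
      unfolding inverse_moment_le_def
    proof (intro allI impI)
      fix v :: "real ^ 'n" assume "v \<noteq> 0"
      with inv have "(\<integral>\<^sup>+T. ennreal (norm (T *v v) powr - t) \<partial>prod_law \<mu> n) \<le>
          ennreal (exp (- t * (\<beta> k - 2 * \<epsilon> * real (k * m))) * E * norm v powr - t)"
        unfolding inverse_moment_le_def n[symmetric] by blast
      also have "\<dots> \<le> ennreal (E * exp (- t * (\<beta> k - 2 * \<epsilon> * real n)) * norm v powr - t)"
        by (intro ennreal_leI mult_right_mono le) simp
      finally show "(\<integral>\<^sup>+T. ennreal (norm (T *v v) powr - t) \<partial>prod_law \<mu> n) \<le>
          ennreal (E * exp (- t * (\<beta> k - 2 * \<epsilon> * real n)) * norm v powr - t)" .
    qed
    from 1 2 show ?thesis by blast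
  qed
  with t(1) E show ?thesis by blast
qed

text \<open>The two moments of \<open>long_moments\<close> confine the logarithm of the norm to a window around \<open>\<beta>\<close>, up to
  exponentially small probability; the same moments confine its expectation to the same window, so \<open>\<beta>\<close>
  can be eliminated.\<close>

lemma log_norm_deviation:
  assumes ne: "K \<noteq> {}" and \<epsilon>: "0 < \<epsilon>"
  shows "\<exists>E t n0. 0 < t \<and> (\<forall>\<mu> n. (\<forall>i. \<mu> i \<in> K) \<longrightarrow> n0 \<le> n \<longrightarrow>
    measure (prod_law \<mu> n) {T \<in> SL. \<epsilon> * real n < \<bar>ln (op_norm T) - expected_log_norm \<mu> n\<bar>} \<le> E * exp (- t * real n))"
proof -
  \<comment> \<open>For large \<open>n\<close> the expectation lies between \<open>\<beta> - 3 * \<delta> * n\<close> and \<open>\<beta> + 2 * \<delta> * n\<close>, and so does the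
    random variable outside a small event; the window has length \<open>5 * \<delta> * n\<close>.\<close>
  define \<delta> where "\<delta> = \<epsilon> / 5"
  have \<delta>: "0 < \<delta>" "\<epsilon> = 5 * \<delta>" using \<epsilon> by (auto simp: \<delta>_def)
  from long_moments[OF ne \<delta>(1)] obtain t E where t: "0 < t" and E: "1 \<le> E"
    and mom: "\<And>\<mu> n. (\<forall>i. \<mu> i \<in> K) \<Longrightarrow> \<exists>\<beta>.
      norm_moment_le \<mu> n t (E * exp (t * (\<beta> + \<delta> * real n))) \<and>
      inverse_moment_le \<mu> n t (E * exp (- t * (\<beta> - 2 * \<delta> * real n)))"
    by blast
  define n0 where "n0 = nat \<lceil>ln E / t / \<delta>\<rceil>"
  have "measure (prod_law \<mu> n) {T \<in> SL. \<epsilon> * real n < \<bar>ln (op_norm T) - expected_log_norm \<mu> n\<bar>} \<le>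
      2 * E * exp (- (t * \<delta>) * real n)" if \<mu>: "\<And>i. \<mu> i \<in> K" and n: "n0 \<le> n" for \<mu> n
  proof -
    let ?P = "prod_law \<mu> n"
    note l = prod_law_SL[OF K_SL[OF \<mu>], where n = n]
    interpret prob_space ?P by (rule SL_lawsD[OF l])
    have sp: "space ?P = SL" by (rule SL_lawsD[OF l])
    from mom[of \<mu> n] \<mu> obtain \<beta> where \<beta>: "norm_moment_le \<mu> n t (E * exp (t * (\<beta> + \<delta> * real n)))"
      "inverse_moment_le \<mu> n t (E * exp (- t * (\<beta> - 2 * \<delta> * real n)))" by blast
    have "ln E / t / \<delta> \<le> real n" using n unfolding n0_def by linarith
    then have lnE: "ln E / t \<le> \<delta> * real n" using \<delta>(1) t by (simp add: field_simps)
    have \<delta>n: "0 \<le> \<delta> * real n" using \<delta>(1) by simp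
    let ?X = "\<lambda>T :: real ^ 'n ^ 'n. ln (op_norm T)"
    have X: "integrable ?P ?X" by (rule integrable_ln_op_norm[OF \<mu>])
    have EX: "expectation ?X = expected_log_norm \<mu> n" by (rule expected_log_norm_eq[OF \<mu>, symmetric])
    have bound: "integrable ?P f \<and> (\<integral>T. f T \<partial>?P) \<le> a"
      if "(\<integral>\<^sup>+T. ennreal (f T) \<partial>?P) \<le> ennreal a" "0 \<le> a" "f \<in> borel_measurable ?P" "\<And>T. 0 \<le> f T"
      for f :: "real ^ 'n ^ 'n \<Rightarrow> real" and a
    proof -
      have int: "integrable ?P f"
        using that le_less_trans[OF that(1) ennreal_less_top] by (intro integrableI_nonneg) auto
      have "ennreal (\<integral>T. f T \<partial>?P) \<le> ennreal a"
        using that(1) nn_integral_eq_integral[OF int] that(4) by simp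
      with int that(2) show ?thesis by (simp add: ennreal_le_iff)
    qed
    have m1: "(\<lambda>T. exp (t * ?X T)) \<in> borel_measurable ?P" by (rule measurable_SL_law[OF l]) measurable
    have m2: "(\<lambda>T. exp (t * - ?X T)) \<in> borel_measurable ?P" by (rule measurable_SL_law[OF l]) measurable
    have "(\<integral>\<^sup>+T. ennreal (exp (t * ?X T)) \<partial>?P) = (\<integral>\<^sup>+T. ennreal (op_norm T powr t) \<partial>?P)"
    proof (rule nn_integral_cong)
      fix T assume "T \<in> space ?P"
      then have "1 \<le> op_norm T" by (intro one_le_op_norm_SL) (simp add: sp)
      then show "ennreal (exp (t * ?X T)) = ennreal (op_norm T powr t)" by (auto simp: powr_def)
    qed
    also have "\<dots> \<le> ennreal (E * exp (t * (\<beta> + \<delta> * real n)))" using \<beta>(1) by (simp add: norm_moment_le_def)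
    finally have up: "integrable ?P (\<lambda>T. exp (t * ?X T))" "(\<integral>T. exp (t * ?X T) \<partial>?P) \<le> E * exp (t * (\<beta> + \<delta> * real n))"
      using bound[OF _ _ m1] E by auto
    \<comment> \<open>Any unit vector will do: following it bounds the norm from below.\<close>
    define e :: "real ^ 'n" where "e = axis undefined 1"
    have e: "norm e = 1" by (simp add: e_def)
    have "(\<integral>\<^sup>+T. ennreal (exp (t * - ?X T)) \<partial>?P) \<le> (\<integral>\<^sup>+T. ennreal (norm (T *v e) powr - t) \<partial>?P)"
    proof (rule nn_integral_mono)
      fix T assume "T \<in> space ?P"
      then have T: "T \<in> SL" by (simp add: sp)
      have p: "0 < norm (T *v e)" using SL_mult_sphere_neq_0[OF T, of e] e by simp
      have le: "norm (T *v e) \<le> op_norm T" using norm_matrix_vector_mult_le[of T e] e by simp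
      have "exp (t * - ?X T) = op_norm T powr - t" using one_le_op_norm_SL[OF T] by (auto simp: powr_def)
      also have "\<dots> \<le> norm (T *v e) powr - t" using p le t by (intro powr_mono2') auto
      finally show "ennreal (exp (t * - ?X T)) \<le> ennreal (norm (T *v e) powr - t)" by (rule ennreal_leI)
    qed
    also have "\<dots> \<le> ennreal (E * exp (- t * (\<beta> - 2 * \<delta> * real n)))"
    proof -
      have "e \<noteq> 0" using e by auto
      with \<beta>(2) have "(\<integral>\<^sup>+T. ennreal (norm (T *v e) powr - t) \<partial>?P) \<le>
          ennreal (E * exp (- t * (\<beta> - 2 * \<delta> * real n)) * norm e powr - t)"
        unfolding inverse_moment_le_def by blast
      then show ?thesis by (simp add: e)
    qed
    finally have "integrable ?P (\<lambda>T. exp (t * - ?X T))" "(\<integral>T. exp (t * - ?X T) \<partial>?P) \<le> E * exp (- t * (\<beta> - 2 * \<delta> * real n))"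
      using bound[OF _ _ m2] E by auto
    then have down: "integrable ?P (\<lambda>T. exp (t * - ?X T))" "(\<integral>T. exp (t * - ?X T) \<partial>?P) \<le> E * exp (t * - (\<beta> - 2 * \<delta> * real n))"
      by (simp_all only: mult_minus_left mult_minus_right)
    have E0: "0 < E" using E by linarith
    have nX: "integrable ?P (\<lambda>T. - ?X T)" using X by simp
    have upper: "expected_log_norm \<mu> n \<le> \<beta> + \<delta> * real n + ln E / t"
      using exp_moment_expectation_le[OF X t E0 up] by (simp add: EX)
    have lower: "- expected_log_norm \<mu> n \<le> - (\<beta> - 2 * \<delta> * real n) + ln E / t"
      using exp_moment_expectation_le[OF nX t E0 down] X by (simp add: EX)
    let ?A = "{T \<in> space ?P. \<beta> + \<delta> * real n + \<delta> * real n \<le> ?X T}"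
    let ?B = "{T \<in> space ?P. - (\<beta> - 2 * \<delta> * real n) + \<delta> * real n \<le> - ?X T}"
    have A: "?A \<in> sets ?P" "?B \<in> sets ?P"
      using borel_measurable_integrable[OF X] by measurable
    have "{T \<in> SL. \<epsilon> * real n < \<bar>?X T - expected_log_norm \<mu> n\<bar>} \<subseteq> ?A \<union> ?B"
    proof
      fix T assume T: "T \<in> {T \<in> SL. \<epsilon> * real n < \<bar>?X T - expected_log_norm \<mu> n\<bar>}"
      then have "5 * (\<delta> * real n) < \<bar>?X T - expected_log_norm \<mu> n\<bar>" by (simp add: \<delta>(2))
      then consider "5 * (\<delta> * real n) < ?X T - expected_log_norm \<mu> n" | "5 * (\<delta> * real n) < expected_log_norm \<mu> n - ?X T"
        by linarith
      then have "\<beta> + \<delta> * real n + \<delta> * real n \<le> ?X T \<or> - (\<beta> - 2 * \<delta> * real n) + \<delta> * real n \<le> - ?X T"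
      proof cases
        case 1
        with lower lnE \<delta>n have "\<beta> + \<delta> * real n + \<delta> * real n \<le> ?X T" by linarith
        then show ?thesis ..
      next
        case 2
        with upper lnE \<delta>n have "- (\<beta> - 2 * \<delta> * real n) + \<delta> * real n \<le> - ?X T" by linarith
        then show ?thesis ..
      qed
      with T show "T \<in> ?A \<union> ?B" by (auto simp: sp)
    qed
    then have "measure ?P {T \<in> SL. \<epsilon> * real n < \<bar>?X T - expected_log_norm \<mu> n\<bar>} \<le> measure ?P (?A \<union> ?B)"
      by (rule finite_measure_mono) (rule sets.Un[OF A])
    also have "\<dots> \<le> measure ?P ?A + measure ?P ?B" by (rule measure_Un_le[OF A])
    also have "\<dots> \<le> E * exp (- t * (\<delta> * real n)) + E * exp (- t * (\<delta> * real n))"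
      by (intro add_mono exp_moment_tail_le[OF X t E0 up] exp_moment_tail_le[OF nX t E0 down])
    also have "\<dots> = 2 * E * exp (- (t * \<delta>) * real n)" by (simp add: mult.assoc)
    finally show ?thesis .
  qed
  then show ?thesis using t \<delta>(1) by (intro exI[of _ "2 * E"] exI[of _ "t * \<delta>"] exI[of _ n0]) auto
qed

theorem log_norm_law_of_large_numbers:
  assumes \<mu>: "\<And>i. \<mu> i \<in> K"
  shows "AE A in (\<Pi>\<^sub>M i\<in>{1..}. \<mu> i).
    (\<lambda>n. 1 / real n * (ln (op_norm (mat_prod A n)) - expected_log_norm \<mu> n)) \<longlonglongrightarrow> 0"
proof -
  let ?P = "\<Pi>\<^sub>M i\<in>{1..}. \<mu> i"
  have ne: "K \<noteq> {}" using \<mu> by blast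
  interpret product_prob_space \<mu> "{1..}"
    by (rule product_prob_spaceI) (rule SL_lawsD[OF K_SL[OF \<mu>]])
  have meas: "(\<lambda>A. mat_prod A n) \<in> borel_measurable ?P" for n
    by (rule measurable_mat_prod) (use K_SL[OF \<mu>] in auto)
  have marginal: "P.prob {A \<in> space ?P. mat_prod A n \<in> X} = measure (prod_law \<mu> n) {T \<in> SL. T \<in> X}"
    if X: "X \<in> sets borel" for n and X :: "(real ^ 'n ^ 'n) set"
  proof -
    have fin: "(\<lambda>A. mat_prod A n) \<in> measurable (\<Pi>\<^sub>M i\<in>{1..n}. \<mu> i) (restrict_space borel SL)"
      using measurable_mat_prod[OF subset_refl K_SL[OF \<mu>]] mat_prod_in_SL[OF subset_refl K_SL[OF \<mu>]]
      by (intro measurable_restrict_space2) auto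
    have restr: "(\<lambda>A. restrict A {1..n}) \<in> measurable ?P (\<Pi>\<^sub>M i\<in>{1..n}. \<mu> i)"
      by (rule measurable_restrict_subset) auto
    have "prod_law \<mu> n = distr (distr ?P (\<Pi>\<^sub>M i\<in>{1..n}. \<mu> i) (\<lambda>A. restrict A {1..n})) (restrict_space borel SL) (\<lambda>A. mat_prod A n)"
      unfolding prod_law_def by (subst distr_PiM_restrict_finite) auto
    also have "\<dots> = distr ?P (restrict_space borel SL) (\<lambda>A. mat_prod (restrict A {1..n}) n)"
      by (rule distr_distr[OF fin restr, unfolded comp_def])
    also have "\<dots> = distr ?P (restrict_space borel SL) (\<lambda>A. mat_prod A n)"
      by (intro distr_cong refl mat_prod_cong) auto
    finally have law: "prod_law \<mu> n = distr ?P (restrict_space borel SL) (\<lambda>A. mat_prod A n)" .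
    have SL: "mat_prod A n \<in> SL" if "A \<in> space ?P" for A
      by (rule mat_prod_in_SL[OF _ _ that]) (use K_SL[OF \<mu>] in auto)
    have m: "(\<lambda>A. mat_prod A n) \<in> measurable ?P (restrict_space borel SL)"
      using meas SL by (intro measurable_restrict_space2) auto
    have "SL \<inter> X \<in> sets (restrict_space borel SL)" using X by (auto simp: sets_restrict_space)
    then have "measure (prod_law \<mu> n) (SL \<inter> X) = P.prob ((\<lambda>A. mat_prod A n) -` (SL \<inter> X) \<inter> space ?P)"
      unfolding law by (rule measure_distr[OF m])
    also have "(\<lambda>A. mat_prod A n) -` (SL \<inter> X) \<inter> space ?P = {A \<in> space ?P. mat_prod A n \<in> X}"
      using SL by auto
    finally show ?thesis by (simp add: Int_def)
  qed
  have ev: "AE A in ?P. eventually (\<lambda>n. \<bar>ln (op_norm (mat_prod A n)) - expected_log_norm \<mu> n\<bar> \<le> \<epsilon> * real n) sequentially"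
    if \<epsilon>: "0 < \<epsilon>" for \<epsilon>
  proof -
    from log_norm_deviation[OF ne \<epsilon>] obtain E t n0 where t: "0 < t"
      and dev: "\<And>n. n0 \<le> n \<Longrightarrow>
        measure (prod_law \<mu> n) {T \<in> SL. \<epsilon> * real n < \<bar>ln (op_norm T) - expected_log_norm \<mu> n\<bar>} \<le> E * exp (- t * real n)"
      using \<mu> by blast
    define X where "X n = {T :: real ^ 'n ^ 'n. \<epsilon> * real n < \<bar>ln (op_norm T) - expected_log_norm \<mu> n\<bar>}" for n
    have X: "X n \<in> sets borel" for n
    proof -
      have "{T \<in> space borel. \<epsilon> * real n < \<bar>ln (op_norm T) - expected_log_norm \<mu> n\<bar>} \<in> sets (borel :: (real ^ 'n ^ 'n) measure)"
        by measurable
      then show ?thesis by (simp add: X_def)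
    qed
    define bad where "bad n = {A \<in> space ?P. mat_prod A n \<in> X n}" for n
    have "AE A in ?P. eventually (\<lambda>n. A \<in> space ?P - bad n) sequentially"
    proof (rule borel_cantelli_AE1)
      show "bad n \<in> sets ?P" for n
        unfolding bad_def using measurable_sets[OF meas X, of n n] by (simp add: vimage_def Int_def conj_commute)
      show "emeasure ?P (bad n) < \<infinity>" for n using P.emeasure_finite[of "bad n"] by (simp add: less_top)
      show "summable (\<lambda>n. measure ?P (bad n))"
      proof (rule summable_comparison_test_ev)
        have "summable (\<lambda>n. exp (- t) ^ n)" using t by (intro summable_geometric) simp
        then have "summable (\<lambda>n. E * exp (- t) ^ n)" by (rule summable_mult)
        then show "summable (\<lambda>n. E * exp (- t * real n))"
          by (simp add: exp_of_nat_mult[symmetric] mult.commute)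
        show "eventually (\<lambda>n. norm (measure ?P (bad n)) \<le> E * exp (- t * real n)) sequentially"
          using eventually_ge_at_top[of n0]
        proof eventually_elim
          case (elim n)
          have "measure ?P (bad n) = measure (prod_law \<mu> n) {T \<in> SL. T \<in> X n}"
            unfolding bad_def by (rule marginal[OF X])
          also have "\<dots> \<le> E * exp (- t * real n)" using dev[OF elim] by (simp add: X_def)
          finally show ?case by simp
        qed
      qed
    qed
    then show ?thesis
    proof eventually_elim
      case (elim A)
      then show ?case
        by eventually_elim (auto simp: bad_def X_def not_less)
    qed
  qed
  have "AE A in ?P. \<forall>k. eventually (\<lambda>n. \<bar>ln (op_norm (mat_prod A n)) - expected_log_norm \<mu> n\<bar> \<le> 1 / real (Suc k) * real n) sequentially"
    unfolding AE_all_countable by (intro allI ev) simp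
  then show ?thesis
  proof eventually_elim
    case (elim A)
    show ?case
    proof (rule LIMSEQ_I)
      fix e :: real assume "0 < e"
      then obtain k where k: "1 / real (Suc k) < e" using nat_approx_posE by blast
      from elim have "eventually (\<lambda>n. \<bar>ln (op_norm (mat_prod A n)) - expected_log_norm \<mu> n\<bar> \<le> 1 / real (Suc k) * real n) sequentially"
        by blast
      then have "eventually (\<lambda>n. norm (1 / real n * (ln (op_norm (mat_prod A n)) - expected_log_norm \<mu> n) - 0) < e) sequentially"
        using eventually_gt_at_top[of 0]
      proof eventually_elim
        case (elim n)
        then have "\<bar>ln (op_norm (mat_prod A n)) - expected_log_norm \<mu> n\<bar> / real n \<le> 1 / real (Suc k)"
          by (simp add: divide_le_eq)
        with k show ?case by (simp add: abs_mult)
      qed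
      then show "\<exists>no. \<forall>n\<ge>no. norm (1 / real n * (ln (op_norm (mat_prod A n)) - expected_log_norm \<mu> n) - 0) < e"
        unfolding eventually_sequentially .
    qed
  qed
qed

end

section \<open>The theorem\<close>

lemma expected_log_norm_cong:
  assumes "\<And>i. i \<in> {1..n} \<Longrightarrow> \<mu> i = \<mu>' i"
  shows "expected_log_norm \<mu> n = expected_log_norm \<mu>' n"
proof -
  have "(\<Pi>\<^sub>M i\<in>{1..n}. \<mu> i) = (\<Pi>\<^sub>M i\<in>{1..n}. \<mu>' i)" by (rule PiM_cong) (use assms in auto)
  then show ?thesis by (simp only: expected_log_norm_def)
qed

theorem theorem1p1:
  fixes K :: "(real ^ 'n ^ 'n) measure set"
  assumes dim: "CARD('n) \<ge> 2"
    and compact: "compactin (weak_topology (top_of_set SL)) K"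
    and moment: "\<exists>\<gamma>>0. \<exists>C::real. \<forall>\<mu>\<in>K. (\<integral>\<^sup>+A. ennreal (op_norm A powr \<gamma>) \<partial>\<mu>) < ennreal C"
    and measures: "\<forall>\<mu>\<in>K. \<not> (\<exists>\<nu>\<^sub>1 \<in> borel_prob_measures proj_topology.
        \<exists>\<nu>\<^sub>2 \<in> borel_prob_measures proj_topology.
          AE A in \<mu>. distr \<nu>\<^sub>1 (borel_of proj_topology) (proj_map A) = \<nu>\<^sub>2)"
    and spaces: "\<forall>\<mu>\<in>K. \<not> (\<exists>U U'. union_of_proper_subspaces U \<and> union_of_proper_subspaces U' \<and>
        (AE A in \<mu>. (*v) A ` U = U'))"
  shows "(\<exists>lam>0::real. \<forall>n. \<forall>\<mu>. (\<forall>i\<in>{1..n}. \<mu> i \<in> K) \<longrightarrow> expected_log_norm \<mu> n \<ge> real n * lam) \<and>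
    (\<forall>\<mu>. (\<forall>i\<in>{1..}. \<mu> i \<in> K) \<longrightarrow>
      (AE A in (\<Pi>\<^sub>M i\<in>{1..}. \<mu> i).
        (\<lambda>n. 1 / real n * (ln (op_norm (mat_prod A n)) - expected_log_norm \<mu> n)) \<longlonglongrightarrow> 0))"
proof -
  obtain \<gamma> C where \<gamma>: "0 < \<gamma>" and C: "\<And>\<mu>. \<mu> \<in> K \<Longrightarrow> (\<integral>\<^sup>+A. ennreal (op_norm A powr \<gamma>) \<partial>\<mu>) < ennreal C"
    using moment by blast
  interpret compact_moment K \<gamma> C
    by unfold_locales (use compact \<gamma> C in \<open>auto intro: less_imp_le\<close>)
  interpret no_common_image K \<gamma> C
    by unfold_locales (use measures in blast)
  interpret strongly_irreducible K \<gamma> C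
    by unfold_locales (use spaces in blast)
  obtain lam where lam: "0 < lam" "\<And>\<mu> n. (\<forall>i. \<mu> i \<in> K) \<Longrightarrow> real n * lam \<le> expected_log_norm \<mu> n"
    using expected_log_norm_growth by blast
  have "real n * lam \<le> expected_log_norm \<mu> n" if \<mu>: "\<forall>i\<in>{1..n}. \<mu> i \<in> K" for n \<mu>
  proof (cases "n = 0")
    case True
    have "mat_prod A 0 \<in> SL" for A :: "nat \<Rightarrow> real ^ 'n ^ 'n" by (simp add: SL_mat_1)
    then have "0 \<le> ln (op_norm (mat_prod A 0))" for A :: "nat \<Rightarrow> real ^ 'n ^ 'n" by (rule ln_op_norm_nonneg)
    then have "0 \<le> expected_log_norm \<mu> 0"
      unfolding expected_log_norm_def by (intro integral_nonneg_AE AE_I2)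
    then show ?thesis using True by simp
  next
    case False
    \<comment> \<open>The results above are about sequences with all terms in \<open>K\<close>; the first \<open>n\<close> laws are extended
      to such a sequence.\<close>
    define \<mu>' where "\<mu>' i = (if i \<in> {1..n} then \<mu> i else \<mu> 1)" for i
    have "\<mu>' i \<in> K" for i using \<mu> False by (auto simp: \<mu>'_def)
    then have "real n * lam \<le> expected_log_norm \<mu>' n" using lam(2) by blast
    also have "\<dots> = expected_log_norm \<mu> n" by (rule expected_log_norm_cong) (simp add: \<mu>'_def)
    finally show ?thesis .
  qed
  moreover have "AE A in (\<Pi>\<^sub>M i\<in>{1..}. \<mu> i).
      (\<lambda>n. 1 / real n * (ln (op_norm (mat_prod A n)) - expected_log_norm \<mu> n)) \<longlonglongrightarrow> 0"
    if \<mu>: "\<forall>i\<in>{1..}. \<mu> i \<in> K" for \<mu>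
  proof -
    \<comment> \<open>The law with index 0, which may lie outside \<open>K\<close>, enters neither the product measure nor the
      expectations.\<close>
    define \<mu>' where "\<mu>' i = (if 1 \<le> i then \<mu> i else \<mu> 1)" for i :: nat
    have "\<mu>' i \<in> K" for i using \<mu> by (auto simp: \<mu>'_def)
    from log_norm_law_of_large_numbers[of \<mu>', OF this] have
      "AE A in (\<Pi>\<^sub>M i\<in>{1..}. \<mu>' i).
        (\<lambda>n. 1 / real n * (ln (op_norm (mat_prod A n)) - expected_log_norm \<mu>' n)) \<longlonglongrightarrow> 0" .
    moreover have "(\<Pi>\<^sub>M i\<in>{1..}. \<mu>' i) = (\<Pi>\<^sub>M i\<in>{1..}. \<mu> i)" by (rule PiM_cong) (auto simp: \<mu>'_def)
    moreover have "expected_log_norm \<mu>' = expected_log_norm \<mu>"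
      by (intro ext expected_log_norm_cong) (simp add: \<mu>'_def)
    ultimately show ?thesis by (simp only:)
  qed
  ultimately show ?thesis using lam(1) by blast
qed

end
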